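(* Let $X$ be a real or complex Banach space with norm $|\cdot|$, and let $r\in\mathbb{N}\cup\{\infty,\omega\}$, with $r=\omega$ if $X$ is complex. Let $\varphi$ be a local semiflow on $X$ with domain $\mathcal{D}^\varphi\subset\mathbb{R}^{\ge0}\times X$ and with a fixed point at $0$ that is Lyapunov stable with respect to $|\cdot|$, such that, for some fixed open neighborhood $O$ of $0$ and each fixed $t\ge0$, the map $x\mapsto\varphi_t(x)$ is of class $C^r_b$ on $\mathcal{D}^\varphi_t\cap O$. Suppose $t\mapsto D\varphi_t(0)$ is an analytic semigroup on $X$ with generator $G$ satisfying $\sigma(G)\subset\{\mu\in\mathbb{C}:\mathrm{Re}\,\mu<0\}$. If $\psi$ is a $C^r_b$ Koopman eigenfunction with eigenvalue $\lambda$ at $0$ such that there exists an integer $\ell<r$ for which $$(\ell+1)\sup\{\mathrm{Re}\,\mu:\mu\in\sigma(G)\}<\mathrm{Re}\,\lambda$$ holds, then $\lambda\in n\,\sigma(G)$ for some $1\le n\le\ell$.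
   Context: A local semiflow on $X$ is a map $\varphi:\mathcal{D}^\varphi\to X$, with $\mathcal{D}^\varphi\subset\mathbb{R}^{\ge0}\times X$ open and containing $\{0\}\times X$, satisfying $\varphi_0=\mathrm{id}_X$ and $\varphi_t\circ\varphi_s=\varphi_{t+s}$ wherever defined; $\mathcal{D}^\varphi_t=\{x\in X:(t,x)\in\mathcal{D}^\varphi\}$. $D$ denotes the Fréchet derivative (in space). The ordering of $\mathbb{N}$ is extended by $\mathbb{N}<\infty<\omega$. $C^r_b$ ($r\in\mathbb{N}$): $r$-times differentiable maps whose derivatives of order $0,\dots,r$ are bounded and continuous; $C^\infty_b=\bigcap_{r\in\mathbb{N}}C^r_b$; $C^\omega_b$: bounded complex analytic maps (when $X$ is complex). $\sigma(\cdot)$ is the spectrum (of the complexification for real spaces). For $\Lambda\subset\mathbb{C}$, $n\Lambda=\Lambda+\cdots+\Lambda$ ($n$-fold Minkowski sum). Semigroups are assumed strongly continuous, so their infinitesimal generators are closed and densely defined; a semigroup $T_t$ is analytic if $t\mapsto T_tx$ extends holomorphically to a cone about the positive real axis for every $x$, equivalently if its generator is sectorial. Koopman eigenfunctions: let $O'\subset X$ be open and $\mathcal{O}=\{(t,x)\in\mathbb{R}^{\ge0}\times O':\varphi_s(x)\in O'\text{ for all }s\in[0,t]\}$. Let $\mathbb{F}=\mathbb{C}$, except that $\mathbb{F}=\mathbb{R}$ when both $X$ and $\lambda$ are real. A function $\psi:O'\to\mathbb{F}$, not identically zero, is called a Koopman eigenfunction with eigenvalue $\lambda\in\mathbb{C}$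 if $\mathcal{O}=\mathbb{R}^{\ge0}\times O'$ and $\psi(\varphi_t(x))=e^{\lambda t}\psi(x)$ for all $(t,x)\in\mathcal{O}$. "At $0$" means that the domain $O'$ contains the fixed point $0$.
   Formalization: The eigenfunction ψ is additionally assumed not to be constant on any neighborhood of 0; otherwise the claim fails, e.g. for ψ = 1, λ = 0, X = ℝ, φ_t(x) = e^{-t}x, ℓ = 1, or for ψ vanishing near 0 but not at points of O' outside the basin of 0. *)

theory Defs
  imports "HOL-Analysis.Analysis"
begin

section \<open>Real and complex Banach spaces\<close>

text \<open>
  Every Banach space is a type of class \<^class>\<open>banach\<close>, hence a real one. A complex Banach space
  is such a type together with a scalar multiplication by complex numbers that extends the real
  one and for which the given norm is homogeneous.
\<close>

datatype 'a scalars = Real_Scalars | Complex_Scalars "complex \<Rightarrow> 'a \<Rightarrow> 'a"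

definition complex_scaling :: "(complex \<Rightarrow> 'a::real_normed_vector \<Rightarrow> 'a) \<Rightarrow> bool" where
  "complex_scaling sc \<longleftrightarrow>
     vector_space sc \<and>
     (\<forall>r x. sc (complex_of_real r) x = r *\<^sub>R x) \<and>
     (\<forall>c x. norm (sc c x) = cmod c * norm x)"

definition admissible_scalars :: "'a::real_normed_vector scalars \<Rightarrow> bool" where
  "admissible_scalars K = (case K of Real_Scalars \<Rightarrow> True | Complex_Scalars sc \<Rightarrow> complex_scaling sc)"

text \<open>
  The scalars acting on the target \<^typ>\<open>complex\<close> of an eigenfunction: over a real space the complex
  plane counts as a real space.
\<close>

definition target_scalars :: "'a scalars \<Rightarrow> complex scalars" where
  "target_scalars K = (case K of Real_Scalars \<Rightarrow> Real_Scalars | Complex_Scalars _ \<Rightarrow> Complex_Scalars (*))"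

definition linear_over ::
    "'a::real_normed_vector scalars \<Rightarrow> 'b::real_normed_vector scalars \<Rightarrow> ('a \<Rightarrow> 'b) \<Rightarrow> bool" where
  "linear_over K L f =
     (case (K, L) of
        (Complex_Scalars s, Complex_Scalars s') \<Rightarrow> Vector_Spaces.linear s s' f
      | _ \<Rightarrow> linear f)"

section \<open>Smoothness classes\<close>

datatype smoothness = Finite_Order nat | Smooth | Analytic

fun below_order :: "int \<Rightarrow> smoothness \<Rightarrow> bool" where
  "below_order l (Finite_Order n) \<longleftrightarrow> l < int n"
| "below_order l Smooth \<longleftrightarrow> True"
| "below_order l Analytic \<longleftrightarrow> True"

text \<open>
  A \<open>k\<close>-linear map is a function on lists, of which only the values on lists of length \<open>k\<close> matter.
  The predicate \<open>multi_bound k M c\<close> says that the operator norm of \<open>M\<close> is at most \<open>c\<close>.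
\<close>

definition multilinear_over ::
    "'a::real_normed_vector scalars \<Rightarrow> 'b::real_normed_vector scalars \<Rightarrow> nat \<Rightarrow> ('a list \<Rightarrow> 'b) \<Rightarrow> bool" where
  "multilinear_over K L k M \<longleftrightarrow>
     (\<forall>vs i. length vs = k \<longrightarrow> i < k \<longrightarrow> linear_over K L (\<lambda>v. M (vs[i := v])))"

definition multi_bound :: "nat \<Rightarrow> ('a::real_normed_vector list \<Rightarrow> 'b::real_normed_vector) \<Rightarrow> real \<Rightarrow> bool" where
  "multi_bound k M c \<longleftrightarrow> (\<forall>vs. length vs = k \<longrightarrow> norm (M vs) \<le> c * (\<Prod>v\<leftarrow>vs. norm v))"

text \<open>
  \<open>F k x\<close> is the \<open>k\<close>-th Frechet derivative of \<open>f\<close> at \<open>x\<close>, for all \<open>k \<le> n\<close>: as a map from \<open>U\<close> to the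
  \<open>k\<close>-linear maps with the operator norm, \<open>F k\<close> has at \<open>x\<close> the Frechet derivative that sends
  \<open>h\<close> to the \<open>k\<close>-linear map \<open>vs \<mapsto> F (Suc k) x (h # vs)\<close>. The set \<open>U\<close> is meant to be open.
\<close>

definition frechet_derivatives ::
    "nat \<Rightarrow> 'a::real_normed_vector set \<Rightarrow> ('a \<Rightarrow> 'b::real_normed_vector) \<Rightarrow> (nat \<Rightarrow> 'a \<Rightarrow> 'a list \<Rightarrow> 'b) \<Rightarrow> bool" where
  "frechet_derivatives n U f F \<longleftrightarrow>
     (\<forall>x\<in>U. F 0 x [] = f x) \<and>
     (\<forall>k\<le>n. \<forall>x\<in>U. multilinear_over Real_Scalars Real_Scalars k (F k x) \<and> (\<exists>c. multi_bound k (F k x) c)) \<and>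
     (\<forall>k<n. \<forall>x\<in>U. \<forall>e>0. \<forall>\<^sub>F h in nhds 0.
        multi_bound k (\<lambda>vs. F k (x + h) vs - F k x vs - F (Suc k) x (h # vs)) (e * norm h))"

definition Cb_finite ::
    "nat \<Rightarrow> 'a::real_normed_vector set \<Rightarrow> ('a \<Rightarrow> 'b::real_normed_vector) \<Rightarrow> bool" where
  "Cb_finite n U f \<longleftrightarrow>
     (\<exists>F. frechet_derivatives n U f F \<and>
          (\<forall>k\<le>n. \<exists>c. \<forall>x\<in>U. multi_bound k (F k x) c) \<and>
          (\<forall>k\<le>n. \<forall>x\<in>U. \<forall>e>0. \<forall>\<^sub>F y in nhds x. multi_bound k (\<lambda>vs. F k y vs - F k x vs) e))"

text \<open>
  Analytic: locally the sum of a power series \<open>\<Sum>k. P k (h, \<dots>, h)\<close> of bounded multilinear maps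
  with positive radius of convergence. Over a complex space the maps \<open>P k\<close> are complex multilinear,
  so this is complex analyticity; over a real space it is real analyticity.
\<close>

definition analytic_over ::
    "'a::real_normed_vector scalars \<Rightarrow> 'b::real_normed_vector scalars \<Rightarrow> 'a set \<Rightarrow> ('a \<Rightarrow> 'b) \<Rightarrow> bool" where
  "analytic_over K L U f \<longleftrightarrow>
     (\<forall>x\<in>U. \<exists>\<rho>>0. \<exists>P c.
        (\<forall>k. multilinear_over K L k (P k) \<and> 0 \<le> c k \<and> multi_bound k (P k) (c k)) \<and>
        summable (\<lambda>k. c k * \<rho> ^ k) \<and>
        (\<forall>h. norm h < \<rho> \<and> x + h \<in> U \<longrightarrow> (\<lambda>k. P k (replicate k h)) sums f (x + h)))"

definition Cb ::
    "'a::real_normed_vector scalars \<Rightarrow> 'b::real_normed_vector scalars \<Rightarrow> smoothness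
      \<Rightarrow> 'a set \<Rightarrow> ('a \<Rightarrow> 'b) \<Rightarrow> bool" where
  "Cb K L r U f =
     (case r of
        Finite_Order n \<Rightarrow> Cb_finite n U f
      | Smooth \<Rightarrow> (\<forall>n. Cb_finite n U f)
      | Analytic \<Rightarrow> analytic_over K L U f \<and> bounded (f ` U))"

section \<open>Local semiflows\<close>

text \<open>
  The semiflow identity is required only where both of its sides are defined.
\<close>

definition local_semiflow :: "(real \<times> 'a::real_normed_vector) set \<Rightarrow> (real \<Rightarrow> 'a \<Rightarrow> 'a) \<Rightarrow> bool" where
  "local_semiflow \<D> \<phi> \<longleftrightarrow>
     openin (top_of_set ({0..} \<times> UNIV)) \<D> \<and>
     {0} \<times> UNIV \<subseteq> \<D> \<and>
     (\<forall>x. \<phi> 0 x = x) \<and>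
     (\<forall>s t x. (s, x) \<in> \<D> \<longrightarrow> (t, \<phi> s x) \<in> \<D> \<longrightarrow> (t + s, x) \<in> \<D> \<longrightarrow> \<phi> t (\<phi> s x) = \<phi> (t + s) x)"

definition time_section :: "(real \<times> 'a) set \<Rightarrow> real \<Rightarrow> 'a set" where
  "time_section \<D> t = {x. (t, x) \<in> \<D>}"

definition fixed_point :: "(real \<times> 'a) set \<Rightarrow> (real \<Rightarrow> 'a \<Rightarrow> 'a) \<Rightarrow> 'a \<Rightarrow> bool" where
  "fixed_point \<D> \<phi> p \<longleftrightarrow> (\<forall>t\<ge>0. (t, p) \<in> \<D> \<and> \<phi> t p = p)"

definition lyapunov_stable ::
    "(real \<times> 'a::real_normed_vector) set \<Rightarrow> (real \<Rightarrow> 'a \<Rightarrow> 'a) \<Rightarrow> 'a \<Rightarrow> bool" where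
  "lyapunov_stable \<D> \<phi> p \<longleftrightarrow>
     (\<forall>e>0. \<exists>d>0. \<forall>x. norm (x - p) < d \<longrightarrow> (\<forall>t. (t, x) \<in> \<D> \<longrightarrow> norm (\<phi> t x - p) < e))"

definition koopman_domain :: "(real \<times> 'a) set \<Rightarrow> (real \<Rightarrow> 'a \<Rightarrow> 'a) \<Rightarrow> 'a set \<Rightarrow> (real \<times> 'a) set" where
  "koopman_domain \<D> \<phi> V =
     {(t, x). 0 \<le> t \<and> x \<in> V \<and> (\<forall>s\<in>{0..t}. (s, x) \<in> \<D> \<and> \<phi> s x \<in> V)}"

text \<open>
  Eigenfunctions always have values in \<^typ>\<open>complex\<close>; if the space and the eigenvalue are
  both real, the values are required to be real.
\<close>

definition koopman_eigenfunction ::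
    "'a::real_normed_vector scalars \<Rightarrow> (real \<times> 'a) set \<Rightarrow> (real \<Rightarrow> 'a \<Rightarrow> 'a)
      \<Rightarrow> 'a set \<Rightarrow> ('a \<Rightarrow> complex) \<Rightarrow> complex \<Rightarrow> bool" where
  "koopman_eigenfunction K \<D> \<phi> V \<psi> \<mu> \<longleftrightarrow>
     open V \<and>
     (K = Real_Scalars \<and> \<mu> \<in> \<real> \<longrightarrow> (\<forall>x\<in>V. \<psi> x \<in> \<real>)) \<and>
     (\<exists>x\<in>V. \<psi> x \<noteq> 0) \<and>
     koopman_domain \<D> \<phi> V = {0..} \<times> V \<and>
     (\<forall>(t, x) \<in> koopman_domain \<D> \<phi> V. \<psi> (\<phi> t x) = exp (\<mu> * complex_of_real t) * \<psi> x)"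

text \<open>
  This notion admits two kinds of eigenfunctions that say nothing about the linearization at a
  stable fixed point in \<open>V\<close>: nonzero constants (with eigenvalue 0), and functions that vanish near
  the fixed point but not at points of \<open>V\<close> outside its basin. The theorem excludes both by
  requiring that the eigenfunction is not constant near the fixed point.
\<close>

section \<open>Unbounded operators and their spectra\<close>

text \<open>An unbounded operator is given by its domain \<open>S\<close> and a function \<open>A\<close>, used only on \<open>S\<close>.\<close>

definition op_spectrum ::
    "(complex \<Rightarrow> 'a::real_normed_vector \<Rightarrow> 'a) \<Rightarrow> 'a set \<Rightarrow> ('a \<Rightarrow> 'a) \<Rightarrow> complex set" where
  "op_spectrum sc S A =
     {\<mu>. \<not> (bij_betw (\<lambda>x. sc \<mu> x - A x) S UNIV \<and>
            bounded_linear (the_inv_into S (\<lambda>x. sc \<mu> x - A x)))}"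

text \<open>
  The complexification of a real space, \<open>(x, y)\<close> standing for \<open>x + \<i>y\<close>. The product norm is
  in general not complex-homogeneous, but it is equivalent to one that is; only its topology is used.
\<close>

definition complexification_scale :: "complex \<Rightarrow> 'a::real_vector \<times> 'a \<Rightarrow> 'a \<times> 'a" where
  "complexification_scale c = (\<lambda>(x, y). (Re c *\<^sub>R x - Im c *\<^sub>R y, Im c *\<^sub>R x + Re c *\<^sub>R y))"

definition spectrum_over ::
    "'a::real_normed_vector scalars \<Rightarrow> 'a set \<Rightarrow> ('a \<Rightarrow> 'a) \<Rightarrow> complex set" where
  "spectrum_over K S A =
     (case K of
        Real_Scalars \<Rightarrow> op_spectrum complexification_scale (S \<times> S) (map_prod A A)
      | Complex_Scalars sc \<Rightarrow> op_spectrum sc S A)"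

definition minkowski_multiple :: "nat \<Rightarrow> 'a::comm_monoid_add set \<Rightarrow> 'a set" where
  "minkowski_multiple n \<Lambda> = {sum_list ms | ms. length ms = n \<and> set ms \<subseteq> \<Lambda>}"

section \<open>Semigroups\<close>

definition c0_semigroup :: "'a::real_normed_vector scalars \<Rightarrow> (real \<Rightarrow> 'a \<Rightarrow> 'a) \<Rightarrow> bool" where
  "c0_semigroup K T \<longleftrightarrow>
     (\<forall>t\<ge>0. bounded_linear (T t) \<and> linear_over K K (T t)) \<and>
     (\<forall>x. T 0 x = x) \<and>
     (\<forall>s\<ge>0. \<forall>t\<ge>0. \<forall>x. T (s + t) x = T s (T t x)) \<and>
     (\<forall>x. ((\<lambda>t. T t x) \<longlongrightarrow> x) (at_right 0))"

definition generates ::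
    "(real \<Rightarrow> 'a::real_normed_vector \<Rightarrow> 'a) \<Rightarrow> 'a set \<Rightarrow> ('a \<Rightarrow> 'a) \<Rightarrow> bool" where
  "generates T S G \<longleftrightarrow>
     S = {x. \<exists>y. ((\<lambda>t. (T t x - x) /\<^sub>R t) \<longlongrightarrow> y) (at_right 0)} \<and>
     (\<forall>x\<in>S. ((\<lambda>t. (T t x - x) /\<^sub>R t) \<longlongrightarrow> G x) (at_right 0))"

definition cone :: "real \<Rightarrow> complex set" where
  "cone \<delta> = {z. 0 < Re z \<and> \<bar>Im z\<bar> < \<delta> * Re z}"

definition vector_holomorphic_on ::
    "(complex \<Rightarrow> 'a::real_normed_vector \<Rightarrow> 'a) \<Rightarrow> (complex \<Rightarrow> 'a) \<Rightarrow> complex set \<Rightarrow> bool" where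
  "vector_holomorphic_on sc F U \<longleftrightarrow>
     (\<forall>z\<in>U. \<exists>d. (F has_derivative (\<lambda>h. sc h d)) (at z))"

definition analytic_semigroup :: "'a::real_normed_vector scalars \<Rightarrow> (real \<Rightarrow> 'a \<Rightarrow> 'a) \<Rightarrow> bool" where
  "analytic_semigroup K T \<longleftrightarrow>
     c0_semigroup K T \<and>
     (\<exists>\<delta>>0. \<forall>x.
        case K of
          Real_Scalars \<Rightarrow>
            (\<exists>F. vector_holomorphic_on complexification_scale F (cone \<delta>) \<and>
                 (\<forall>t>0. F (complex_of_real t) = (T t x, 0)))
        | Complex_Scalars sc \<Rightarrow>
            (\<exists>F. vector_holomorphic_on sc F (cone \<delta>) \<and>
                 (\<forall>t>0. F (complex_of_real t) = T t x)))"

end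

theory Submission
  imports Defs "HOL-Library.Function_Algebras"
begin

text \<open>
  Write \<open>p\<close> for the first nonvanishing homogeneous term of positive degree in the Taylor expansion of
  \<open>\<psi>\<close> at \<open>0\<close>. Comparing the leading terms of \<open>\<psi> (\<phi> t x) - \<psi> 0 = exp (\<kappa> t) (\<psi> x - \<psi> 0)\<close> gives
  \<open>p (T t x) = exp (\<kappa> t) p x\<close>. If the degree \<open>n\<close> of \<open>p\<close> is at most \<open>l\<close>, then polarizing \<open>p\<close> yields a
  nonzero \<open>n\<close>-linear form \<open>P\<close> with \<open>P (T t v\<^sub>1, \<dots>, T t v\<^sub>n) = exp (\<kappa> t) P (v\<^sub>1, \<dots>, v\<^sub>n)\<close>. Formally
  \<open>\<kappa>\<close> is then an eigenvalue of the sum of the \<open>n\<close> commuting operators "\<open>G\<close> acting in slot \<open>i\<close>", and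
  therefore a sum of \<open>n\<close> spectral values of \<open>G\<close>. If there is no such term up to degree \<open>l\<close>, then
  \<open>\<psi> x - \<psi> 0 = O(norm x ^ (l + 1))\<close>, whereas orbits near \<open>0\<close> contract like \<open>exp (q t)\<close> for every negative
  \<open>q > sup (Re \<sigma>(G))\<close>. The hypothesis on \<open>(l + 1) sup (Re \<sigma>(G))\<close> allows a choice of \<open>q\<close> for which
  \<open>\<psi> x - \<psi> 0 = exp (- \<kappa> t) (\<psi> (\<phi> t x) - \<psi> 0)\<close> tends to \<open>0\<close>, so that \<open>\<psi>\<close> is constant near \<open>0\<close>.

  Two facts about the unbounded operator \<open>G\<close> carry this argument: the additivity of spectra over the
  slots of a form, and the bound of the growth of the semigroup by the spectrum of its generator.
  Both come from one device. The bounded operators \<open>T 1\<close> and \<open>D = G \<circ> T 1\<close> commute, and a pair of joint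
  approximate eigenvalues \<open>\<tau> \<noteq> 0\<close> and \<open>d\<close> of them determines \<open>\<mu> = d / \<tau>\<close>, which lies in the spectrum
  of \<open>G\<close> (\<open>joint_eigenvalue_in_spectrum\<close>) and satisfies \<open>\<tau> = exp \<mu>\<close> (\<open>joint_eigenvalue_exp\<close>);
  on the corresponding approximate eigenvectors \<open>T t\<close> acts like \<open>exp (\<mu> t)\<close> for all \<open>t \<in> {1..2}\<close>
  (\<open>joint_eigenvalue_semigroup\<close>).

  For an invariant form, joint approximate eigenvalues of \<open>T 1\<close> and \<open>D\<close> in all slots simultaneously give
  \<open>exp (\<kappa> t) = exp ((\<mu>\<^sub>1 + \<dots> + \<mu>\<^sub>n) t)\<close> on an interval of times, hence \<open>\<kappa> = \<mu>\<^sub>1 + \<dots> + \<mu>\<^sub>n\<close>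
  (\<open>invariant_form_eigenvalue\<close>). For the growth bound, the forms are linear maps from \<open>X\<close> to \<open>X\<close> or to its
  complexification, which is why forms with values in a vector space are considered: if \<open>T k\<close> grew
  faster than \<open>exp (q k)\<close>, then \<open>T 1\<close> would have an approximate eigenvalue \<open>\<tau> = exp \<mu>\<close> with
  \<open>Re \<mu> \<ge> q\<close> (\<open>slot_growth\<close>).

  Approximate eigenvalues exist in every seminormed space, complete or not
  (\<open>approximate_eigenvalue_exists\<close>, \<open>approximate_eigenvalue_outside\<close>). This allows passing to spaces of
  sequences of approximate eigenvectors, seminormed by the limit superior, in which approximate
  eigenvectors become exact ones; further commuting operators are then added one by one
  (\<open>approximate_eigenvalue_extend\<close>).
\<close>

section \<open>Growth of powers and approximate eigenvalues\<close>

text \<open>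
  Orthogonality of the characters \<open>q \<mapsto> \<omega>\<^sup>q\<^sup>a\<close> of the cyclic group of order \<open>L\<close>; averaging over roots of
  unity will take the place of Cauchy's coefficient formula.
\<close>

lemma sum_roots_of_unity:
  fixes a b L :: nat
  assumes "a < L" "b < L"
  shows "(\<Sum>q<L. cis (2 * pi * real q * (real a - real b) / real L))
         = (if a = b then of_nat L else 0)"
proof (cases "a = b")
  case False
  define w where "w = cis (2 * pi * (real a - real b) / real L)"
  have L: "L > 0" using assms by simp
  have pow: "cis (2 * pi * real q * (real a - real b) / real L) = w ^ q" for q
  proof -
    have "2 * pi * real q * (real a - real b) / real L = real q * (2 * pi * (real a - real b) / real L)"
      by simp
    then show ?thesis unfolding w_def by (simp only: Complex.DeMoivre)
  qed
  have wL: "w ^ L = 1"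
  proof -
    have "w ^ L = cis (2 * pi * (real a - real b))"
      unfolding w_def Complex.DeMoivre using L by simp
    also have "\<dots> = 1"
      by (rule cis_multiple_2pi) simp
    finally show ?thesis .
  qed
  have w1: "w \<noteq> 1"
  proof
    assume "w = 1"
    then have "cos (2 * pi * (real a - real b) / real L) = 1"
      by (simp add: w_def complex_eq_iff)
    then obtain n :: int where n: "2 * pi * (real a - real b) / real L = of_int n * 2 * pi"
      by (auto simp: cos_one_2pi_int)
    then have "pi * (2 * (real a - real b)) = pi * (2 * (of_int n * real L))"
      using L by (simp add: field_simps)
    then have "real a - real b = of_int n * real L"
      by simp
    then have eq: "int a - int b = n * int L"
      by (metis of_int_diff of_int_eq_iff of_int_mult of_int_of_nat_eq)
    have "\<bar>n * int L\<bar> < int L" using eq assms by linarith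
    then have "n = 0"
      using L by (simp add: abs_mult)
    then show False using eq False by simp
  qed
  have "(\<Sum>q<L. w ^ q) = (1 - w ^ L) / (1 - w)"
    using w1 by (simp add: sum_gp_strict)
  then show ?thesis using False wL by (simp add: pow)
qed auto

text \<open>
  The seminorm is homogeneous only up to the constant \<open>h\<close>. The reason is the complexification of a real
  space: its product norm is equivalent to a complex norm without being one.
\<close>

locale complex_seminormed_space = vector_space sc
  for sc :: "complex \<Rightarrow> 'e::ab_group_add \<Rightarrow> 'e" +
  fixes E :: "'e set" and N :: "'e \<Rightarrow> real" and h :: real
  assumes subspace_E: "subspace E"
    and N_nonneg: "x \<in> E \<Longrightarrow> 0 \<le> N x"
    and N_triangle: "x \<in> E \<Longrightarrow> y \<in> E \<Longrightarrow> N (x + y) \<le> N x + N y"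
    and N_scale: "x \<in> E \<Longrightarrow> N (sc c x) \<le> h * cmod c * N x"
    and h_pos: "0 < h"
begin

lemmas E_intros = subspace_0[OF subspace_E] subspace_add[OF subspace_E]
  subspace_diff[OF subspace_E] subspace_scale[OF subspace_E] subspace_sum[OF subspace_E]

lemma N_zero: "N 0 = 0"
  using N_scale[of 0 0] N_nonneg[of 0] by (simp add: E_intros)

lemma N_sum:
  assumes "finite I" "\<And>i. i \<in> I \<Longrightarrow> f i \<in> E"
  shows "N (sum f I) \<le> (\<Sum>i\<in>I. N (f i))"
  using assms
proof (induction I rule: finite_induct)
  case empty
  then show ?case by (simp add: N_zero)
next
  case (insert i I)
  have "N (f i + sum f I) \<le> N (f i) + N (sum f I)"
    using insert by (intro N_triangle E_intros) auto
  moreover have "N (sum f I) \<le> (\<Sum>i\<in>I. N (f i))"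
    using insert by auto
  ultimately show ?case using insert(1,2) by simp
qed

lemma N_diff:
  assumes "x \<in> E" "y \<in> E"
  shows "N (x - y) \<le> N x + h * N y"
proof -
  have "N (x + sc (-1) y) \<le> N x + N (sc (-1) y)"
    using assms by (intro N_triangle E_intros)
  moreover have "N (sc (-1) y) \<le> h * N y"
    using N_scale[OF assms(2), of "-1"] by simp
  ultimately show ?thesis by simp
qed

lemma N_unscale:
  assumes "x \<in> E"
  shows "cmod c * N x \<le> h * N (sc c x)"
proof (cases "c = 0")
  case False
  have "N x = N (sc (1 / c) (sc c x))" using False by simp
  also have "\<dots> \<le> h * cmod (1 / c) * N (sc c x)"
    using assms by (intro N_scale E_intros)
  finally show ?thesis using False by (simp add: norm_divide field_simps)
qed (use assms N_nonneg[OF subspace_0[OF subspace_E]] h_pos in simp)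

text \<open>
  Cauchy's estimate for a polynomial \<open>\<Sum>\<^sub>i z ^ e i y\<^sub>i\<close> with coefficients in the space: the coefficient of
  \<open>z ^ k\<close> is the mean of \<open>z ^ (-k)\<close> times the polynomial over sufficiently many equidistributed points
  of the circle of radius \<open>t\<close>. Several indices \<open>i\<close> may contribute to the same power.
\<close>

lemma coefficient_bound:
  assumes "finite I" and y: "\<And>i. i \<in> I \<Longrightarrow> y i \<in> E"
    and C: "\<And>z. cmod z = t \<Longrightarrow> N (\<Sum>i\<in>I. sc (z ^ e i) (y i)) \<le> C"
    and "0 < t"
  shows "t ^ k * N (\<Sum>i\<in>{i\<in>I. e i = k}. y i) \<le> h ^ 3 * C"
proof -
  define L where "L = Suc (Max (insert k (e ` I)))"
  have eL: "e i < L" if "i \<in> I" for i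
    unfolding L_def using that assms(1) by (simp add: less_Suc_eq_le)
  have kL: "k < L" unfolding L_def using assms(1) by (simp add: less_Suc_eq_le)
  define z where "z q = of_real t * cis (2 * pi * real q / real L)" for q :: nat
  define Y where "Y q = sc (cis (- (2 * pi * real q * real k / real L))) (\<Sum>i\<in>I. sc (z q ^ e i) (y i))" for q
  have zE: "(\<Sum>i\<in>I. sc (z q ^ e i) (y i)) \<in> E" for q
    using y by (intro E_intros)
  have YE: "Y q \<in> E" for q
    unfolding Y_def by (intro E_intros zE)
  have NY: "N (Y q) \<le> h * C" for q
  proof -
    have "N (Y q) \<le> h * N (\<Sum>i\<in>I. sc (z q ^ e i) (y i))"
      unfolding Y_def using N_scale[OF zE, of "cis _"] by simp
    also have "\<dots> \<le> h * C"
      using C[of "z q"] h_pos \<open>0 < t\<close> by (simp add: z_def norm_mult)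
    finally show ?thesis .
  qed
  have coef: "cis (- (2 * pi * real q * real k / real L)) * z q ^ j
      = of_real t ^ j * cis (2 * pi * real q * (real j - real k) / real L)" for q j
  proof -
    have "z q ^ j = of_real t ^ j * cis (real j * (2 * pi * real q / real L))"
      by (simp only: z_def power_mult_distrib Complex.DeMoivre)
    then have "cis (- (2 * pi * real q * real k / real L)) * z q ^ j
       = of_real t ^ j * (cis (- (2 * pi * real q * real k / real L)) * cis (real j * (2 * pi * real q / real L)))"
      by (simp only: mult.left_commute)
    also have "cis (- (2 * pi * real q * real k / real L)) * cis (real j * (2 * pi * real q / real L))
       = cis (- (2 * pi * real q * real k / real L) + real j * (2 * pi * real q / real L))"
      by (rule cis_mult)
    also have "- (2 * pi * real q * real k / real L) + real j * (2 * pi * real q / real L)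
       = 2 * pi * real q * (real j - real k) / real L"
      by (simp add: diff_divide_distrib right_diff_distrib)
    finally show ?thesis .
  qed
  have "(\<Sum>q<L. Y q) = (\<Sum>i\<in>I. sc (\<Sum>q<L. cis (- (2 * pi * real q * real k / real L)) * z q ^ e i) (y i))"
    unfolding Y_def by (simp add: scale_sum_right scale_sum_left sum.swap[of _ _ I])
  also have "\<dots> = (\<Sum>i\<in>I. sc (of_real t ^ e i * (if e i = k then of_nat L else 0)) (y i))"
    by (intro sum.cong refl) (simp only: coef sum_distrib_left[symmetric] sum_roots_of_unity[OF eL kL])
  also have "\<dots> = (\<Sum>i\<in>{i\<in>I. e i = k}. sc (of_real t ^ k * of_nat L) (y i))"
    using assms(1) by (intro sum.mono_neutral_cong_right) auto
  also have "\<dots> = sc (of_nat L) (sc (of_real t ^ k) (\<Sum>i\<in>{i\<in>I. e i = k}. y i))"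
    by (simp add: scale_sum_right mult.commute)
  finally have eq: "sc (of_real t ^ k) (\<Sum>i\<in>{i\<in>I. e i = k}. y i) = (\<Sum>q<L. sc (1 / of_nat L) (Y q))"
    using kL by (simp add: scale_sum_right[symmetric])
  have "N (\<Sum>q<L. sc (1 / of_nat L) (Y q)) \<le> (\<Sum>q<L. N (sc (1 / of_nat L) (Y q)))"
    by (intro N_sum) (auto intro: E_intros YE)
  also have "\<dots> \<le> (\<Sum>q<L. h / real L * (h * C))"
  proof (intro sum_mono)
    fix q
    have "N (sc (1 / of_nat L) (Y q)) \<le> h * (1 / real L) * N (Y q)"
      using N_scale[OF YE, of "1 / of_nat L" q] by (simp add: norm_divide)
    also have "\<dots> \<le> h * (1 / real L) * (h * C)"
      using NY h_pos by (intro mult_left_mono) auto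
    finally show "N (sc (1 / of_nat L) (Y q)) \<le> h / real L * (h * C)" by simp
  qed
  also have "\<dots> = h * h * C" using kL by simp
  finally have "N (sc (of_real t ^ k) (\<Sum>i\<in>{i\<in>I. e i = k}. y i)) \<le> h * h * C" unfolding eq .
  moreover have "t ^ k * N (\<Sum>i\<in>{i\<in>I. e i = k}. y i) \<le> h * N (sc (of_real t ^ k) (\<Sum>i\<in>{i\<in>I. e i = k}. y i))"
  proof -
    have "(\<Sum>i\<in>{i\<in>I. e i = k}. y i) \<in> E" using y by (intro E_intros) auto
    from N_unscale[OF this, of "of_real t ^ k"] \<open>0 < t\<close> show ?thesis
      by (simp add: norm_power)
  qed
  moreover have "h * N (sc (of_real t ^ k) (\<Sum>i\<in>{i\<in>I. e i = k}. y i)) \<le> h * (h * h * C)"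
    using calculation h_pos by (intro mult_left_mono) auto
  ultimately show ?thesis
    by (simp add: power3_eq_cube mult.assoc)
qed

definition bounded_endo :: "('e \<Rightarrow> 'e) \<Rightarrow> bool" where
  "bounded_endo B \<longleftrightarrow> Vector_Spaces.linear sc sc B \<and> (\<forall>x\<in>E. B x \<in> E) \<and> (\<exists>\<beta>. \<forall>x\<in>E. N (B x) \<le> \<beta> * N x)"

text \<open>
  The conventions are those of the Neumann series: \<open>power_bounded B t\<close> expresses that the terms
  \<open>z ^ k B ^ k x\<close> remain bounded on the circle of radius \<open>t\<close>, so larger \<open>t\<close> means slower growth.
\<close>

definition power_bounded :: "('e \<Rightarrow> 'e) \<Rightarrow> real \<Rightarrow> bool" where
  "power_bounded B t \<longleftrightarrow> (\<exists>C. \<forall>k. \<forall>x\<in>E. N ((B ^^ k) x) * t ^ k \<le> C * N x)"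

lemma bounded_endo_bound:
  assumes "bounded_endo B"
  obtains \<beta> where "0 < \<beta>" "\<And>x. x \<in> E \<Longrightarrow> N (B x) \<le> \<beta> * N x"
proof -
  obtain \<beta> where \<beta>: "\<And>x. x \<in> E \<Longrightarrow> N (B x) \<le> \<beta> * N x"
    using assms unfolding bounded_endo_def by blast
  have "N (B x) \<le> max \<beta> 1 * N x" if "x \<in> E" for x
    using \<beta>[OF that] N_nonneg[OF that] by (meson max.cobounded1 mult_right_mono order_trans)
  then show ?thesis by (intro that[of "max \<beta> 1"]) auto
qed

text \<open>
  A lower bound of \<open>1 - z B\<close> persists, with half the constant, on a disc around \<open>z\<close>; compactness of the
  closed disc does the rest.
\<close>

lemma uniform_lower_bound:
  assumes B: "bounded_endo B"
    and low: "\<And>z. cmod z \<le> R \<Longrightarrow> \<exists>c>0. \<forall>x\<in>E. c * N x \<le> N (x - sc z (B x))"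
  shows "\<exists>c>0. \<forall>z. cmod z \<le> R \<longrightarrow> (\<forall>x\<in>E. c * N x \<le> N (x - sc z (B x)))"
proof -
  have BE: "\<And>x. x \<in> E \<Longrightarrow> B x \<in> E" using B unfolding bounded_endo_def by blast
  obtain \<beta> where \<beta>pos: "0 < \<beta>" and \<beta>: "\<And>x. x \<in> E \<Longrightarrow> N (B x) \<le> \<beta> * N x"
    using bounded_endo_bound[OF B] by blast
  from low have "\<forall>z\<in>cball 0 R. \<exists>c>0. \<forall>x\<in>E. c * N x \<le> N (x - sc z (B x))" by simp
  then obtain c where c: "\<And>z. z \<in> cball 0 R \<Longrightarrow> 0 < c z"
    "\<And>z x. z \<in> cball 0 R \<Longrightarrow> x \<in> E \<Longrightarrow> c z * N x \<le> N (x - sc z (B x))"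
    by metis
  define d where "d z = c z / (2 * h * \<beta>)" for z
  have dpos: "0 < d z" if "z \<in> cball 0 R" for z
    using c(1)[OF that] h_pos \<beta>pos unfolding d_def by simp
  have "compact (cball (0::complex) R)" by simp
  moreover have "\<And>z. z \<in> cball 0 R \<Longrightarrow> open (ball z (d z))" by simp
  moreover have "cball 0 R \<subseteq> (\<Union>z\<in>cball 0 R. ball z (d z))" using dpos by force
  ultimately obtain Z where Z: "Z \<subseteq> cball 0 R" "finite Z" "cball 0 R \<subseteq> (\<Union>z\<in>Z. ball z (d z))"
    by (rule compactE_image)
  define c0 where "c0 = Min (insert 1 (c ` Z)) / 2"
  have c0pos: "0 < c0" unfolding c0_def using Z(1,2) c(1) by (auto simp: Min_gr_iff)
  have "c0 * N x \<le> N (x - sc z (B x))" if z: "cmod z \<le> R" and x: "x \<in> E" for z x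
  proof -
    have "z \<in> cball 0 R" using z by simp
    then obtain w where w: "w \<in> Z" "z \<in> ball w (d w)" using Z(3) by auto
    then have wc: "w \<in> cball 0 R" using Z(1) by auto
    have "c w * N x \<le> N (x - sc w (B x))" using c(2)[OF wc x] .
    also have "x - sc w (B x) = (x - sc z (B x)) + sc (z - w) (B x)"
      by (simp add: scale_left_diff_distrib)
    also have "N \<dots> \<le> N (x - sc z (B x)) + N (sc (z - w) (B x))"
      using x by (intro N_triangle E_intros BE)
    also have "N (sc (z - w) (B x)) \<le> h * cmod (z - w) * N (B x)"
      using x by (intro N_scale BE)
    also have "\<dots> \<le> h * d w * (\<beta> * N x)"
      using w(2) h_pos N_nonneg[OF BE[OF x]] \<beta>[OF x] dpos[OF wc]
      by (intro mult_mono mult_left_mono) (auto simp: dist_norm norm_minus_commute)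
    also have "\<dots> = c w / 2 * N x"
      unfolding d_def using h_pos \<beta>pos by simp
    finally have "c w / 2 * N x \<le> N (x - sc z (B x))" by simp
    moreover have "c0 \<le> c w / 2"
      unfolding c0_def using Z(2) w(1) by (simp add: Min_le)
    ultimately show ?thesis
      using N_nonneg[OF x] by (meson mult_right_mono order_trans)
  qed
  then show ?thesis using c0pos by blast
qed

lemma geometric_sum_telescope:
  assumes "Vector_Spaces.linear sc sc B"
  defines "\<Psi> \<equiv> \<lambda>z L x. \<Sum>k<L. sc (z ^ k) ((B ^^ k) x)"
  shows "\<Psi> z L x - sc z (B (\<Psi> z L x)) = x - sc (z ^ L) ((B ^^ L) x)"
proof -
  interpret B: Vector_Spaces.linear sc sc B by fact
  show ?thesis
    unfolding \<Psi>_def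
  proof (induction L)
    case 0
    then show ?case by (simp add: B.zero)
  next
    case (Suc L)
    have "(\<Sum>k<Suc L. sc (z ^ k) ((B ^^ k) x)) - sc z (B (\<Sum>k<Suc L. sc (z ^ k) ((B ^^ k) x)))
      = ((\<Sum>k<L. sc (z ^ k) ((B ^^ k) x)) - sc z (B (\<Sum>k<L. sc (z ^ k) ((B ^^ k) x))))
        + (sc (z ^ L) ((B ^^ L) x) - sc (z ^ Suc L) ((B ^^ Suc L) x))"
      by (simp add: B.add B.scale scale_right_distrib)
    then show ?case unfolding Suc by simp
  qed
qed

lemma funpow_in: "bounded_endo B \<Longrightarrow> x \<in> E \<Longrightarrow> (B ^^ k) x \<in> E"
  by (induction k) (auto simp: bounded_endo_def)

lemma neumann_sum_bound:
  assumes B: "bounded_endo B" and low: "\<And>x. x \<in> E \<Longrightarrow> c * N x \<le> N (x - sc z (B x))" and x: "x \<in> E"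
  shows "c * N (\<Sum>k<L. sc (z ^ k) ((B ^^ k) x)) \<le> N x + h\<^sup>2 * (N ((B ^^ L) x) * cmod z ^ L)"
proof -
  have BE: "\<And>k. (B ^^ k) x \<in> E" using funpow_in[OF B x] .
  let ?\<Psi> = "\<Sum>k<L. sc (z ^ k) ((B ^^ k) x)"
  have "c * N ?\<Psi> \<le> N (?\<Psi> - sc z (B ?\<Psi>))" by (intro low E_intros BE)
  also have "\<dots> = N (x - sc (z ^ L) ((B ^^ L) x))"
    using B by (subst geometric_sum_telescope) (auto simp: bounded_endo_def)
  also have "\<dots> \<le> N x + h * N (sc (z ^ L) ((B ^^ L) x))"
    using x by (intro N_diff E_intros BE)
  also have "\<dots> \<le> N x + h * (h * cmod z ^ L * N ((B ^^ L) x))"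
    using N_scale[OF BE, of "z ^ L" L] h_pos by (simp add: norm_power)
  finally show ?thesis by (simp add: power2_eq_square mult_ac)
qed

text \<open>
  Below a radius \<open>s\<close> of power boundedness the constant is controlled by the lower bound \<open>c\<close> alone: in
  \<open>neumann_sum_bound\<close> the last term vanishes as \<open>L\<close> tends to infinity, because \<open>t < s\<close>; so the partial
  Neumann sums are bounded on the circle, and so are their coefficients. Since the bound does not depend
  on \<open>s\<close>, it persists at the supremum of such radii.
\<close>

lemma power_bounded_resolvent:
  assumes B: "bounded_endo B"
    and low: "\<forall>z. cmod z \<le> R \<longrightarrow> (\<forall>x\<in>E. c * N x \<le> N (x - sc z (B x)))"
    and c: "0 < c" and t: "0 < t" "t < s" "t \<le> R" and s: "power_bounded B s"
    and x: "x \<in> E"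
  shows "N ((B ^^ k) x) * t ^ k \<le> 2 * h ^ 3 / c * N x"
proof -
  from s obtain C where C: "\<And>k x. x \<in> E \<Longrightarrow> N ((B ^^ k) x) * s ^ k \<le> C * N x"
    unfolding power_bounded_def by blast
  have "(\<lambda>L. h\<^sup>2 * C * (t / s) ^ L) \<longlonglongrightarrow> h\<^sup>2 * C * 0"
    using t by (intro tendsto_intros LIMSEQ_realpow_zero) auto
  then have "\<forall>\<^sub>F L in sequentially. h\<^sup>2 * C * (t / s) ^ L < 1"
    by (intro order_tendstoD(2)[where y = 0]) auto
  then obtain L where L: "h\<^sup>2 * C * (t / s) ^ L < 1" "k < L"
    using eventually_conj[OF _ eventually_gt_at_top[of k]]
    by (metis (mono_tags, lifting) eventually_happens trivial_limit_sequentially)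
  have BE: "\<And>k. (B ^^ k) x \<in> E" using funpow_in[OF B x] .
  have bd: "N (\<Sum>k<L. sc (z ^ k) ((B ^^ k) x)) \<le> 2 / c * N x" if z: "cmod z = t" for z
  proof -
    have "c * N (\<Sum>k<L. sc (z ^ k) ((B ^^ k) x)) \<le> N x + h\<^sup>2 * (N ((B ^^ L) x) * t ^ L)"
      using neumann_sum_bound[OF B, of c z x L] low z t(3) x by simp
    also have "h\<^sup>2 * (N ((B ^^ L) x) * t ^ L) = h\<^sup>2 * (t / s) ^ L * (N ((B ^^ L) x) * s ^ L)"
      using t by (simp add: power_divide)
    also have "\<dots> \<le> h\<^sup>2 * (t / s) ^ L * (C * N x)"
      using C[OF x] t h_pos by (intro mult_left_mono) auto
    also have "\<dots> \<le> 1 * N x"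
      using L(1) N_nonneg[OF x] mult_right_mono[of "h\<^sup>2 * C * (t / s) ^ L" 1 "N x"]
      by (simp add: mult_ac)
    finally show ?thesis using c by (simp add: field_simps)
  qed
  have "t ^ k * N (\<Sum>i\<in>{i\<in>{..<L}. i = k}. (B ^^ i) x) \<le> h ^ 3 * (2 / c * N x)"
    using bd t BE by (intro coefficient_bound[where e = "\<lambda>i. i"]) auto
  moreover have "{i\<in>{..<L}. i = k} = {k}" using L(2) by auto
  ultimately show ?thesis by (simp add: mult_ac)
qed

text \<open>
  Power boundedness at a radius \<open>g\<close> where \<open>1 - z B\<close> is bounded below extends beyond \<open>g\<close>. The square of the
  partial Neumann sum of length \<open>L\<close> is bounded independently of \<open>L\<close>, since
  \<open>(1 - z B)\<^sup>2\<close> maps it to \<open>(1 - z ^ L B ^ L)\<^sup>2 x\<close>, whereas its middle coefficient is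
  \<open>L B ^ (L - 1) x\<close>. Hence \<open>g ^ q B ^ q\<close> has norm at most \<open>1/2\<close> for \<open>q = L - 1\<close> large, and \<open>g\<close> can be
  enlarged to \<open>g \<cdot> 2 ^ (1/q)\<close>.
\<close>

lemma power_bounded_improve:
  assumes B: "bounded_endo B"
    and low: "\<forall>z. cmod z \<le> R \<longrightarrow> (\<forall>x\<in>E. c * N x \<le> N (x - sc z (B x)))"
    and c: "0 < c" and g: "0 < g" "g \<le> R" and C: "\<And>k x. x \<in> E \<Longrightarrow> N ((B ^^ k) x) * g ^ k \<le> C * N x"
  shows "\<exists>s>g. power_bounded B s"
proof -
  have lin: "Vector_Spaces.linear sc sc B" using B by (simp add: bounded_endo_def)
  define D where "D = (1 + h\<^sup>2 * \<bar>C\<bar>) / c"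
  have D: "0 < D" using c unfolding D_def by (simp add: add_pos_nonneg)
  have CE: "N ((B ^^ k) x) * g ^ k \<le> \<bar>C\<bar> * N x" if "x \<in> E" for k x
    using C[OF that, of k] N_nonneg[OF that] by (meson abs_ge_self mult_right_mono order_trans)
  have bd: "N (\<Sum>k<L. sc (z ^ k) ((B ^^ k) x)) \<le> D * N x" if z: "cmod z = g" and x: "x \<in> E" for z x L
  proof -
    have "c * N (\<Sum>k<L. sc (z ^ k) ((B ^^ k) x)) \<le> N x + h\<^sup>2 * (N ((B ^^ L) x) * g ^ L)"
      using neumann_sum_bound[OF B, of c z x L] low z g(2) x by simp
    also have "h\<^sup>2 * (N ((B ^^ L) x) * g ^ L) \<le> h\<^sup>2 * (\<bar>C\<bar> * N x)"
      using CE[OF x] by (intro mult_left_mono) auto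
    finally show ?thesis unfolding D_def using c by (simp add: field_simps)
  qed
  \<comment> \<open>\<open>D\<^sup>2\<close> bounds the square of the partial Neumann sums; the powers of \<open>h\<close> come from the coefficient
    estimate and from dividing by \<open>L = q + 1\<close>.\<close>
  obtain q where q: "real q > 2 * (h ^ 4 * D\<^sup>2) + 1" using reals_Archimedean2 by blast
  then have q0: "0 < q" 
  proof -
    have "0 \<le> 2 * (h ^ 4 * D\<^sup>2) + 1" by simp
    then have "0 < real q" using q by linarith
    then show ?thesis by simp
  qed
  have half: "N ((B ^^ q) x) * g ^ q \<le> N x / 2" if x: "x \<in> E" for x
  proof -
    define L where "L = Suc q"
    have BE: "\<And>k. (B ^^ k) x \<in> E" using funpow_in[OF B x] .
    let ?I = "{..<L} \<times> {..<L}"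
    have two: "N (\<Sum>i\<in>?I. sc (z ^ (fst i + snd i)) ((B ^^ (fst i + snd i)) x)) \<le> D\<^sup>2 * N x" if z: "cmod z = g" for z
    proof -
      let ?\<Psi> = "\<Sum>k<L. sc (z ^ k) ((B ^^ k) x)"
      have PE: "?\<Psi> \<in> E" by (intro E_intros BE)
      have "Vector_Spaces.linear sc sc (B ^^ k)" for k
      proof (induction k)
        case (Suc k)
        then show ?case using Vector_Spaces.linear_compose[OF Suc lin] by (simp add: comp_def)
      qed (simp add: linear_id[unfolded id_def])
      then interpret Bk: Vector_Spaces.linear sc sc "B ^^ k" for k .
      have "(\<Sum>i\<in>?I. sc (z ^ (fst i + snd i)) ((B ^^ (fst i + snd i)) x))
          = (\<Sum>i<L. sc (z ^ i) ((B ^^ i) ?\<Psi>))"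
        by (simp add: sum.cartesian_product' Bk.sum Bk.scale scale_sum_right power_add funpow_add)
      also have "N \<dots> \<le> D * N ?\<Psi>" by (intro bd z PE)
      also have "\<dots> \<le> D * (D * N x)"
        using D by (intro mult_left_mono bd z x) auto
      finally show ?thesis by (simp add: power2_eq_square)
    qed
    have "g ^ q * N (\<Sum>i\<in>{i\<in>?I. fst i + snd i = q}. (B ^^ (fst i + snd i)) x) \<le> h ^ 3 * (D\<^sup>2 * N x)"
      using two g BE by (intro coefficient_bound) auto
    \<comment> \<open>There are \<open>q + 1\<close> pairs of indices with sum \<open>q\<close>.\<close>
    also have "(\<Sum>i\<in>{i\<in>?I. fst i + snd i = q}. (B ^^ (fst i + snd i)) x) = (\<Sum>i<L. (B ^^ q) x)"
      by (rule sum.reindex_bij_witness[where i = "\<lambda>i. (i, q - i)" and j = fst]) (auto simp: L_def)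
    also have "\<dots> = sc (of_nat L) ((B ^^ q) x)"
      by (simp add: sum_constant_scale)
    finally have "g ^ q * N (sc (of_nat L) ((B ^^ q) x)) \<le> h ^ 3 * (D\<^sup>2 * N x)" .
    moreover have "real L * N ((B ^^ q) x) \<le> h * N (sc (of_nat L) ((B ^^ q) x))"
      using N_unscale[OF BE, of "of_nat L" q] by simp
    ultimately have "real L * (N ((B ^^ q) x) * g ^ q) \<le> h ^ 4 * D\<^sup>2 * N x"
    proof -
      assume a: "g ^ q * N (sc (of_nat L) ((B ^^ q) x)) \<le> h ^ 3 * (D\<^sup>2 * N x)"
        and b: "real L * N ((B ^^ q) x) \<le> h * N (sc (of_nat L) ((B ^^ q) x))"
      have "real L * (N ((B ^^ q) x) * g ^ q) = g ^ q * (real L * N ((B ^^ q) x))" by simp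
      also have "\<dots> \<le> g ^ q * (h * N (sc (of_nat L) ((B ^^ q) x)))"
        using b g by (intro mult_left_mono) auto
      also have "\<dots> = h * (g ^ q * N (sc (of_nat L) ((B ^^ q) x)))" by simp
      also have "\<dots> \<le> h * (h ^ 3 * (D\<^sup>2 * N x))"
        using a h_pos by (intro mult_left_mono) auto
      also have "\<dots> = h ^ 4 * D\<^sup>2 * N x" by (simp add: power4_eq_xxxx power3_eq_cube)
      finally show ?thesis .
    qed
    also have "\<dots> \<le> real L / 2 * N x"
      using q N_nonneg[OF x] unfolding L_def by (intro mult_right_mono) auto
    finally have "real L * (N ((B ^^ q) x) * g ^ q) \<le> real L * (N x / 2)" by simp
    then show ?thesis unfolding L_def by (subst (asm) mult_le_cancel_left_pos) auto
  qed
  \<comment> \<open>The radius grows by a factor \<open>u\<close> with \<open>u ^ q = 2\<close>, which uses up the gain \<open>1/2\<close> over \<open>q\<close> steps.\<close>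
  define u where "u = root q 2"
  have u: "u ^ q = 2" "1 < u" unfolding u_def using q0 by (auto simp: real_root_gt_1_iff)
  have mult: "N ((B ^^ (q * a)) x) * g ^ (q * a) \<le> N x / 2 ^ a" if "x \<in> E" for a x
    using that
  proof (induction a arbitrary: x)
    case (Suc a)
    have e: "(B ^^ (q * Suc a)) x = (B ^^ (q * a)) ((B ^^ q) x)"
      by (metis add.commute funpow_add comp_apply mult_Suc_right)
    have "N ((B ^^ (q * Suc a)) x) * g ^ (q * Suc a)
      = N ((B ^^ (q * a)) ((B ^^ q) x)) * g ^ (q * a) * g ^ q"
      unfolding e by (simp add: power_add)
    also have "\<dots> \<le> N ((B ^^ q) x) / 2 ^ a * g ^ q"
      using g by (intro mult_right_mono Suc.IH funpow_in[OF B Suc.prems]) auto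
    also have "\<dots> = N ((B ^^ q) x) * g ^ q / 2 ^ a" by simp
    also have "\<dots> \<le> (N x / 2) / 2 ^ a"
      using half[OF Suc.prems] by (intro divide_right_mono) auto
    finally show ?case by simp
  qed simp
  have "N ((B ^^ k) x) * (g * u) ^ k \<le> 2 * \<bar>C\<bar> * N x" if x: "x \<in> E" for k x
  proof -
    define a b where "a = k div q" and "b = k mod q"
    have k: "k = b + q * a" unfolding a_def b_def by simp
    have b: "b \<le> q" unfolding b_def using q0 by (simp add: less_imp_le)
    have xE: "(B ^^ (q * a)) x \<in> E" by (intro funpow_in[OF B x])
    have "N ((B ^^ k) x) * (g * u) ^ k
       = (N ((B ^^ b) ((B ^^ (q * a)) x)) * g ^ b) * g ^ (q * a) * (u ^ b * (u ^ q) ^ a)"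
      unfolding k by (simp add: funpow_add power_mult_distrib power_add power_mult)
    also have "\<dots> \<le> (\<bar>C\<bar> * N ((B ^^ (q * a)) x)) * g ^ (q * a) * (u ^ b * (u ^ q) ^ a)"
      using g u(2) by (intro mult_right_mono CE xE) auto
    also have "\<dots> = \<bar>C\<bar> * (N ((B ^^ (q * a)) x) * g ^ (q * a)) * (u ^ b * (u ^ q) ^ a)" by simp
    also have "\<dots> \<le> \<bar>C\<bar> * (N x / 2 ^ a) * (u ^ b * (u ^ q) ^ a)"
      using mult[OF x] u(2) by (intro mult_right_mono mult_left_mono) auto
    also have "\<dots> = \<bar>C\<bar> * N x * u ^ b" unfolding u(1) by simp
    also have "\<dots> \<le> \<bar>C\<bar> * N x * u ^ q"
      using N_nonneg[OF x] u(2) b by (intro mult_left_mono power_increasing) auto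
    finally show ?thesis unfolding u(1) by simp
  qed
  then have "power_bounded B (g * u)" unfolding power_bounded_def by blast
  moreover have "g * u > g" using g u by simp
  ultimately show ?thesis by blast
qed

lemma power_bounded_mono:
  assumes "bounded_endo B" "power_bounded B s" "0 \<le> t" "t \<le> s"
  shows "power_bounded B t"
  unfolding power_bounded_def
proof -
  from assms(2) obtain C where C: "\<And>k x. x \<in> E \<Longrightarrow> N ((B ^^ k) x) * s ^ k \<le> C * N x"
    unfolding power_bounded_def by blast
  have "N ((B ^^ k) x) * t ^ k \<le> C * N x" if "x \<in> E" for k x
    using C[OF that, of k] assms(3,4) N_nonneg[OF funpow_in[OF assms(1) that]]
    by (meson mult_left_mono order_trans power_mono)
  then show "\<exists>C. \<forall>k. \<forall>x\<in>E. N ((B ^^ k) x) * t ^ k \<le> C * N x" by blast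
qed

text \<open>
  This replaces the argument that the resolvent is analytic off the spectrum. Only lower bounds of
  \<open>1 - z B\<close> are available, no inverses, since the space need not be complete; the two preceding lemmas
  show that the set of radii of power boundedness can neither stop at nor before \<open>R\<close>.
\<close>

theorem power_bounded_if_bounded_below:
  assumes B: "bounded_endo B" and R: "0 < R"
    and low: "\<And>z. cmod z \<le> R \<Longrightarrow> \<exists>c>0. \<forall>x\<in>E. c * N x \<le> N (x - sc z (B x))"
  shows "power_bounded B R"
proof (rule ccontr)
  assume not: "\<not> power_bounded B R"
  obtain c where c: "0 < c" "\<forall>z. cmod z \<le> R \<longrightarrow> (\<forall>x\<in>E. c * N x \<le> N (x - sc z (B x)))"
    using uniform_lower_bound[OF B low] by blast
  define Q where "Q = {t. 0 < t \<and> power_bounded B t}"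
  have QR: "t < R" if "t \<in> Q" for t
    using that not power_bounded_mono[OF B, of t R] R unfolding Q_def by force
  then have bdd: "bdd_above Q" by (meson bdd_aboveI less_imp_le)
  obtain \<beta> where \<beta>pos: "0 < \<beta>" and \<beta>: "\<And>x. x \<in> E \<Longrightarrow> N (B x) \<le> \<beta> * N x"
    using bounded_endo_bound[OF B] by blast
  have pow: "N ((B ^^ k) x) \<le> \<beta> ^ k * N x" if x: "x \<in> E" for k x
  proof (induction k)
    case (Suc k)
    have "N (B ((B ^^ k) x)) \<le> \<beta> * N ((B ^^ k) x)" by (intro \<beta> funpow_in[OF B x])
    also have "\<dots> \<le> \<beta> * (\<beta> ^ k * N x)" using Suc \<beta>pos by simp
    finally show ?case by simp
  qed simp
  have "power_bounded B (1 / \<beta>)"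
    unfolding power_bounded_def
    using pow \<beta>pos by (intro exI[of _ 1]) (simp add: power_divide field_simps)
  then have Qne: "1 / \<beta> \<in> Q" using \<beta>pos unfolding Q_def by simp
  define g where "g = Sup Q"
  have g: "0 < g" using cSup_upper[OF Qne bdd] \<beta>pos unfolding g_def
    by (meson divide_pos_pos less_le_trans zero_less_one)
  have gR: "g \<le> R" unfolding g_def using QR Qne by (intro cSup_least) (auto intro: less_imp_le)
  have below: "N ((B ^^ k) x) * t ^ k \<le> 2 * h ^ 3 / c * N x" if t: "0 < t" "t < g" and x: "x \<in> E" for t k x
  proof -
    obtain s where s: "s \<in> Q" "t < s"
      using t(2) less_cSup_iff[OF _ bdd] Qne unfolding g_def by blast
    have "t \<le> R" "power_bounded B s" using QR[OF s(1)] s unfolding Q_def by auto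
    then show ?thesis
      using power_bounded_resolvent[OF B c(2,1) t(1) s(2)] x by blast
  qed
  have "N ((B ^^ k) x) * g ^ k \<le> 2 * h ^ 3 / c * N x" if x: "x \<in> E" for k x
  proof (rule tendsto_upperbound)
    show "((\<lambda>t. N ((B ^^ k) x) * t ^ k) \<longlongrightarrow> N ((B ^^ k) x) * g ^ k) (at_left g)"
      by (intro tendsto_intros)
    show "\<forall>\<^sub>F t in at_left g. N ((B ^^ k) x) * t ^ k \<le> 2 * h ^ 3 / c * N x"
      using eventually_at_left_real[OF g] by eventually_elim (use below x in auto)
  qed simp
  then obtain s where s: "s > g" "power_bounded B s"
    using power_bounded_improve[OF B c(2,1) g gR] by blast
  then have "s \<in> Q" using g unfolding Q_def by simp
  then have "s \<le> g" unfolding g_def using bdd by (rule cSup_upper)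
  then show False using s by simp
qed

text \<open>
  The same vector must serve all pairs in \<open>ops\<close>: these are joint approximate eigenvalues.
\<close>

definition approximate_eigenvalues :: "(('e \<Rightarrow> 'e) \<times> complex) set \<Rightarrow> bool" where
  "approximate_eigenvalues ops \<longleftrightarrow>
     (\<forall>\<epsilon>>0. \<exists>x\<in>E. 0 < N x \<and> (\<forall>(A, m)\<in>ops. N (A x - sc m x) \<le> \<epsilon> * N x))"

text \<open>
  A form of the spectral radius formula: growth of the powers of \<open>B\<close> faster than \<open>\<rho> ^ k\<close> is caused by an
  approximate eigenvalue \<open>m\<close> of modulus at least \<open>\<rho>\<close>. Under the substitution \<open>z = 1 / m\<close>, failure of being
  bounded below is exactly approximate singularity.
\<close>

lemma approximate_eigenvalue_outside:
  assumes B: "bounded_endo B" and "0 < \<rho>"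
    and "\<not> power_bounded B (1 / \<rho>)"
  shows "\<exists>m. \<rho> \<le> cmod m \<and> approximate_eigenvalues {(B, m)}"
proof (rule ccontr)
  assume not: "\<not> ?thesis"
  have "\<exists>c>0. \<forall>x\<in>E. c * N x \<le> N (x - sc z (B x))" if z: "cmod z \<le> 1 / \<rho>" for z
  proof (cases "z = 0")
    case True
    then show ?thesis by (intro exI[of _ 1]) simp
  next
    case False
    then have "\<rho> \<le> cmod (1 / z)" using z \<open>0 < \<rho>\<close> by (simp add: norm_divide field_simps)
    then have "\<not> approximate_eigenvalues {(B, 1 / z)}" using not by blast
    then obtain \<epsilon> where \<epsilon>: "0 < \<epsilon>" "\<And>x. x \<in> E \<Longrightarrow> 0 < N x \<Longrightarrow> \<epsilon> * N x < N (B x - sc (1 / z) x)"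
      unfolding approximate_eigenvalues_def by (auto simp: not_le)
    have "\<epsilon> / (h * cmod (1 / z)) * N x \<le> N (x - sc z (B x))" if x: "x \<in> E" for x
    proof (cases "N x = 0")
      case True
      then show ?thesis using x B by (simp add: bounded_endo_def N_nonneg E_intros)
    next
      case nz: False
      have xE: "x - sc z (B x) \<in> E" using x B by (auto simp: bounded_endo_def intro!: E_intros)
      have "\<epsilon> * N x < N (B x - sc (1 / z) x)" using \<epsilon>(2)[OF x] nz N_nonneg[OF x] by simp
      also have "B x - sc (1 / z) x = sc (- (1 / z)) (x - sc z (B x))"
        using False by (simp add: scale_right_diff_distrib)
      also have "N \<dots> \<le> h * cmod (1 / z) * N (x - sc z (B x))"
        using N_scale[OF xE, of "- (1 / z)"] by (simp add: norm_divide)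
      finally show ?thesis using h_pos False by (simp add: norm_divide field_simps)
    qed
    then show ?thesis
      using \<epsilon>(1) h_pos False by (intro exI[of _ "\<epsilon> / (h * cmod (1 / z))"]) auto
  qed
  then have "power_bounded B (1 / \<rho>)"
    using assms by (intro power_bounded_if_bounded_below) auto
  then show False using assms by simp
qed

text \<open>
  If there were none, then \<open>B\<close> would be bounded below by some \<open>\<epsilon>\<close>, so \<open>B ^ k x0\<close> would decay at most like
  \<open>\<epsilon> ^ k\<close>; but the absence of approximate eigenvalues of modulus at least \<open>\<epsilon> / 2\<close> forces decay like
  \<open>(\<epsilon> / 2) ^ k\<close>.
\<close>

theorem approximate_eigenvalue_exists:
  assumes B: "bounded_endo B" and x0: "x0 \<in> E" "0 < N x0"
  shows "\<exists>m. approximate_eigenvalues {(B, m)}"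
proof (rule ccontr)
  assume not: "\<not> ?thesis"
  then have "\<not> approximate_eigenvalues {(B, 0)}" by blast
  then obtain \<epsilon> where \<epsilon>: "0 < \<epsilon>" "\<And>x. x \<in> E \<Longrightarrow> 0 < N x \<Longrightarrow> \<epsilon> * N x < N (B x)"
    unfolding approximate_eigenvalues_def by (auto simp: not_le)
  have low: "\<epsilon> ^ k * N x0 \<le> N ((B ^^ k) x0) \<and> 0 < N ((B ^^ k) x0)" for k
  proof (induction k)
    case (Suc k)
    have "\<epsilon> ^ Suc k * N x0 \<le> \<epsilon> * N ((B ^^ k) x0)" using Suc \<epsilon>(1) by simp
    also have "\<dots> < N (B ((B ^^ k) x0))" using Suc by (intro \<epsilon>(2) funpow_in[OF B x0(1)]) auto
    finally have "\<epsilon> ^ Suc k * N x0 < N ((B ^^ Suc k) x0)" by simp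
    moreover have "0 < \<epsilon> ^ Suc k * N x0" using \<epsilon>(1) x0(2) by simp
    ultimately show ?case by linarith
  qed (use x0 in auto)
  have "power_bounded B (1 / (\<epsilon> / 2))"
  proof (rule ccontr)
    assume "\<not> power_bounded B (1 / (\<epsilon> / 2))"
    with approximate_eigenvalue_outside[OF B half_gt_zero[OF \<epsilon>(1)]] not show False by blast
  qed
  then obtain C where C: "\<And>k. N ((B ^^ k) x0) * (1 / (\<epsilon> / 2)) ^ k \<le> C * N x0"
    using x0(1) unfolding power_bounded_def by blast
  have "2 ^ k \<le> C" for k
  proof -
    have "2 ^ k * N x0 = \<epsilon> ^ k * N x0 * (1 / (\<epsilon> / 2)) ^ k"
      using \<epsilon>(1) by (simp add: power_divide)
    also have "\<dots> \<le> N ((B ^^ k) x0) * (1 / (\<epsilon> / 2)) ^ k"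
      using low \<epsilon>(1) by (intro mult_right_mono) auto
    also have "\<dots> \<le> C * N x0" by (rule C)
    finally show ?thesis using x0 by simp
  qed
  moreover obtain k where "C < 2 ^ k"
    using real_arch_pow[of 2 C] by auto
  ultimately show False by (meson not_less)
qed

end

section \<open>Joint approximate eigenvalues of commuting operators\<close>

text \<open>
  The limit superior of a bounded nonnegative sequence, as a real number.
\<close>

definition eventual_bound :: "(nat \<Rightarrow> real) \<Rightarrow> real" where
  "eventual_bound s = Inf {C. 0 \<le> C \<and> (\<forall>\<^sub>F j in sequentially. s j \<le> C)}"

lemma eventual_bound_le:
  assumes "0 \<le> C" "\<forall>\<^sub>F j in sequentially. s j \<le> C"
  shows "eventual_bound s \<le> C"
  unfolding eventual_bound_def using assms by (intro cInf_lower) (auto intro!: bdd_belowI[of _ 0])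

lemma eventual_bound_nonneg:
  assumes "\<And>j. s j \<le> C"
  shows "0 \<le> eventual_bound s"
  unfolding eventual_bound_def
proof (rule cInf_greatest)
  have "max C 0 \<in> {C. 0 \<le> C \<and> (\<forall>\<^sub>F j in sequentially. s j \<le> C)}"
    using assms by (simp add: le_max_iff_disj)
  then show "{C. 0 \<le> C \<and> (\<forall>\<^sub>F j in sequentially. s j \<le> C)} \<noteq> {}" by blast
qed auto

lemma eventually_le_eventual_bound:
  assumes "\<And>j. s j \<le> C" "0 < e"
  shows "\<forall>\<^sub>F j in sequentially. s j \<le> eventual_bound s + e"
proof -
  let ?Q = "{C. 0 \<le> C \<and> (\<forall>\<^sub>F j in sequentially. s j \<le> C)}"
  have "max C 0 \<in> ?Q"
    using assms(1) by (simp add: le_max_iff_disj)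
  then have "?Q \<noteq> {}" by blast
  moreover have "Inf ?Q < eventual_bound s + e"
    using assms(2) by (simp add: eventual_bound_def)
  ultimately obtain c where c: "c \<in> ?Q" "c < eventual_bound s + e"
    by (rule cInf_lessD[THEN bexE])
  then have "\<forall>\<^sub>F j in sequentially. s j \<le> c" by simp
  then show ?thesis by eventually_elim (use c in simp)
qed

context complex_seminormed_space
begin

text \<open>
  Bounded sequences of approximate joint eigenvectors of \<open>ops\<close> form a seminormed space under the limit
  superior of the seminorms. It is invariant under \<open>B\<close>, because \<open>B\<close> commutes with \<open>ops\<close>, and it is not
  null; an approximate eigenvector of \<open>B\<close> in it consists, up to finitely many terms, of the desired
  vectors.
\<close>

theorem approximate_eigenvalue_extend:
  assumes ops: "finite ops" "\<And>A m. (A, m) \<in> ops \<Longrightarrow> bounded_endo A"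
    and B: "bounded_endo B"
    and commute: "\<And>A m x. (A, m) \<in> ops \<Longrightarrow> A (B x) = B (A x)"
    and approx: "approximate_eigenvalues ops"
  shows "\<exists>m. approximate_eigenvalues (insert (B, m) ops)"
proof -
  define E' :: "(nat \<Rightarrow> 'e) set" where
    "E' = {q. (\<forall>j. q j \<in> E) \<and> (\<exists>C. \<forall>j. N (q j) \<le> C)
           \<and> (\<forall>(A, m)\<in>ops. (\<lambda>j. N (A (q j) - sc m (q j))) \<longlonglongrightarrow> 0)}"
  define N' where "N' q = eventual_bound (\<lambda>j. N (q j))" for q :: "nat \<Rightarrow> 'e"
  define sc' where "sc' c q = (\<lambda>j. sc c (q j))" for c and q :: "nat \<Rightarrow> 'e"
  define B' where "B' q = (\<lambda>j. B (q j))" for q :: "nat \<Rightarrow> 'e"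
  have E'_E: "q j \<in> E" if "q \<in> E'" for q j using that unfolding E'_def by blast
  have E'_bd: "\<exists>C. \<forall>j. N (q j) \<le> C" if "q \<in> E'" for q using that unfolding E'_def by blast
  have E'_lim: "(\<lambda>j. N (A (q j) - sc m (q j))) \<longlonglongrightarrow> 0" if "q \<in> E'" "(A, m) \<in> ops" for q A m
    using that unfolding E'_def by blast
  have E'I: "q \<in> E'" if "\<And>j. q j \<in> E" "\<And>j. N (q j) \<le> C"
    "\<And>A m. (A, m) \<in> ops \<Longrightarrow> (\<lambda>j. N (A (q j) - sc m (q j))) \<longlonglongrightarrow> 0" for q C
    using that unfolding E'_def by blast
  have diffE: "A x - sc m x \<in> E" if "(A, m) \<in> ops" "x \<in> E" for A m x
    using ops(2)[OF that(1)] that(2) unfolding bounded_endo_def by (auto intro: E_intros)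
  have lin: "Vector_Spaces.linear sc sc A" if "(A, m) \<in> ops" for A m
    using ops(2)[OF that] unfolding bounded_endo_def by blast
  have BE: "B x \<in> E" if "x \<in> E" for x using B that unfolding bounded_endo_def by blast
  interpret B: Vector_Spaces.linear sc sc B using B unfolding bounded_endo_def by blast
  obtain \<beta> where \<beta>pos: "0 < \<beta>" and \<beta>: "\<And>x. x \<in> E \<Longrightarrow> N (B x) \<le> \<beta> * N x"
    using bounded_endo_bound[OF B] by blast
  have squeeze: "s \<longlonglongrightarrow> 0" if "\<And>j. 0 \<le> s j" "\<And>j. s j \<le> u j" "u \<longlonglongrightarrow> 0" for s u :: "nat \<Rightarrow> real"
    using that by (intro real_tendsto_sandwich[of "\<lambda>_. 0" s sequentially u 0]) auto
  have zero: "0 \<in> E'"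
  proof -
    have "(\<lambda>j. N (A ((0 :: nat \<Rightarrow> 'e) j) - sc m ((0 :: nat \<Rightarrow> 'e) j))) \<longlonglongrightarrow> 0" if a: "(A, m) \<in> ops" for A m
    proof -
      interpret A: Vector_Spaces.linear sc sc A by (rule lin[OF a])
      show ?thesis by (simp add: A.zero N_zero)
    qed
    then show ?thesis unfolding E'_def by (auto simp: N_zero E_intros)
  qed
  have add: "q + q' \<in> E'" if q: "q \<in> E'" "q' \<in> E'" for q q'
  proof -
    obtain C C' where C: "\<And>j. N (q j) \<le> C" "\<And>j. N (q' j) \<le> C'"
      using E'_bd q by meson
    have bd: "N ((q + q') j) \<le> C + C'" for j
      using N_triangle[OF E'_E[OF q(1)] E'_E[OF q(2)], of j j] C[of j] by simp
    have lim: "(\<lambda>j. N (A ((q + q') j) - sc m ((q + q') j))) \<longlonglongrightarrow> 0" if a: "(A, m) \<in> ops" for A m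
    proof (rule squeeze)
      interpret A: Vector_Spaces.linear sc sc A by (rule lin[OF a])
      fix j
      have "A ((q + q') j) - sc m ((q + q') j) = (A (q j) - sc m (q j)) + (A (q' j) - sc m (q' j))"
        by (simp add: A.add scale_right_distrib)
      then show "N (A ((q + q') j) - sc m ((q + q') j)) \<le> N (A (q j) - sc m (q j)) + N (A (q' j) - sc m (q' j))"
        using N_triangle[OF diffE[OF a E'_E[OF q(1)]] diffE[OF a E'_E[OF q(2)]]] by simp
      show "0 \<le> N (A ((q + q') j) - sc m ((q + q') j))"
        using q by (intro N_nonneg diffE[OF a]) (auto intro: E_intros E'_E)
    next
      show "(\<lambda>j. N (A (q j) - sc m (q j)) + N (A (q' j) - sc m (q' j))) \<longlonglongrightarrow> 0"
        using tendsto_add[OF E'_lim[OF q(1) a] E'_lim[OF q(2) a]] by simp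
    qed
    show ?thesis
      using E'I[of "q + q'", OF _ bd lim] E_intros(2)[OF E'_E[OF q(1)] E'_E[OF q(2)]] by simp
  qed
  have scl: "sc' c q \<in> E'" if q: "q \<in> E'" for c q
  proof -
    obtain C where C: "\<And>j. N (q j) \<le> C" using E'_bd q by meson
    have bd: "N (sc c (q j)) \<le> h * cmod c * C" for j
      using N_scale[OF E'_E[OF q], of c j] C[of j] h_pos
      by (meson mult_left_mono mult_nonneg_nonneg norm_ge_zero order_trans less_imp_le)
    have lim: "(\<lambda>j. N (A (sc c (q j)) - sc m (sc c (q j)))) \<longlonglongrightarrow> 0" if a: "(A, m) \<in> ops" for A m
    proof (rule squeeze)
      interpret A: Vector_Spaces.linear sc sc A by (rule lin[OF a])
      fix j
      have "A (sc c (q j)) - sc m (sc c (q j)) = sc c (A (q j) - sc m (q j))"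
        by (simp add: A.scale scale_right_diff_distrib mult.commute)
      then show "N (A (sc c (q j)) - sc m (sc c (q j))) \<le> h * cmod c * N (A (q j) - sc m (q j))"
        using N_scale[OF diffE[OF a E'_E[OF q]]] by simp
      show "0 \<le> N (A (sc c (q j)) - sc m (sc c (q j)))"
        using q by (intro N_nonneg diffE[OF a]) (auto intro: E_intros E'_E)
    next
      show "(\<lambda>j. h * cmod c * N (A (q j) - sc m (q j))) \<longlonglongrightarrow> 0"
        using tendsto_mult_left[OF E'_lim[OF q a], of "h * cmod c"] by simp
    qed
    show ?thesis
      unfolding sc'_def by (rule E'I[OF _ bd lim]) (auto intro: E_intros E'_E[OF q])
  qed
  have B'E: "B' q \<in> E'" if q: "q \<in> E'" for q
  proof -
    obtain C where C: "\<And>j. N (q j) \<le> C" using E'_bd q by meson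
    have bd: "N (B (q j)) \<le> \<beta> * C" for j
      using \<beta>[OF E'_E[OF q], of j] C[of j] \<beta>pos
      by (meson mult_left_mono order_trans less_imp_le)
    have lim: "(\<lambda>j. N (A (B (q j)) - sc m (B (q j)))) \<longlonglongrightarrow> 0" if a: "(A, m) \<in> ops" for A m
    proof (rule squeeze)
      fix j
      have "A (B (q j)) - sc m (B (q j)) = B (A (q j) - sc m (q j))"
        by (simp add: commute[OF a] B.scale B.diff)
      then show "N (A (B (q j)) - sc m (B (q j))) \<le> \<beta> * N (A (q j) - sc m (q j))"
        using \<beta>[OF diffE[OF a E'_E[OF q]]] by simp
      show "0 \<le> N (A (B (q j)) - sc m (B (q j)))"
        using q by (intro N_nonneg diffE[OF a]) (auto intro: BE E'_E)
    next
      show "(\<lambda>j. \<beta> * N (A (q j) - sc m (q j))) \<longlonglongrightarrow> 0"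
        using tendsto_mult_left[OF E'_lim[OF q a], of \<beta>] by simp
    qed
    show ?thesis
      unfolding B'_def by (rule E'I[OF _ bd lim]) (auto intro: BE E'_E[OF q])
  qed
  have N'_le: "N' q \<le> C" if "0 \<le> C" "\<forall>\<^sub>F j in sequentially. N (q j) \<le> C" for q C
    unfolding N'_def using that by (rule eventual_bound_le)
  have N'_ev: "\<forall>\<^sub>F j in sequentially. N (q j) \<le> N' q + e" if q: "q \<in> E'" and e: "0 < e" for q e
  proof -
    obtain C where "\<And>j. N (q j) \<le> C" using E'_bd q by meson
    then show ?thesis unfolding N'_def using e by (rule eventually_le_eventual_bound)
  qed
  have N'_nonneg: "0 \<le> N' q" if q: "q \<in> E'" for q
  proof -
    obtain C where "\<And>j. N (q j) \<le> C" using E'_bd q by meson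
    then show ?thesis unfolding N'_def by (rule eventual_bound_nonneg)
  qed
  interpret seq: complex_seminormed_space sc' E' N' h
  proof (unfold_locales)
    show "module.subspace sc' E'"
    proof -
      interpret S: vector_space sc'
        by unfold_locales (auto simp: sc'_def fun_eq_iff scale_right_distrib scale_left_distrib)
      show ?thesis by (intro S.subspaceI zero add scl)
    qed
  next
    fix q q' assume q: "q \<in> E'" "q' \<in> E'"
    show "N' (q + q') \<le> N' q + N' q'"
    proof (rule field_le_epsilon)
      fix e :: real assume e: "0 < e"
      have "\<forall>\<^sub>F j in sequentially. N ((q + q') j) \<le> N' q + N' q' + e"
        using N'_ev[OF q(1) half_gt_zero[OF e]] N'_ev[OF q(2) half_gt_zero[OF e]]
      proof eventually_elim
        case (elim j)
        then show ?case using N_triangle[OF E'_E[OF q(1)] E'_E[OF q(2)], of j j] by simp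
      qed
      then show "N' (q + q') \<le> N' q + N' q' + e"
        using q N'_nonneg e by (intro N'_le) (auto simp: add_nonneg_nonneg)
    qed
  next
    fix q c assume q: "q \<in> E'"
    show "N' (sc' c q) \<le> h * cmod c * N' q"
    proof (rule field_le_epsilon)
      fix e :: real assume e: "0 < e"
      define d where "d = e / (h * cmod c + 1)"
      have den: "0 < h * cmod c + 1" using h_pos by (simp add: add_nonneg_pos)
      then have d: "0 < d" using e unfolding d_def by simp
      have hd: "h * cmod c * d \<le> e"
        using den e h_pos unfolding d_def by (simp add: field_simps)
      have "\<forall>\<^sub>F j in sequentially. N (sc' c q j) \<le> h * cmod c * N' q + e"
        using N'_ev[OF q d]
      proof eventually_elim
        case (elim j)
        have "N (sc' c q j) \<le> h * cmod c * N (q j)"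
          unfolding sc'_def by (rule N_scale[OF E'_E[OF q]])
        also have "\<dots> \<le> h * cmod c * (N' q + d)"
          using elim h_pos by (intro mult_left_mono) auto
        finally show ?case using hd by (simp add: distrib_left)
      qed
      then show "N' (sc' c q) \<le> h * cmod c * N' q + e"
        using N'_nonneg[OF q] e h_pos by (intro N'_le) auto
    qed
  qed (auto simp: sc'_def fun_eq_iff scale_right_distrib scale_left_distrib N'_nonneg h_pos)
  have "seq.bounded_endo B'"
    unfolding seq.bounded_endo_def
  proof (intro conjI exI[of _ \<beta>] ballI)
    show "Vector_Spaces.linear sc' sc' B'"
      by unfold_locales (auto simp: B'_def sc'_def fun_eq_iff B.add B.scale)
    fix q assume q: "q \<in> E'"
    show "B' q \<in> E'" by (rule B'E[OF q])
    show "N' (B' q) \<le> \<beta> * N' q"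
    proof (rule field_le_epsilon)
      fix e :: real assume e: "0 < e"
      have "\<forall>\<^sub>F j in sequentially. N (B' q j) \<le> \<beta> * N' q + e"
        using N'_ev[OF q divide_pos_pos[OF e \<beta>pos]]
      proof eventually_elim
        case (elim j)
        have "N (B' q j) \<le> \<beta> * N (q j)"
          unfolding B'_def by (rule \<beta>[OF E'_E[OF q]])
        also have "\<dots> \<le> \<beta> * (N' q + e / \<beta>)"
          using elim \<beta>pos by (intro mult_left_mono) auto
        finally show ?case using \<beta>pos by (simp add: distrib_left)
      qed
      then show "N' (B' q) \<le> \<beta> * N' q + e"
        using N'_nonneg[OF q] e \<beta>pos by (intro N'_le) auto
    qed
  qed
  moreover obtain q where q: "q \<in> E'" "0 < N' q"
  proof -
    have "\<exists>x\<in>E. 0 < N x \<and> (\<forall>(A, m)\<in>ops. N (A x - sc m x) \<le> 1 / real (Suc j) * N x)" for j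
      using approx[unfolded approximate_eigenvalues_def, rule_format, of "1 / real (Suc j)"] by auto
    then obtain p where p: "\<And>j. p j \<in> E" "\<And>j. 0 < N (p j)"
      "\<And>j A m. (A, m) \<in> ops \<Longrightarrow> N (A (p j) - sc m (p j)) \<le> 1 / real (Suc j) * N (p j)"
      by (metis (no_types, lifting) case_prodD)
    define q where "q j = sc (1 / of_real (N (p j))) (p j)" for j
    have qE: "q j \<in> E" for j unfolding q_def by (intro E_intros p)
    have up: "N (q j) \<le> h" for j
      using N_scale[OF p(1), of "1 / of_real (N (p j))" j] p(2)[of j] unfolding q_def by (simp add: norm_divide)
    have lo: "1 / h \<le> N (q j)" for j
      using N_unscale[OF p(1), of "1 / of_real (N (p j))" j] p(2)[of j] h_pos unfolding q_def
      by (simp add: norm_divide field_simps)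
    have lim: "(\<lambda>j. N (A (q j) - sc m (q j))) \<longlonglongrightarrow> 0" if a: "(A, m) \<in> ops" for A m
    proof (rule squeeze)
      interpret A: Vector_Spaces.linear sc sc A by (rule lin[OF a])
      fix j
      show "0 \<le> N (A (q j) - sc m (q j))" by (intro N_nonneg diffE[OF a] qE)
      have "A (q j) - sc m (q j) = sc (1 / of_real (N (p j))) (A (p j) - sc m (p j))"
        unfolding q_def by (simp add: A.scale scale_right_diff_distrib mult.commute)
      then have "N (A (q j) - sc m (q j)) \<le> h * (1 / N (p j)) * N (A (p j) - sc m (p j))"
        using N_scale[OF diffE[OF a p(1)], of "1 / of_real (N (p j))" j] p(2)[of j] by (simp add: norm_divide)
      also have "\<dots> \<le> h * (1 / N (p j)) * (1 / real (Suc j) * N (p j))"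
        using p(3)[OF a, of j] p(2)[of j] h_pos by (intro mult_left_mono) auto
      also have "\<dots> = h * (1 / real (Suc j))" using p(2)[of j] by simp
      finally show "N (A (q j) - sc m (q j)) \<le> h * (1 / real (Suc j))" .
    next
      show "(\<lambda>j. h * (1 / real (Suc j))) \<longlonglongrightarrow> 0"
        using tendsto_mult_left[OF LIMSEQ_Suc[OF lim_1_over_n], of h] by simp
    qed
    have "q \<in> E'" using qE up lim by (rule E'I)
    moreover have "0 < N' q"
    proof (rule ccontr)
      assume "\<not> 0 < N' q"
      then have "N' q = 0" using N'_nonneg[OF \<open>q \<in> E'\<close>] by simp
      then have "\<forall>\<^sub>F j in sequentially. N (q j) \<le> 0 + 1 / (2 * h)"
        using N'_ev[OF \<open>q \<in> E'\<close>, of "1 / (2 * h)"] h_pos by simp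
      then obtain j where "N (q j) \<le> 1 / (2 * h)"
        by (metis (mono_tags, lifting) add_0 eventually_happens trivial_limit_sequentially)
      then show False using lo[of j] h_pos by (simp add: field_simps)
    qed
    ultimately show ?thesis by (rule that)
  qed
  ultimately obtain m where m: "seq.approximate_eigenvalues {(B', m)}"
    using seq.approximate_eigenvalue_exists by blast
  have "approximate_eigenvalues (insert (B, m) ops)"
    unfolding approximate_eigenvalues_def
  proof (intro allI impI)
    fix \<epsilon> :: real assume \<epsilon>: "0 < \<epsilon>"
    then have "0 < \<epsilon> / 4" by simp
    then have "\<exists>q\<in>E'. 0 < N' q \<and> (\<forall>(A, m)\<in>{(B', m)}. N' (A q - sc' m q) \<le> \<epsilon> / 4 * N' q)"
      using m unfolding seq.approximate_eigenvalues_def by blast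
    then obtain q where q: "q \<in> E'" "0 < N' q" "N' (B' q - sc' m q) \<le> \<epsilon> / 4 * N' q"
      by blast
    have BqE: "B' q - sc' m q \<in> E'"
      by (intro seq.E_intros B'E q)
    have ev1: "\<forall>\<^sub>F j in sequentially. N (B (q j) - sc m (q j)) \<le> \<epsilon> * (N' q / 2)"
      using N'_ev[OF BqE mult_pos_pos[OF \<open>0 < \<epsilon> / 4\<close> q(2)]]
    proof eventually_elim
      case (elim j)
      then have "N (B (q j) - sc m (q j)) \<le> N' (B' q - sc' m q) + \<epsilon> / 4 * N' q"
        using \<epsilon> q(2) by (simp add: B'_def sc'_def)
      then show ?case using q(3) by simp
    qed
    have ev2: "\<forall>\<^sub>F j in sequentially. \<forall>(A, m)\<in>ops. N (A (q j) - sc m (q j)) \<le> \<epsilon> * (N' q / 2)"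
    proof (intro eventually_ball_finite ops ballI)
      fix am assume am: "am \<in> ops"
      obtain A m' where [simp]: "am = (A, m')" by (cases am)
      have "\<forall>\<^sub>F j in sequentially. N (A (q j) - sc m' (q j)) < \<epsilon> * (N' q / 2)"
        using E'_lim[OF q(1), of A m'] am \<epsilon> q(2) by (intro order_tendstoD(2)) auto
      then show "\<forall>\<^sub>F j in sequentially. case am of (A, m) \<Rightarrow> N (A (q j) - sc m (q j)) \<le> \<epsilon> * (N' q / 2)"
        by eventually_elim simp
    qed
    have freq: "\<exists>\<^sub>F j in sequentially. \<not> N (q j) \<le> N' q / 2"
    proof (rule ccontr)
      assume "\<not> ?thesis"
      then have "N' q \<le> N' q / 2" using q(2) by (intro N'_le) (auto simp: frequently_def)
      then show False using q(2) by simp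
    qed
    have "\<exists>\<^sub>F j in sequentially. N' q / 2 < N (q j)
        \<and> N (B (q j) - sc m (q j)) \<le> \<epsilon> * (N' q / 2) \<and> (\<forall>(A, m)\<in>ops. N (A (q j) - sc m (q j)) \<le> \<epsilon> * (N' q / 2))"
    proof (rule frequently_rev_mp[OF freq])
      show "\<forall>\<^sub>F j in sequentially. \<not> N (q j) \<le> N' q / 2 \<longrightarrow> N' q / 2 < N (q j)
        \<and> N (B (q j) - sc m (q j)) \<le> \<epsilon> * (N' q / 2) \<and> (\<forall>(A, m)\<in>ops. N (A (q j) - sc m (q j)) \<le> \<epsilon> * (N' q / 2))"
        using ev1 ev2 by eventually_elim (simp add: not_le)
    qed
    then obtain j where j: "N' q / 2 < N (q j)" "N (B (q j) - sc m (q j)) \<le> \<epsilon> * (N' q / 2)"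
      "\<And>A m. (A, m) \<in> ops \<Longrightarrow> N (A (q j) - sc m (q j)) \<le> \<epsilon> * (N' q / 2)"
      by (blast dest!: frequently_ex)
    have le: "\<epsilon> * (N' q / 2) \<le> \<epsilon> * N (q j)" using j(1) \<epsilon> by (intro mult_left_mono) auto
    show "\<exists>x\<in>E. 0 < N x \<and> (\<forall>(A, m)\<in>insert (B, m) ops. N (A x - sc m x) \<le> \<epsilon> * N x)"
    proof (intro bexI[of _ "q j"] conjI)
      show "0 < N (q j)" using j(1) q(2) by simp
      show "\<forall>(A, m)\<in>insert (B, m) ops. N (A (q j) - sc m (q j)) \<le> \<epsilon> * N (q j)"
        using order_trans[OF j(2) le] order_trans[OF j(3) le] by blast
    qed (rule E'_E[OF q(1)])
  qed
  then show ?thesis by blast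
qed

end

section \<open>Multilinear forms and operators acting in one slot\<close>

text \<open>
  A normed space with a complex structure that is compatible with the topology, as codomain of forms.
\<close>

locale complex_target =
  fixes sw :: "complex \<Rightarrow> 'w::real_normed_vector \<Rightarrow> 'w"
  assumes vs: "vector_space sw" and bilinear: "bounded_bilinear sw"
    and sw_real: "sw (complex_of_real r) w = r *\<^sub>R w"

text \<open>
  Forms of degree \<open>n\<close> are functions of a family \<open>v :: nat \<Rightarrow> 'a\<close>; the slots are the indices below \<open>n\<close>.
  Compared with lists this makes replacing an argument a function update.
\<close>

definition form_bound :: "nat \<Rightarrow> ((nat \<Rightarrow> 'a::real_normed_vector) \<Rightarrow> 'w::real_normed_vector) \<Rightarrow> real \<Rightarrow> bool" where
  "form_bound n P c \<longleftrightarrow> 0 \<le> c \<and> (\<forall>v. norm (P v) \<le> c * (\<Prod>i<n. norm (v i)))"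

definition slot_forms ::
    "'a::real_normed_vector scalars \<Rightarrow> (complex \<Rightarrow> 'w::real_normed_vector \<Rightarrow> 'w) \<Rightarrow> nat \<Rightarrow> ((nat \<Rightarrow> 'a) \<Rightarrow> 'w) set" where
  "slot_forms K sw n = {P. (\<forall>i<n. \<forall>v. linear_over K (Complex_Scalars sw) (\<lambda>x. P (v(i := x)))) \<and> (\<exists>c. form_bound n P c)}"

definition form_norm :: "nat \<Rightarrow> ((nat \<Rightarrow> 'a::real_normed_vector) \<Rightarrow> 'w::real_normed_vector) \<Rightarrow> real" where
  "form_norm n P = Inf {c. form_bound n P c}"

definition form_scale :: "(complex \<Rightarrow> 'w \<Rightarrow> 'w) \<Rightarrow> complex \<Rightarrow> ('v \<Rightarrow> 'w) \<Rightarrow> 'v \<Rightarrow> 'w" where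
  "form_scale sw c P = (\<lambda>v. sw c (P v))"

definition slot :: "nat \<Rightarrow> ('a \<Rightarrow> 'a) \<Rightarrow> ((nat \<Rightarrow> 'a) \<Rightarrow> 'w) \<Rightarrow> (nat \<Rightarrow> 'a) \<Rightarrow> 'w" where
  "slot i A P = (\<lambda>v. P (v(i := A (v i))))"

lemma form_norm_le: "form_bound n P c \<Longrightarrow> form_norm n P \<le> c"
  unfolding form_norm_def by (rule cInf_lower) (auto intro!: bdd_belowI[of _ 0] simp: form_bound_def)

lemma form_bound_norm:
  assumes "P \<in> slot_forms K sw n"
  shows "form_bound n P (form_norm n P)"
proof -
  obtain c0 where c0: "form_bound n P c0" using assms unfolding slot_forms_def by blast
  have nn: "0 \<le> form_norm n P"
    unfolding form_norm_def using c0 by (intro cInf_greatest) (auto simp: form_bound_def)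
  moreover have "norm (P v) \<le> form_norm n P * (\<Prod>i<n. norm (v i))" for v
  proof (cases "(\<Prod>i<n. norm (v i)) = 0")
    case True
    then show ?thesis using c0 unfolding form_bound_def by (metis mult_zero_right)
  next
    case False
    then have pos: "0 < (\<Prod>i<n. norm (v i))" by (simp add: prod_nonneg less_le)
    have "norm (P v) / (\<Prod>i<n. norm (v i)) \<le> form_norm n P"
      unfolding form_norm_def
    proof (rule cInf_greatest)
      show "{c. form_bound n P c} \<noteq> {}" using c0 by blast
      fix c assume "c \<in> {c. form_bound n P c}"
      then show "norm (P v) / (\<Prod>i<n. norm (v i)) \<le> c"
        using pos by (simp add: form_bound_def pos_divide_le_eq)
    qed
    then show ?thesis using pos by (simp add: pos_divide_le_eq)
  qed
  ultimately show ?thesis unfolding form_bound_def by blast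
qed

lemma form_norm_nonneg: "P \<in> slot_forms K sw n \<Longrightarrow> 0 \<le> form_norm n P"
  using form_bound_norm form_bound_def by blast

lemma norm_form_le: "P \<in> slot_forms K sw n \<Longrightarrow> norm (P v) \<le> form_norm n P * (\<Prod>i<n. norm (v i))"
  using form_bound_norm form_bound_def by blast

lemma prod_upd_slot:
  fixes v :: "nat \<Rightarrow> 'a::real_normed_vector"
  assumes "i < n"
  shows "(\<Prod>j<n. norm ((v(i := x)) j)) = norm x * (\<Prod>j\<in>{..<n} - {i}. norm (v j))"
proof -
  have "(\<Prod>j<n. norm ((v(i := x)) j)) = norm ((v(i := x)) i) * (\<Prod>j\<in>{..<n} - {i}. norm ((v(i := x)) j))"
    using assms by (intro prod.remove) auto
  then show ?thesis by simp
qed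

text \<open>
  Forms may be linear over the reals or over the complex numbers according to \<open>K\<close>; an operator acting
  in a slot has to be linear over the same scalars.
\<close>

lemma linear_over_compose:
  assumes "linear_over K (Complex_Scalars sw) f" "linear_over K K A"
  shows "linear_over K (Complex_Scalars sw) (\<lambda>x. f (A x))"
  using assms Vector_Spaces.linear_compose linear_compose
  unfolding linear_over_def by (force simp: comp_def split: scalars.splits)

lemma linear_over_real_linear:
  fixes f :: "'a::real_normed_vector \<Rightarrow> 'w::real_normed_vector"
  assumes "complex_target sw" "admissible_scalars K" "linear_over K (Complex_Scalars sw) f"
  shows "linear f"
proof (cases K)
  case Real_Scalars
  then show ?thesis using assms by (simp add: linear_over_def)
next
  case (Complex_Scalars sc)
  then interpret f: Vector_Spaces.linear sc sw f using assms by (simp add: linear_over_def)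
  have sc: "sc (of_real r) x = r *\<^sub>R x" for r x
    using assms Complex_Scalars by (simp add: admissible_scalars_def complex_scaling_def)
  show ?thesis
  proof
    fix r :: real and x
    have "f (sc (of_real r) x) = sw (of_real r) (f x)" by (rule f.scale)
    then show "f (r *\<^sub>R x) = r *\<^sub>R f x"
      using assms(1) by (simp add: sc complex_target.sw_real)
  qed (rule f.add)
qed

context complex_target
begin

sublocale sw: vector_space sw by (rule vs)
sublocale swb: bounded_bilinear sw by (rule bilinear)

lemma linear_over_zero: "admissible_scalars K \<Longrightarrow> linear_over K (Complex_Scalars sw) (\<lambda>x. 0)"
  by (auto simp: linear_over_def admissible_scalars_def complex_scaling_def linear_iff
      module_hom_iff_linear[symmetric] module_hom_iff module_iff_vector_space vs split: scalars.splits)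

lemma linear_over_add:
  assumes "linear_over K (Complex_Scalars sw) f" "linear_over K (Complex_Scalars sw) g"
  shows "linear_over K (Complex_Scalars sw) (\<lambda>x. f x + g x)"
proof (cases K)
  case Real_Scalars
  then show ?thesis using assms by (simp add: linear_over_def linear_compose_add)
next
  case (Complex_Scalars sc)
  then show ?thesis using assms
    by (simp add: linear_over_def module_hom_iff_linear[symmetric] module_hom_iff sw.scale_right_distrib add_ac)
qed

lemma linear_over_scale:
  assumes "linear_over K (Complex_Scalars sw) f"
  shows "linear_over K (Complex_Scalars sw) (\<lambda>x. sw c (f x))"
proof (cases K)
  case Real_Scalars
  then show ?thesis using assms
    by (simp add: linear_over_def linear_iff swb.add_right swb.scaleR_right)
next
  case (Complex_Scalars sc)
  then show ?thesis using assms
    by (simp add: linear_over_def module_hom_iff_linear[symmetric] module_hom_iff sw.scale_right_distrib mult.commute)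
qed

definition sw_const :: real where "sw_const = (SOME H. 0 < H \<and> (\<forall>c w. norm (sw c w) \<le> norm c * norm w * H))"

lemma sw_const: "0 < sw_const" "norm (sw c w) \<le> sw_const * cmod c * norm w"
proof -
  have "0 < sw_const \<and> (\<forall>c w. norm (sw c w) \<le> norm c * norm w * sw_const)"
    unfolding sw_const_def using swb.pos_bounded by (rule someI_ex)
  then show "0 < sw_const" "norm (sw c w) \<le> sw_const * cmod c * norm w"
    by (auto simp: mult_ac)
qed

lemma vector_space_form_scale: "vector_space (form_scale sw)"
  by unfold_locales (auto simp: form_scale_def fun_eq_iff sw.scale_right_distrib sw.scale_left_distrib)

lemma form_bound_add:
  assumes P: "P \<in> slot_forms K sw n" and Q: "Q \<in> slot_forms K sw n"
  shows "form_bound n (P + Q) (form_norm n P + form_norm n Q)"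
  unfolding form_bound_def
proof (intro conjI allI)
  fix v
  show "norm ((P + Q) v) \<le> (form_norm n P + form_norm n Q) * (\<Prod>i<n. norm (v i))"
    using norm_triangle_ineq[of "P v" "Q v"] norm_form_le[OF P, of v] norm_form_le[OF Q, of v]
    by (simp add: distrib_right)
qed (simp add: form_norm_nonneg[OF P] form_norm_nonneg[OF Q])

lemma form_bound_scale:
  assumes P: "P \<in> slot_forms K sw n"
  shows "form_bound n (form_scale sw c P) (sw_const * cmod c * form_norm n P)"
  unfolding form_bound_def
proof (intro conjI allI)
  fix v
  have "norm (form_scale sw c P v) \<le> sw_const * cmod c * norm (P v)"
    unfolding form_scale_def by (rule sw_const)
  also have "\<dots> \<le> sw_const * cmod c * (form_norm n P * (\<Prod>i<n. norm (v i)))"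
    using norm_form_le[OF P] sw_const(1) by (intro mult_left_mono) auto
  finally show "norm (form_scale sw c P v) \<le> sw_const * cmod c * form_norm n P * (\<Prod>i<n. norm (v i))"
    by (simp add: mult_ac)
qed (use sw_const(1) form_norm_nonneg[OF P] in simp)

lemma subspace_slot_forms:
  assumes "admissible_scalars K"
  shows "module.subspace (form_scale sw) (slot_forms K sw n)"
proof -
  interpret F: vector_space "form_scale sw" by (rule vector_space_form_scale)
  show ?thesis
  proof (rule F.subspaceI)
    show "0 \<in> slot_forms K sw n"
      unfolding slot_forms_def using linear_over_zero[OF assms]
      by (auto simp: zero_fun_def form_bound_def intro!: exI[of _ 0])
  next
    fix P Q assume P: "P \<in> slot_forms K sw n" and Q: "Q \<in> slot_forms K sw n"
    from form_bound_add[OF this] show "P + Q \<in> slot_forms K sw n"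
      using P Q unfolding slot_forms_def by (auto intro: linear_over_add)
  next
    fix c P assume P: "P \<in> slot_forms K sw n"
    from form_bound_scale[OF this] show "form_scale sw c P \<in> slot_forms K sw n"
      using P unfolding slot_forms_def by (auto simp: form_scale_def intro: linear_over_scale)
  qed
qed

text \<open>
  The spaces to which the results on approximate eigenvalues will be applied.
\<close>

lemma forms_seminormed:
  assumes E: "E \<subseteq> slot_forms K sw n" "module.subspace (form_scale sw) E"
  shows "complex_seminormed_space (form_scale sw) E (form_norm n) sw_const"
proof -
  interpret F: vector_space "form_scale sw" by (rule vector_space_form_scale)
  have E': "P \<in> slot_forms K sw n" if "P \<in> E" for P using that E(1) by blast
  show ?thesis
    by unfold_locales
      (use E(2) sw_const(1) in \<open>auto intro!: form_norm_nonneg form_norm_le form_bound_add form_bound_scale dest!: E'\<close>)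
qed

lemma slot_form_bound:
  assumes P: "P \<in> slot_forms K sw n" and i: "i < n" and A: "\<And>x. norm (A x) \<le> a * norm x" "0 \<le> a"
  shows "form_bound n (slot i A P) (a * form_norm n P)"
  unfolding form_bound_def
proof (intro conjI allI)
  fix v
  have "norm (slot i A P v) \<le> form_norm n P * (\<Prod>j<n. norm ((v(i := A (v i))) j))"
    unfolding slot_def by (rule norm_form_le[OF P])
  also have "(\<Prod>j<n. norm ((v(i := A (v i))) j)) = norm (A (v i)) * (\<Prod>j\<in>{..<n} - {i}. norm (v j))"
    by (rule prod_upd_slot[OF i])
  also have "\<dots> \<le> (a * norm (v i)) * (\<Prod>j\<in>{..<n} - {i}. norm (v j))"
    by (intro mult_right_mono A prod_nonneg) auto
  also have "\<dots> = a * (\<Prod>j<n. norm (v j))"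
    using i by (simp add: prod.remove[of "{..<n}" i])
  finally have "norm (slot i A P v) \<le> form_norm n P * (a * (\<Prod>j<n. norm (v j)))"
    using form_norm_nonneg[OF P] by (simp add: mult_left_mono)
  then show "norm (slot i A P v) \<le> a * form_norm n P * (\<Prod>j<n. norm (v j))"
    by (simp add: mult_ac)
qed (use form_norm_nonneg[OF P] A in simp)

lemma slot_in_forms:
  assumes P: "P \<in> slot_forms K sw n" and i: "i < n" and A: "bounded_linear A" "linear_over K K A"
  shows "slot i A P \<in> slot_forms K sw n"
proof -
  obtain a where a: "\<And>x. norm (A x) \<le> norm x * a" "0 \<le> a"
    using bounded_linear.nonneg_bounded[OF A(1)] by blast
  then have "norm (A x) \<le> a * norm x" for x
    by (subst mult.commute)
  then have "form_bound n (slot i A P) (a * form_norm n P)"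
    by (rule slot_form_bound[OF P i _ a(2)])
  moreover have "linear_over K (Complex_Scalars sw) (\<lambda>x. slot i A P (v(j := x)))" if j: "j < n" for j v
  proof (cases "j = i")
    case True
    have "linear_over K (Complex_Scalars sw) (\<lambda>x. P (v(i := A x)))"
      using P i A(2) unfolding slot_forms_def
      by (intro linear_over_compose[where f = "\<lambda>x. P (v(i := x))" and A = A]) auto
    then show ?thesis using True by (simp add: slot_def)
  next
    case False
    have "slot i A P (v(j := x)) = P ((v(i := A (v i)))(j := x))" for x
      using False by (simp add: slot_def fun_upd_twist)
    then show ?thesis using P j unfolding slot_forms_def by simp
  qed
  ultimately show ?thesis unfolding slot_forms_def by blast
qed

lemma slot_linear: "Vector_Spaces.linear (form_scale sw) (form_scale sw) (slot i A)"
proof -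
  interpret F: vector_space "form_scale sw" by (rule vector_space_form_scale)
  show ?thesis by unfold_locales (auto simp: slot_def form_scale_def fun_eq_iff)
qed

end

section \<open>Spectra seen by forms under a differentiable semigroup\<close>

text \<open>
  What remains of the resolvent at \<open>\<mu>\<close> when \<open>G\<close> is only accessible through \<open>A = T 1\<close> and \<open>D = G \<circ> T 1\<close>:
  an operator \<open>R\<close> with \<open>A = (\<mu> A - D) R\<close>. Over the reals \<open>\<mu>\<close> acts on the complexification, and \<open>R1\<close>,
  \<open>R2\<close> are the real and imaginary parts of the restriction of \<open>R\<close> to the real subspace.
\<close>

definition resolvent_witness ::
    "'a::real_normed_vector scalars \<Rightarrow> ('a \<Rightarrow> 'a) \<Rightarrow> ('a \<Rightarrow> 'a) \<Rightarrow> complex \<Rightarrow> bool" where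
  "resolvent_witness K A D \<mu> = (case K of
     Real_Scalars \<Rightarrow> \<exists>R1 R2. bounded_linear R1 \<and> bounded_linear R2 \<and>
       (\<forall>y. A y = Re \<mu> *\<^sub>R A (R1 y) - Im \<mu> *\<^sub>R A (R2 y) - D (R1 y)) \<and>
       (\<forall>y. 0 = Im \<mu> *\<^sub>R A (R1 y) + Re \<mu> *\<^sub>R A (R2 y) - D (R2 y))
   | Complex_Scalars sc \<Rightarrow> \<exists>R. bounded_linear R \<and> (\<forall>y. A y = sc \<mu> (A (R y)) - D (R y)))"

text \<open>
  Both cases of the definition have the same effect on a functional with complex values: \<open>f \<circ> A\<close> factors
  through \<open>\<mu> f \<circ> A - f \<circ> D\<close>. This makes it unnecessary to complexify the space on which the forms live.
\<close>

lemma (in complex_target) resolvent_witness_functional: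
  assumes K: "admissible_scalars K" and R: "resolvent_witness K A D \<mu>"
    and zero: "A 0 = 0" "D 0 = 0"
  shows "\<exists>R1 R2. bounded_linear R1 \<and> bounded_linear R2 \<and>
    (\<forall>f y. linear_over K (Complex_Scalars sw) f \<longrightarrow>
      f (A y) = (sw \<mu> (f (A (R1 y))) - f (D (R1 y))) + sw \<i> (sw \<mu> (f (A (R2 y))) - f (D (R2 y))))"
proof (cases K)
  case Real_Scalars
  then have "\<exists>R1 R2. bounded_linear R1 \<and> bounded_linear R2 \<and>
       (\<forall>y. A y = Re \<mu> *\<^sub>R A (R1 y) - Im \<mu> *\<^sub>R A (R2 y) - D (R1 y)) \<and>
       (\<forall>y. 0 = Im \<mu> *\<^sub>R A (R1 y) + Re \<mu> *\<^sub>R A (R2 y) - D (R2 y))"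
    using R unfolding resolvent_witness_def by simp
  then obtain R1 R2 where R: "bounded_linear R1" "bounded_linear R2"
    "\<And>y. A y = Re \<mu> *\<^sub>R A (R1 y) - Im \<mu> *\<^sub>R A (R2 y) - D (R1 y)"
    "\<And>y. 0 = Im \<mu> *\<^sub>R A (R1 y) + Re \<mu> *\<^sub>R A (R2 y) - D (R2 y)"
    by blast
  have sw\<mu>: "sw \<mu> w = Re \<mu> *\<^sub>R w + sw \<i> (Im \<mu> *\<^sub>R w)" for w
  proof -
    have "sw \<mu> w = sw (of_real (Re \<mu>) + \<i> * of_real (Im \<mu>)) w"
      by (simp add: complex_eq_iff)
    also have "\<dots> = sw (of_real (Re \<mu>)) w + sw \<i> (sw (of_real (Im \<mu>)) w)"
      by (simp only: sw.scale_left_distrib sw.scale_scale)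
    finally show ?thesis by (simp only: sw_real)
  qed
  have ii: "sw \<i> (sw \<i> w) = - w" for w by simp
  have "f (A y) = (sw \<mu> (f (A (R1 y))) - f (D (R1 y))) + sw \<i> (sw \<mu> (f (A (R2 y))) - f (D (R2 y)))"
    if f: "linear_over K (Complex_Scalars sw) f" for f y
  proof -
    interpret f: linear f by (rule linear_over_real_linear[OF complex_target_axioms K f])
    have 1: "f (A y) = Re \<mu> *\<^sub>R f (A (R1 y)) - Im \<mu> *\<^sub>R f (A (R2 y)) - f (D (R1 y))"
      using arg_cong[OF R(3)[of y], of f] by (simp only: f.diff f.scaleR)
    have "f 0 = Im \<mu> *\<^sub>R f (A (R1 y)) + Re \<mu> *\<^sub>R f (A (R2 y)) - f (D (R2 y))"
      using arg_cong[OF R(4)[of y], of f] by (simp only: f.diff f.add f.scaleR)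
    then have 2: "sw \<i> (Im \<mu> *\<^sub>R f (A (R1 y)) + Re \<mu> *\<^sub>R f (A (R2 y)) - f (D (R2 y))) = 0"
      by (simp add: f.zero)
    show ?thesis
      using 1 2 unfolding sw\<mu>
      by (simp add: sw.scale_right_distrib sw.scale_right_diff_distrib ii algebra_simps)
  qed
  then show ?thesis using R(1,2) by blast
next
  case (Complex_Scalars sc)
  then have "\<exists>R. bounded_linear R \<and> (\<forall>y. A y = sc \<mu> (A (R y)) - D (R y))"
    using R unfolding resolvent_witness_def by simp
  then obtain R where R: "bounded_linear R" "\<And>y. A y = sc \<mu> (A (R y)) - D (R y)"
    by blast
  have "f (A y) = (sw \<mu> (f (A (R y))) - f (D (R y))) + sw \<i> (sw \<mu> (f (A 0)) - f (D 0))"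
    if f: "linear_over K (Complex_Scalars sw) f" for f y
  proof -
    interpret f: Vector_Spaces.linear sc sw f using f Complex_Scalars by (simp add: linear_over_def)
    have "f (A y) = sw \<mu> (f (A (R y))) - f (D (R y))"
      using arg_cong[OF R(2)[of y], of f] by (simp only: f.diff f.scale)
    then show ?thesis by (simp add: zero f.zero)
  qed
  then show ?thesis 
    using R(1) bounded_linear_zero by (intro exI[of _ R] exI[of _ "\<lambda>x. 0"] conjI allI impI) auto
qed

text \<open>
  The properties of an analytic semigroup on which the spectral arguments rest, with \<open>D = G \<circ> T 1\<close> and
  \<open>\<Lambda>\<close> the spectrum of \<open>G\<close>. Orbits are differentiated only from time \<open>1\<close> on, where the derivative is
  the bounded expression \<open>T (t - 1) (D x)\<close>.
\<close>

locale smooth_semigroup =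
  fixes K :: "'a::real_normed_vector scalars" and T :: "real \<Rightarrow> 'a \<Rightarrow> 'a" and D :: "'a \<Rightarrow> 'a"
    and \<Lambda> :: "complex set"
  assumes admissible: "admissible_scalars K"
    and T_bounded_linear: "0 \<le> t \<Longrightarrow> bounded_linear (T t)"
    and T_linear_over: "0 \<le> t \<Longrightarrow> linear_over K K (T t)"
    and T_0: "T 0 x = x"
    and T_add: "0 \<le> s \<Longrightarrow> 0 \<le> t \<Longrightarrow> T (s + t) x = T s (T t x)"
    and T_uniform: "\<exists>M. \<forall>t\<in>{0..1}. \<forall>x. norm (T t x) \<le> M * norm x"
    and D_bounded_linear: "bounded_linear D"
    and D_linear_over: "linear_over K K D"
    and T_deriv: "1 \<le> t \<Longrightarrow> ((\<lambda>s. T s x) has_vector_derivative T (t - 1) (D x)) (at t)"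
    and D_commute: "0 \<le> t \<Longrightarrow> D (T t x) = T t (D x)"
    and resolvent: "\<mu> \<notin> \<Lambda> \<Longrightarrow> resolvent_witness K (T 1) D \<mu>"

locale semigroup_forms = smooth_semigroup K T D \<Lambda> + complex_target sw
  for K :: "'a::real_normed_vector scalars" and T D \<Lambda> and sw :: "complex \<Rightarrow> 'w::real_normed_vector \<Rightarrow> 'w" +
  fixes E :: "((nat \<Rightarrow> 'a) \<Rightarrow> 'w) set" and n :: nat
  assumes E_forms: "E \<subseteq> slot_forms K sw n"
    and E_subspace: "module.subspace (form_scale sw) E"
    and E_slot: "P \<in> E \<Longrightarrow> i < n \<Longrightarrow> slot i (T 1) P \<in> E" "P \<in> E \<Longrightarrow> i < n \<Longrightarrow> slot i D P \<in> E"
begin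

abbreviation "N \<equiv> form_norm n"

sublocale forms: complex_seminormed_space "form_scale sw" E N sw_const
  by (rule forms_seminormed[OF E_forms E_subspace])

sublocale all: complex_seminormed_space "form_scale sw" "slot_forms K sw n" N sw_const
  by (rule forms_seminormed[OF order_refl subspace_slot_forms[OF admissible]])

lemma T_zero: "T 1 0 = 0"
  using T_bounded_linear[of 1] by (simp add: linear_simps)

lemma D_zero: "D 0 = 0"
  using D_bounded_linear by (simp add: linear_simps)

lemma slot_T_forms: "P \<in> slot_forms K sw n \<Longrightarrow> i < n \<Longrightarrow> 0 \<le> t \<Longrightarrow> slot i (T t) P \<in> slot_forms K sw n"
  by (rule slot_in_forms[OF _ _ T_bounded_linear T_linear_over])

lemma slot_D_forms: "P \<in> slot_forms K sw n \<Longrightarrow> i < n \<Longrightarrow> slot i D P \<in> slot_forms K sw n"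
  by (rule slot_in_forms[OF _ _ D_bounded_linear D_linear_over])

lemma slot_bounded_endo:
  assumes i: "i < n" and A: "bounded_linear A" and AE: "\<And>P. P \<in> E \<Longrightarrow> slot i A P \<in> E"
  shows "forms.bounded_endo (slot i A)"
  unfolding forms.bounded_endo_def
proof (intro conjI slot_linear ballI AE)
  obtain a where a: "\<And>x. norm (A x) \<le> norm x * a" "0 \<le> a"
    using bounded_linear.nonneg_bounded[OF A(1)] by blast
  then have "norm (A x) \<le> a * norm x" for x
    by (subst mult.commute)
  then show "\<exists>\<beta>. \<forall>P\<in>E. N (slot i A P) \<le> \<beta> * N P"
    using E_forms a(2) by (intro exI[of _ a] ballI form_norm_le slot_form_bound[OF _ i]) auto
qed

lemma slot_functional:
  assumes P: "P \<in> slot_forms K sw n" and i: "i < n"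
  shows "linear_over K (Complex_Scalars sw) (\<lambda>x. P (v(i := x)))"
    and "bounded_linear (\<lambda>x. P (v(i := x)))"
proof -
  show 1: "linear_over K (Complex_Scalars sw) (\<lambda>x. P (v(i := x)))"
    using P i unfolding slot_forms_def by blast
  interpret f: linear "\<lambda>x. P (v(i := x))"
    by (rule linear_over_real_linear[OF complex_target_axioms admissible 1])
  show "bounded_linear (\<lambda>x. P (v(i := x)))"
  proof (rule bounded_linear_intro)
    show "norm (P (v(i := x))) \<le> norm x * (N P * (\<Prod>j\<in>{..<n} - {i}. norm (v j)))" for x
      using norm_form_le[OF P, of "v(i := x)"] unfolding prod_upd_slot[OF i] by (simp add: mult_ac)
  qed (simp_all add: f.add f.scaleR)
qed

text \<open>
  Along an orbit in slot \<open>i\<close>, the derivative of \<open>exp (- \<mu> s)\<close> times the form is the defect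
  \<open>slot i D P - \<mu> slot i (T 1) P\<close> evaluated on a bounded multiple of the arguments. A small defect thus
  means that \<open>T t\<close> acts on \<open>P\<close> nearly as \<open>exp (\<mu> (t - 1)) T 1\<close>.
\<close>

lemma slot_T_exponential:
  assumes i: "i < n"
  shows "\<exists>C. \<forall>P\<in>slot_forms K sw n. \<forall>t\<in>{1..2}.
    N (slot i (T t) P - form_scale sw (exp (\<mu> * of_real (t - 1))) (slot i (T 1) P))
      \<le> C * N (slot i D P - form_scale sw \<mu> (slot i (T 1) P))"
proof -
  obtain M0 where M0: "\<And>t x. t \<in> {0..1} \<Longrightarrow> norm (T t x) \<le> M0 * norm x"
    using T_uniform by blast
  define M where "M = \<bar>M0\<bar>"
  have M: "norm (T t x) \<le> M * norm x" if "t \<in> {0..1}" for t x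
    using M0[OF that, of x] unfolding M_def
    by (meson abs_ge_self mult_right_mono norm_ge_zero order_trans)
  have M_nn: "0 \<le> M" unfolding M_def by simp
  define H where "H = sw_const"
  have H: "0 < H" "norm (sw c w) \<le> H * cmod c * norm w" for c w
    unfolding H_def by (rule sw_const)+
  define e where "e = exp (2 * cmod \<mu>)"
  have e_nn: "0 \<le> e" unfolding e_def by simp
  have e: "cmod (exp (\<mu> * of_real s)) \<le> e" "cmod (exp (- (\<mu> * of_real s))) \<le> e" if "s \<in> {0..2}" for s
  proof -
    have "\<bar>Re \<mu> * s\<bar> \<le> cmod \<mu> * 2"
      unfolding abs_mult using that by (intro mult_mono abs_Re_le_cmod) auto
    then show "cmod (exp (\<mu> * of_real s)) \<le> e" "cmod (exp (- (\<mu> * of_real s))) \<le> e"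
      unfolding e_def by auto
  qed
  define C where "C = H * e * (H * e * M)"
  have C_nn: "0 \<le> C" unfolding C_def using H(1) e_nn M_nn by simp
  have "N (slot i (T t) P - form_scale sw (exp (\<mu> * of_real (t - 1))) (slot i (T 1) P))
      \<le> C * N (slot i D P - form_scale sw \<mu> (slot i (T 1) P))"
    if P: "P \<in> slot_forms K sw n" and t: "t \<in> {1..2}" for P t
  proof -
    define Q where "Q = slot i D P - form_scale sw \<mu> (slot i (T 1) P)"
    have Q: "Q \<in> slot_forms K sw n"
      unfolding Q_def using P i by (intro all.E_intros slot_D_forms slot_T_forms) auto
    have QN: "0 \<le> N Q" by (rule form_norm_nonneg[OF Q])
    show ?thesis
      unfolding Q_def[symmetric]
    proof (rule form_norm_le, unfold form_bound_def, intro conjI allI)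
      show "0 \<le> C * N Q" using C_nn QN by simp
      fix v :: "nat \<Rightarrow> 'a"
      define f where "f x = P (v(i := x))" for x
      have f: "linear_over K (Complex_Scalars sw) f" "bounded_linear f"
        unfolding f_def by (rule slot_functional[OF P i])+
      define rest where "rest = (\<Prod>j\<in>{..<n} - {i}. norm (v j))"
      have rest: "0 \<le> rest" unfolding rest_def by (intro prod_nonneg) auto
      have Qf: "Q (v(i := x)) = f (D x) - sw \<mu> (f (T 1 x))" for x
        by (simp add: Q_def slot_def form_scale_def f_def)
      define u where "u s = f (T s (v i))" for s
      define g where "g s = sw (exp (- (\<mu> * of_real s))) (u s)" for s
      define g' where "g' s = sw (exp (- (\<mu> * of_real s))) (Q (v(i := T (s - 1) (v i))))" for s
      have deriv: "(g has_vector_derivative g' s) (at s)" if s: "s \<in> {1..2}" for s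
      proof -
        have du: "(u has_vector_derivative f (T (s - 1) (D (v i)))) (at s)"
          unfolding u_def using s by (intro bounded_linear.has_vector_derivative[OF f(2)] T_deriv) auto
        have de: "((\<lambda>s. exp (- (\<mu> * of_real s))) has_vector_derivative (- \<mu> * exp (- (\<mu> * of_real s)))) (at s)"
        proof -
          have "((\<lambda>z. exp (- (\<mu> * z))) has_field_derivative (- \<mu> * exp (- (\<mu> * of_real s)))) (at (of_real s))"
            by (auto intro!: derivative_eq_intros)
          then show ?thesis by (rule has_vector_derivative_real_field)
        qed
        have "(g has_vector_derivative (sw (exp (- (\<mu> * of_real s))) (f (T (s - 1) (D (v i))))
            + sw (- \<mu> * exp (- (\<mu> * of_real s))) (u s))) (at s)"
          unfolding g_def by (rule bounded_bilinear.has_vector_derivative[OF bilinear de du])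
        also have "sw (exp (- (\<mu> * of_real s))) (f (T (s - 1) (D (v i))))
            + sw (- \<mu> * exp (- (\<mu> * of_real s))) (u s) = g' s"
        proof -
          have "T s (v i) = T 1 (T (s - 1) (v i))"
            using T_add[of 1 "s - 1" "v i"] s by simp
          moreover have "D (T (s - 1) (v i)) = T (s - 1) (D (v i))"
            using s by (intro D_commute) auto
          ultimately show ?thesis
            unfolding g'_def Qf u_def by (simp add: sw.scale_right_diff_distrib mult.commute)
        qed
        finally show ?thesis .
      qed
      have bd: "norm (g' s) \<le> H * e * (N Q * (M * norm (v i) * rest))" if s: "s \<in> {1..2}" for s
      proof -
        have "norm (g' s) \<le> H * cmod (exp (- (\<mu> * of_real s))) * norm (Q (v(i := T (s - 1) (v i))))"
          unfolding g'_def by (rule H)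
        also have "\<dots> \<le> H * e * norm (Q (v(i := T (s - 1) (v i))))"
          using s H(1) by (intro mult_right_mono mult_left_mono e) auto
        also have "norm (Q (v(i := T (s - 1) (v i)))) \<le> N Q * (norm (T (s - 1) (v i)) * rest)"
          using norm_form_le[OF Q, of "v(i := T (s - 1) (v i))"] unfolding prod_upd_slot[OF i] rest_def .
        also have "\<dots> \<le> N Q * (M * norm (v i) * rest)"
          using s QN rest by (intro mult_left_mono mult_right_mono M) auto
        finally show ?thesis using H(1) e_nn by (simp add: mult_left_mono)
      qed
      have "norm (g t - g 1) \<le> H * e * (N Q * (M * norm (v i) * rest)) * norm (t - 1)"
      proof (rule differentiable_bound[where S = "{1..2}"])
        fix s :: real assume s: "s \<in> {1..2}"
        show "(g has_derivative (\<lambda>h. h *\<^sub>R g' s)) (at s within {1..2})"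
          using deriv[OF s] by (auto simp: has_vector_derivative_def intro: has_derivative_at_withinI)
        show "onorm (\<lambda>h. h *\<^sub>R g' s) \<le> H * e * (N Q * (M * norm (v i) * rest))"
        proof (rule onorm_le)
          fix x :: real
          have "\<bar>x\<bar> * norm (g' s) \<le> \<bar>x\<bar> * (H * e * (N Q * (M * norm (v i) * rest)))"
            by (intro mult_left_mono bd s) auto
          then show "norm (x *\<^sub>R g' s) \<le> H * e * (N Q * (M * norm (v i) * rest)) * norm x"
            by (simp add: mult_ac)
        qed
      qed (use t in auto)
      also have "\<dots> \<le> H * e * (N Q * (M * norm (v i) * rest)) * 1"
        using t H(1) e_nn QN M_nn rest by (intro mult_left_mono) auto
      finally have gt: "norm (g t - g 1) \<le> H * e * (N Q * (M * norm (v i) * rest))" by simp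
      have "(slot i (T t) P - form_scale sw (exp (\<mu> * of_real (t - 1))) (slot i (T 1) P)) v
         = u t - sw (exp (\<mu> * of_real (t - 1))) (u 1)"
        by (simp add: slot_def form_scale_def u_def f_def)
      also have "\<dots> = sw (exp (\<mu> * of_real t)) (g t - g 1)"
        by (simp add: g_def sw.scale_right_diff_distrib exp_add[symmetric] algebra_simps)
      also have "norm \<dots> \<le> H * cmod (exp (\<mu> * of_real t)) * norm (g t - g 1)"
        by (rule H)
      also have "\<dots> \<le> H * e * (H * e * (N Q * (M * norm (v i) * rest)))"
        using t H(1) e_nn by (intro mult_mono mult_left_mono e gt) auto
      also have "\<dots> = C * N Q * (norm (v i) * rest)" unfolding C_def by simp
      also have "norm (v i) * rest = (\<Prod>j<n. norm (v j))"
        unfolding rest_def using i by (subst prod.remove[of "{..<n}" i]) auto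
      finally show "norm ((slot i (T t) P - form_scale sw (exp (\<mu> * of_real (t - 1))) (slot i (T 1) P)) v)
        \<le> C * N Q * (\<Prod>j<n. norm (v j))" .
    qed
  qed
  then show ?thesis by blast
qed

text \<open>
  An operator \<open>R\<close> on forms is negligible relative to \<open>ops\<close> if it maps approximate joint eigenvectors of
  tolerance \<open>\<epsilon>\<close> to forms of size \<open>O(\<epsilon>)\<close>. Calculating modulo negligible operators is calculating with exact
  eigenvectors, without having any.
\<close>

definition negligible ::
    "((((nat \<Rightarrow> 'a) \<Rightarrow> 'w) \<Rightarrow> (nat \<Rightarrow> 'a) \<Rightarrow> 'w) \<times> complex) set
      \<Rightarrow> (((nat \<Rightarrow> 'a) \<Rightarrow> 'w) \<Rightarrow> (nat \<Rightarrow> 'a) \<Rightarrow> 'w) \<Rightarrow> bool" where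
  "negligible ops R \<longleftrightarrow> (\<forall>P\<in>E. R P \<in> slot_forms K sw n) \<and>
     (\<exists>C. \<forall>P\<in>E. \<forall>\<epsilon>>0. (\<forall>(A, m)\<in>ops. N (A P - form_scale sw m P) \<le> \<epsilon> * N P) \<longrightarrow> N (R P) \<le> C * \<epsilon> * N P)"

lemma negligible_forms: "negligible ops R \<Longrightarrow> P \<in> E \<Longrightarrow> R P \<in> slot_forms K sw n"
  unfolding negligible_def by blast

lemma negligible_cong: "negligible ops X \<Longrightarrow> (\<And>P v. X P v = Y P v) \<Longrightarrow> negligible ops Y"
proof -
  assume "\<And>P v. X P v = Y P v"
  then have "X = Y" by (intro ext)
  then show "negligible ops X \<Longrightarrow> negligible ops Y" by simp
qed

lemma negligible_zero: "negligible ops (\<lambda>P. 0)"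
  unfolding negligible_def
  by (intro conjI ballI allI impI exI[of _ 0] all.E_intros) (simp only: all.N_zero mult_zero_left order_refl)

lemma negligible_le:
  assumes X: "negligible ops X" and R: "\<And>P. P \<in> E \<Longrightarrow> R P \<in> slot_forms K sw n"
    and le: "\<And>P. P \<in> E \<Longrightarrow> N (R P) \<le> C * N (X P)"
  shows "negligible ops R"
proof -
  obtain C' where C': "\<And>P \<epsilon>. P \<in> E \<Longrightarrow> 0 < \<epsilon> \<Longrightarrow> \<forall>(A, m)\<in>ops. N (A P - form_scale sw m P) \<le> \<epsilon> * N P \<Longrightarrow>
      N (X P) \<le> C' * \<epsilon> * N P"
    using X unfolding negligible_def by blast
  have "N (R P) \<le> (\<bar>C\<bar> * C') * \<epsilon> * N P"
    if P: "P \<in> E" and \<epsilon>: "0 < \<epsilon>" "\<forall>(A, m)\<in>ops. N (A P - form_scale sw m P) \<le> \<epsilon> * N P" for P \<epsilon>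
  proof -
    have "N (R P) \<le> \<bar>C\<bar> * N (X P)"
      using le[OF P] form_norm_nonneg[OF negligible_forms[OF X P]]
      by (meson abs_ge_self mult_right_mono order_trans)
    also have "\<dots> \<le> \<bar>C\<bar> * (C' * \<epsilon> * N P)" by (intro mult_left_mono C' P \<epsilon>) auto
    finally show ?thesis by (simp only: mult.assoc)
  qed
  then show ?thesis using R unfolding negligible_def by blast
qed

lemma negligible_add:
  assumes X: "negligible ops X" and Y: "negligible ops Y"
  shows "negligible ops (\<lambda>P. X P + Y P)"
proof -
  let ?near = "\<lambda>\<epsilon> P. \<forall>(A, m)\<in>ops. N (A P - form_scale sw m P) \<le> \<epsilon> * N P"
  obtain C where C: "\<And>P \<epsilon>. P \<in> E \<Longrightarrow> 0 < \<epsilon> \<Longrightarrow> ?near \<epsilon> P \<Longrightarrow> N (X P) \<le> C * \<epsilon> * N P"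
    using X unfolding negligible_def by blast
  obtain C' where C': "\<And>P \<epsilon>. P \<in> E \<Longrightarrow> 0 < \<epsilon> \<Longrightarrow> ?near \<epsilon> P \<Longrightarrow> N (Y P) \<le> C' * \<epsilon> * N P"
    using Y unfolding negligible_def by blast
  have XY: "X P + Y P \<in> slot_forms K sw n" "N (X P + Y P) \<le> N (X P) + N (Y P)" if "P \<in> E" for P
    using negligible_forms[OF X that] negligible_forms[OF Y that] by (auto intro: all.E_intros all.N_triangle)
  have "N (X P + Y P) \<le> (C + C') * \<epsilon> * N P" if "P \<in> E" "0 < \<epsilon>" "?near \<epsilon> P" for P \<epsilon>
    using XY(2)[OF that(1)] C[OF that] C'[OF that] by (simp add: distrib_right)
  then show ?thesis using XY(1) unfolding negligible_def by blast
qed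

lemma negligible_scale: "negligible ops X \<Longrightarrow> negligible ops (\<lambda>P. form_scale sw z (X P))"
  by (rule negligible_le[where C = "sw_const * cmod z"]) (auto intro: all.E_intros all.N_scale negligible_forms)

lemma negligible_diff:
  assumes "negligible ops X" "negligible ops Y"
  shows "negligible ops (\<lambda>P. X P - Y P)"
  by (rule negligible_cong[OF negligible_add[OF assms(1) negligible_scale[OF assms(2), of "- 1"]]])
    (simp add: form_scale_def)

lemma negligible_slot:
  assumes X: "negligible ops X" and i: "i < n" and A: "bounded_linear A" "linear_over K K A"
  shows "negligible ops (\<lambda>P. slot i A (X P))"
proof -
  obtain a where a: "\<And>x. norm (A x) \<le> norm x * a" "0 \<le> a"
    using bounded_linear.nonneg_bounded[OF A(1)] by blast
  have "norm (A x) \<le> a * norm x" for x using a(1)[of x] by (simp only: mult.commute)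
  then show ?thesis
    by (intro negligible_le[OF X, of _ a] form_norm_le slot_form_bound[OF negligible_forms[OF X] i _ a(2)]
        slot_in_forms[OF negligible_forms[OF X] i A])
qed

lemma negligible_op:
  assumes "(A, m) \<in> ops" and A: "\<And>P. P \<in> E \<Longrightarrow> A P \<in> slot_forms K sw n"
  shows "negligible ops (\<lambda>P. A P - form_scale sw m P)"
  unfolding negligible_def
proof (intro conjI exI[of _ 1] ballI allI impI)
  fix P assume "P \<in> E"
  then show "A P - form_scale sw m P \<in> slot_forms K sw n" using E_forms by (intro all.E_intros A) auto
qed (use assms(1) in auto)

text \<open>
  All conclusions about eigenvalues are drawn here: a scalar that annihilates approximate eigenvectors up
  to \<open>O(\<epsilon>)\<close> is zero, as these have arbitrarily small tolerance and positive norm.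
\<close>

lemma zero_if_negligible:
  assumes approx: "forms.approximate_eigenvalues ops" and negl: "negligible ops (form_scale sw c)"
  shows "c = 0"
proof (rule ccontr)
  assume "c \<noteq> 0"
  obtain C where C: "\<And>P \<epsilon>. P \<in> E \<Longrightarrow> 0 < \<epsilon> \<Longrightarrow> \<forall>(A, m)\<in>ops. N (A P - form_scale sw m P) \<le> \<epsilon> * N P \<Longrightarrow>
      N (form_scale sw c P) \<le> C * \<epsilon> * N P"
    using negl unfolding negligible_def by blast
  define \<epsilon> where "\<epsilon> = cmod c / (2 * sw_const * (\<bar>C\<bar> + 1))"
  have \<epsilon>: "0 < \<epsilon>" using \<open>c \<noteq> 0\<close> sw_const(1) unfolding \<epsilon>_def by (intro divide_pos_pos) auto
  then obtain P where P: "P \<in> E" "0 < N P" "\<forall>(A, m)\<in>ops. N (A P - form_scale sw m P) \<le> \<epsilon> * N P"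
    using approx unfolding forms.approximate_eigenvalues_def by blast
  have "cmod c * N P \<le> sw_const * N (form_scale sw c P)"
    by (rule forms.N_unscale[OF P(1)])
  also have "\<dots> \<le> sw_const * (C * \<epsilon> * N P)" using C[OF P(1) \<epsilon> P(3)] sw_const(1) by (intro mult_left_mono) auto
  finally have "cmod c \<le> sw_const * C * \<epsilon>" using P(2) by (simp add: mult_ac)
  also have "\<dots> \<le> sw_const * (\<bar>C\<bar> + 1) * \<epsilon>"
    using sw_const(1) \<epsilon> by (intro mult_right_mono mult_left_mono) auto
  also have "\<dots> = cmod c / 2"
  proof -
    have "sw_const * (\<bar>C\<bar> + 1) \<noteq> 0" using sw_const(1) by (simp add: add_nonneg_eq_0_iff)
    then show ?thesis unfolding \<epsilon>_def by (simp add: field_simps)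
  qed
  finally show False using \<open>c \<noteq> 0\<close> by simp
qed

context
  fixes ops i \<tau> d
  assumes approx: "forms.approximate_eigenvalues ops"
    and ops: "(slot i (T 1), \<tau>) \<in> ops" "(slot i D, d) \<in> ops"
    and i: "i < n" and \<tau>: "\<tau> \<noteq> 0"
begin

lemma negligible_T_1: "negligible ops (\<lambda>P. slot i (T 1) P - form_scale sw \<tau> P)"
  using E_forms i by (intro negligible_op ops slot_T_forms) auto

lemma negligible_defect:
  "negligible ops (\<lambda>P. slot i D P - form_scale sw (d / \<tau>) (slot i (T 1) P))" (is "negligible _ ?R")
proof -
  have "negligible ops (\<lambda>P. slot i D P - form_scale sw d P)"
    using E_forms i by (intro negligible_op ops slot_D_forms) auto
  from negligible_diff[OF this negligible_scale[OF negligible_T_1, of "d / \<tau>"]]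
  show ?thesis
    by (rule negligible_cong) (use \<tau> in \<open>simp add: form_scale_def sw.scale_right_diff_distrib\<close>)
qed

text \<open>
  Off the spectrum, \<open>slot i (T 1) P\<close> factors through the negligible defect
  \<open>slot i D P - \<mu> slot i (T 1) P\<close> for \<open>\<mu> = d / \<tau>\<close>, whereas it is close to \<open>\<tau> P\<close> with \<open>\<tau> \<noteq> 0\<close>.
\<close>

lemma joint_eigenvalue_in_spectrum: "d / \<tau> \<in> \<Lambda>"
proof (rule ccontr)
  define \<mu> where "\<mu> = d / \<tau>"
  assume "\<not> d / \<tau> \<in> \<Lambda>"
  then have "resolvent_witness K (T 1) D \<mu>" unfolding \<mu>_def by (rule resolvent)
  from resolvent_witness_functional[OF admissible this T_zero D_zero]
  obtain R1 R2 where R: "bounded_linear R1" "bounded_linear R2"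
    "\<And>f y. linear_over K (Complex_Scalars sw) f \<Longrightarrow>
       f (T 1 y) = (sw \<mu> (f (T 1 (R1 y))) - f (D (R1 y))) + sw \<i> (sw \<mu> (f (T 1 (R2 y))) - f (D (R2 y)))"
    by blast
  obtain r1 r2 where r: "\<And>x. norm (R1 x) \<le> norm x * r1" "0 \<le> r1" "\<And>x. norm (R2 x) \<le> norm x * r2" "0 \<le> r2"
    using bounded_linear.nonneg_bounded[OF R(1)] bounded_linear.nonneg_bounded[OF R(2)] by blast
  define C1 where "C1 = r1 + sw_const * r2"
  have C1: "0 \<le> C1" unfolding C1_def using r sw_const(1) by simp
  have T1: "N (slot i (T 1) P) \<le> C1 * N (slot i D P - form_scale sw \<mu> (slot i (T 1) P))" if P: "P \<in> E" for P
  proof -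
    have Pf: "P \<in> slot_forms K sw n" using P E_forms by blast
    define Q where "Q = slot i D P - form_scale sw \<mu> (slot i (T 1) P)"
    have Q: "Q \<in> slot_forms K sw n"
      unfolding Q_def using Pf i by (intro all.E_intros slot_D_forms slot_T_forms) auto
    have QN: "0 \<le> N Q" by (rule form_norm_nonneg[OF Q])
    show ?thesis unfolding Q_def[symmetric]
    proof (rule form_norm_le, unfold form_bound_def, intro conjI allI)
      show "0 \<le> C1 * N Q" using C1 QN by simp
      fix v :: "nat \<Rightarrow> 'a"
      define rest where "rest = (\<Prod>j\<in>{..<n} - {i}. norm (v j))"
      have rest: "0 \<le> rest" unfolding rest_def by (intro prod_nonneg) auto
      have Qb: "norm (Q (v(i := x))) \<le> N Q * (norm x * rest)" for x
        using norm_form_le[OF Q, of "v(i := x)"] unfolding prod_upd_slot[OF i] rest_def .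
      have "slot i (T 1) P v = - Q (v(i := R1 (v i))) - sw \<i> (Q (v(i := R2 (v i))))"
        using R(3)[OF slot_functional(1)[OF Pf i, of v], of "v i"]
        by (simp add: slot_def Q_def form_scale_def sw.scale_right_diff_distrib)
      also have "norm \<dots> \<le> norm (Q (v(i := R1 (v i)))) + norm (sw \<i> (Q (v(i := R2 (v i)))))"
        by (metis norm_minus_cancel norm_triangle_ineq4)
      also have "\<dots> \<le> norm (Q (v(i := R1 (v i)))) + sw_const * norm (Q (v(i := R2 (v i))))"
        using sw_const(2)[of \<i>] by simp
      also have "\<dots> \<le> N Q * ((norm (v i) * r1) * rest) + sw_const * (N Q * ((norm (v i) * r2) * rest))"
        using sw_const(1) QN rest r
        by (intro add_mono mult_left_mono order_trans[OF Qb] mult_right_mono) auto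
      also have "\<dots> = C1 * N Q * (norm (v i) * rest)" unfolding C1_def by (simp add: algebra_simps)
      also have "norm (v i) * rest = (\<Prod>j<n. norm (v j))"
        unfolding rest_def using i by (subst prod.remove[of "{..<n}" i]) auto
      finally show "norm (slot i (T 1) P v) \<le> C1 * N Q * (\<Prod>j<n. norm (v j))" .
    qed
  qed
  have "negligible ops (slot i (T 1))"
    using E_forms i unfolding \<mu>_def
    by (intro negligible_le[OF negligible_defect _ T1[unfolded \<mu>_def]] slot_T_forms) auto
  from negligible_diff[OF this negligible_T_1] have "negligible ops (form_scale sw \<tau>)"
    by (rule negligible_cong) simp
  then show False using zero_if_negligible[OF approx] \<tau> by blast
qed

lemma negligible_T_shifted:
  assumes t: "t \<in> {1..2}"
  shows "negligible ops (\<lambda>P. slot i (T t) P - form_scale sw (exp (d / \<tau> * of_real (t - 1)) * \<tau>) P)"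
proof -
  define z where "z = exp (d / \<tau> * of_real (t - 1))"
  obtain C where C: "\<And>P. P \<in> slot_forms K sw n \<Longrightarrow>
    N (slot i (T t) P - form_scale sw z (slot i (T 1) P))
      \<le> C * N (slot i D P - form_scale sw (d / \<tau>) (slot i (T 1) P))"
    using slot_T_exponential[OF i, of "d / \<tau>"] t unfolding z_def by blast
  have "negligible ops (\<lambda>P. slot i (T t) P - form_scale sw z (slot i (T 1) P))"
  proof (rule negligible_le[OF negligible_defect])
    fix P assume "P \<in> E"
    then have P: "P \<in> slot_forms K sw n" using E_forms by blast
    show "slot i (T t) P - form_scale sw z (slot i (T 1) P) \<in> slot_forms K sw n"
      using t by (intro all.E_intros slot_T_forms P i) auto
    show "N (slot i (T t) P - form_scale sw z (slot i (T 1) P))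
      \<le> C * N (slot i D P - form_scale sw (d / \<tau>) (slot i (T 1) P))" by (rule C[OF P])
  qed
  from negligible_add[OF this negligible_scale[OF negligible_T_1, of z]]
  show ?thesis unfolding z_def[symmetric]
    by (rule negligible_cong) (simp add: form_scale_def sw.scale_right_diff_distrib)
qed

text \<open>
  The action of \<open>T 2\<close> is close to \<open>\<tau>\<^sup>2\<close>, being that of \<open>T 1\<close> twice, and close to
  \<open>exp \<mu> \<tau>\<close> by the differential equation, where \<open>\<mu> = d / \<tau>\<close>.
\<close>

lemma joint_eigenvalue_exp: "exp (d / \<tau>) = \<tau>"
proof -
  let ?X = "\<lambda>P. slot i (T 1) P - form_scale sw \<tau> P"
  let ?W = "\<lambda>P. slot i (T 2) P - form_scale sw (exp (d / \<tau>) * \<tau>) P"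
  have "negligible ops ?W" using negligible_T_shifted[of 2] by simp
  moreover have "negligible ops (\<lambda>P. slot i (T 1) (?X P) + form_scale sw \<tau> (?X P))"
    by (intro negligible_add[OF negligible_slot[OF negligible_T_1 i] negligible_scale[OF negligible_T_1]]
        T_bounded_linear T_linear_over) auto
  ultimately have "negligible ops (\<lambda>P. ?W P - (slot i (T 1) (?X P) + form_scale sw \<tau> (?X P)))"
    by (rule negligible_diff)
  then have "negligible ops (form_scale sw (\<tau> * \<tau> - exp (d / \<tau>) * \<tau>))"
  proof (rule negligible_cong)
    fix P v
    have "T 2 (v i) = T 1 (T 1 (v i))" using T_add[of 1 1] by simp
    then show "(?W P - (slot i (T 1) (?X P) + form_scale sw \<tau> (?X P))) v
        = form_scale sw (\<tau> * \<tau> - exp (d / \<tau>) * \<tau>) P v"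
      by (simp add: slot_def form_scale_def sw.scale_right_diff_distrib sw.scale_left_diff_distrib)
  qed
  then have "\<tau> * \<tau> - exp (d / \<tau>) * \<tau> = 0" by (rule zero_if_negligible[OF approx])
  then show ?thesis using \<tau> by (simp add: left_diff_distrib[symmetric])
qed

lemma joint_eigenvalue_semigroup:
  assumes t: "t \<in> {1..2}"
  shows "negligible ops (\<lambda>P. slot i (T t) P - form_scale sw (exp (d / \<tau> * of_real t)) P)"
proof -
  have "exp (d / \<tau> * of_real (t - 1)) * \<tau> = exp (d / \<tau> * of_real (t - 1)) * exp (d / \<tau>)"
    by (simp only: joint_eigenvalue_exp)
  also have "\<dots> = exp (d / \<tau> * of_real t)"
    by (simp add: exp_add[symmetric] algebra_simps)
  finally show ?thesis using negligible_T_shifted[OF t] by simp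
qed

end

end

lemma slot_commute:
  assumes "i \<noteq> j \<or> (\<forall>x. A (B x) = B (A x))"
  shows "slot i A (slot j B P) = slot j B (slot i A P)"
proof (cases "i = j")
  case True
  then show ?thesis using assms by (simp add: slot_def)
next
  case False
  then show ?thesis by (simp add: slot_def fun_upd_twist)
qed

lemma exp_scaled_eq_1_imp_0:
  assumes "\<And>t. t \<in> {1..2} \<Longrightarrow> exp (\<nu> * complex_of_real t) = 1"
  shows "\<nu> = 0"
proof -
  \<comment> \<open>So small that the imaginary part of \<open>\<nu> s\<close> cannot be a nonzero multiple of \<open>2 \<pi>\<close>.\<close>
  define s where "s = 1 / (1 + cmod \<nu>)"
  have s: "0 < s" "s \<le> 1" unfolding s_def by (auto simp: field_simps add_pos_nonneg)
  have "exp (\<nu> * of_real (1 + s)) = exp (\<nu> * of_real 1) * exp (\<nu> * of_real s)"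
    by (simp add: exp_add[symmetric] distrib_left)
  then have "exp (\<nu> * of_real s) = 1"
    using assms[of 1] assms[of "1 + s"] s by simp
  then obtain n :: int where n: "Re \<nu> * s = 0" "Im \<nu> * s = of_int (2 * n) * pi"
    unfolding exp_eq_1 by auto
  have "\<bar>Im \<nu> * s\<bar> \<le> cmod \<nu> * s"
    unfolding abs_mult using s by (intro mult_mono abs_Im_le_cmod) auto
  also have "\<dots> < 1" unfolding s_def by (simp add: add_pos_nonneg)
  finally have "\<bar>of_int (2 * n) * pi\<bar> < 1" using n(2) by simp
  then have "n = 0"
  proof (rule contrapos_pp)
    assume "n \<noteq> 0"
    then have "1 \<le> \<bar>real_of_int n\<bar>" by linarith
    then have "2 * 2 \<le> 2 * \<bar>real_of_int n\<bar> * pi"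
      using pi_ge_two by (intro mult_mono) auto
    moreover have "\<bar>of_int (2 * n) * pi\<bar> = 2 * \<bar>real_of_int n\<bar> * pi" by (simp add: abs_mult)
    ultimately show "\<not> \<bar>of_int (2 * n) * pi\<bar> < 1" by linarith
  qed
  then show ?thesis using n s by (simp add: complex_eq_iff)
qed

context semigroup_forms
begin

lemma slot_T1_endo: "i < n \<Longrightarrow> forms.bounded_endo (slot i (T 1))"
  by (intro slot_bounded_endo T_bounded_linear E_slot) auto

lemma slot_D_endo: "i < n \<Longrightarrow> forms.bounded_endo (slot i D)"
  by (intro slot_bounded_endo D_bounded_linear E_slot) auto

text \<open>
  Operators acting in different slots commute, and so do \<open>T 1\<close> and \<open>D\<close> in the same slot.
\<close>

lemma joint_approximate_eigenvalues:
  assumes P0: "P0 \<in> E" "0 < N P0" and "k \<le> n"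
  shows "\<exists>\<tau> d. forms.approximate_eigenvalues (\<Union>i<k. {(slot i (T 1), \<tau> i), (slot i D, d i)})"
  using \<open>k \<le> n\<close>
proof (induction k)
  case 0
  then show ?case using P0 by (auto simp: forms.approximate_eigenvalues_def)
next
  case (Suc k)
  then obtain \<tau> d where ops: "forms.approximate_eigenvalues (\<Union>i<k. {(slot i (T 1), \<tau> i), (slot i D, d i)})"
    (is "forms.approximate_eigenvalues ?ops") by auto
  have k: "k < n" using Suc by simp
  have comm: "D (T 1 x) = T 1 (D x)" for x by (rule D_commute) simp
  have ops_cases: "\<exists>i<k. A = slot i (T 1) \<or> A = slot i D" if "(A, m) \<in> ?ops" for A m
    using that by auto
  have endo: "forms.bounded_endo A" if "(A, m) \<in> ?ops" for A m
    using ops_cases[OF that] slot_T1_endo slot_D_endo k by (metis less_trans)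
  have 1: "\<exists>m. forms.approximate_eigenvalues (insert (slot k (T 1), m) ?ops)"
  proof (rule forms.approximate_eigenvalue_extend[OF _ endo slot_T1_endo[OF k] _ ops])
    show "A (slot k (T 1) P) = slot k (T 1) (A P)" if "(A, m) \<in> ?ops" for A m P
      using ops_cases[OF that] by (auto simp: slot_commute)
  qed auto
  then obtain \<tau>' where ops': "forms.approximate_eigenvalues (insert (slot k (T 1), \<tau>') ?ops)" by blast
  have "\<exists>m. forms.approximate_eigenvalues (insert (slot k D, m) (insert (slot k (T 1), \<tau>') ?ops))"
  proof (rule forms.approximate_eigenvalue_extend[OF _ _ slot_D_endo[OF k] _ ops'])
    show "forms.bounded_endo A" if "(A, m) \<in> insert (slot k (T 1), \<tau>') ?ops" for A m
      using that endo slot_T1_endo[OF k] by blast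
    show "A (slot k D P) = slot k D (A P)" if "(A, m) \<in> insert (slot k (T 1), \<tau>') ?ops" for A m P
      using that
    proof
      assume "(A, m) = (slot k (T 1), \<tau>')"
      then show ?thesis by (simp add: slot_commute comm)
    next
      assume "(A, m) \<in> ?ops"
      from ops_cases[OF this] show ?thesis by (auto simp: slot_commute)
    qed
  qed auto
  then obtain d' where d': "forms.approximate_eigenvalues (insert (slot k D, d') (insert (slot k (T 1), \<tau>') ?ops))" by blast
  have old: "(\<Union>i<k. {(slot i (T 1), (\<tau>(k := \<tau>')) i), (slot i D, (d(k := d')) i)}) = ?ops"
    by (intro SUP_cong refl) auto
  have "(\<Union>i<Suc k. {(slot i (T 1), (\<tau>(k := \<tau>')) i), (slot i D, (d(k := d')) i)})
      = insert (slot k D, d') (insert (slot k (T 1), \<tau>') ?ops)"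
    unfolding lessThan_Suc UN_insert old by auto
  then have "forms.approximate_eigenvalues (\<Union>i<Suc k. {(slot i (T 1), (\<tau>(k := \<tau>')) i), (slot i D, (d(k := d')) i)})"
    using d' by simp
  then show ?case by blast
qed

text \<open>
  A one-sided spectral mapping theorem: every approximate eigenvalue \<open>m \<noteq> 0\<close> of \<open>T 1\<close> can be completed by
  one of \<open>D\<close> and is then \<open>exp \<mu>\<close> with \<open>\<mu> \<in> \<Lambda>\<close>.
\<close>

theorem slot_growth:
  assumes n: "0 < n" and q: "\<And>\<mu>. \<mu> \<in> \<Lambda> \<Longrightarrow> Re \<mu> < q"
  shows "\<exists>C. \<forall>k. \<forall>P\<in>E. N ((slot 0 (T 1) ^^ k) P) \<le> C * exp (q * real k) * N P"
proof -
  have "forms.power_bounded (slot 0 (T 1)) (1 / exp q)"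
  proof (rule ccontr)
    assume "\<not> ?thesis"
    from forms.approximate_eigenvalue_outside[OF slot_T1_endo[OF n] exp_gt_zero this]
    obtain m where m: "exp q \<le> cmod m" "forms.approximate_eigenvalues {(slot 0 (T 1), m)}" by blast
    have comm: "D (T 1 x) = T 1 (D x)" for x by (rule D_commute) simp
    have "\<exists>d. forms.approximate_eigenvalues (insert (slot 0 D, d) {(slot 0 (T 1), m)})"
      by (rule forms.approximate_eigenvalue_extend[OF _ _ slot_D_endo[OF n] _ m(2)])
        (auto intro: slot_T1_endo n simp: slot_commute comm)
    then obtain d where d: "forms.approximate_eigenvalues (insert (slot 0 D, d) {(slot 0 (T 1), m)})" by blast
    have m0: "m \<noteq> 0" using m(1) exp_gt_zero[of q] by auto
    have ops: "(slot 0 (T 1), m) \<in> insert (slot 0 D, d) {(slot 0 (T 1), m)}"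
      "(slot 0 D, d) \<in> insert (slot 0 D, d) {(slot 0 (T 1), m)}" by auto
    have "Re (d / m) < q" by (rule q[OF joint_eigenvalue_in_spectrum[OF d ops n m0]])
    then have "cmod (exp (d / m)) < exp q" by simp
    then show False using joint_eigenvalue_exp[OF d ops n m0] m(1) by simp
  qed
  then obtain C where C: "\<And>k P. P \<in> E \<Longrightarrow> N ((slot 0 (T 1) ^^ k) P) * (1 / exp q) ^ k \<le> C * N P"
    unfolding forms.power_bounded_def by blast
  have "N ((slot 0 (T 1) ^^ k) P) \<le> C * exp (q * real k) * N P" if "P \<in> E" for k P
  proof -
    have "exp (q * real k) = exp q ^ k" by (metis exp_of_nat_mult mult.commute)
    then show ?thesis using C[OF that, of k] by (simp add: power_divide divide_le_eq mult_ac)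
  qed
  then show ?thesis by blast
qed

text \<open>
  The semigroup acting in the first \<open>k\<close> slots simultaneously.
\<close>

definition flow :: "nat \<Rightarrow> real \<Rightarrow> ((nat \<Rightarrow> 'a) \<Rightarrow> 'w) \<Rightarrow> (nat \<Rightarrow> 'a) \<Rightarrow> 'w" where
  "flow k t P = (\<lambda>v. P (\<lambda>i. if i < k then T t (v i) else v i))"

lemma flow_0: "flow 0 t P = P" by (simp add: flow_def)

lemma flow_Suc: "flow (Suc k) t P = slot k (T t) (flow k t P)"
  unfolding flow_def slot_def
  by (intro ext arg_cong[where f = P]) (auto simp: less_Suc_eq)

lemma negligible_flow:
  assumes t: "0 \<le> t"
    and step: "\<And>i. i < n \<Longrightarrow> negligible ops (\<lambda>P. slot i (T t) P - form_scale sw (c i) P)"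
  shows "k \<le> n \<Longrightarrow> negligible ops (\<lambda>P. flow k t P - form_scale sw (\<Prod>i<k. c i) P)"
proof (induction k)
  case 0
  show ?case by (rule negligible_cong[OF negligible_zero]) (simp add: flow_0 form_scale_def)
next
  case (Suc k)
  let ?X = "\<lambda>P. flow k t P - form_scale sw (\<Prod>i<k. c i) P"
  let ?Y = "\<lambda>P. slot k (T t) P - form_scale sw (c k) P"
  have k: "k < n" using Suc.prems by simp
  then have X: "negligible ops ?X" by (intro Suc.IH) simp
  have "negligible ops (\<lambda>P. slot k (T t) (?X P) + form_scale sw (\<Prod>i<k. c i) (?Y P))"
    by (rule negligible_add[OF negligible_slot[OF X k T_bounded_linear[OF t] T_linear_over[OF t]]
        negligible_scale[OF step[OF k]]])
  then show ?case
    by (rule negligible_cong)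
      (simp add: flow_Suc form_scale_def slot_def sw.scale_right_diff_distrib mult.commute)
qed

text \<open>
  The equation at time \<open>1\<close> shows that the product of the \<open>\<tau> i\<close> is \<open>exp \<kappa>\<close>, so no \<open>\<tau> i\<close> vanishes.
  Comparing the action of \<open>T t\<close> in all slots for a whole interval of times \<open>t\<close> removes the ambiguity of
  the logarithm.
\<close>

theorem invariant_form_eigenvalue:
  assumes P0: "P0 \<in> E" "0 < N P0"
    and inv: "\<And>P t. P \<in> E \<Longrightarrow> t \<in> {1..2} \<Longrightarrow> flow n t P = form_scale sw (exp (\<kappa> * of_real t)) P"
  shows "\<exists>\<mu>. (\<forall>i<n. \<mu> i \<in> \<Lambda>) \<and> \<kappa> = (\<Sum>i<n. \<mu> i)"
proof -
  obtain \<tau> d where approx: "forms.approximate_eigenvalues (\<Union>i<n. {(slot i (T 1), \<tau> i), (slot i D, d i)})"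
    (is "forms.approximate_eigenvalues ?ops")
    using joint_approximate_eigenvalues[OF P0 order_refl] by blast
  have ops: "(slot i (T 1), \<tau> i) \<in> ?ops" "(slot i D, d i) \<in> ?ops" if "i < n" for i
    using that by auto
  have product: "exp (\<kappa> * of_real t) = (\<Prod>i<n. c i)"
    if t: "t \<in> {1..2}" and step: "\<And>i. i < n \<Longrightarrow> negligible ?ops (\<lambda>P. slot i (T t) P - form_scale sw (c i) P)"
    for t c
  proof -
    have "0 \<le> t" using t by simp
    from negligible_flow[OF this step order_refl]
    have negl: "negligible ?ops (\<lambda>P. flow n t P - form_scale sw (\<Prod>i<n. c i) P)" .
    have "negligible ?ops (form_scale sw (exp (\<kappa> * of_real t) - (\<Prod>i<n. c i)))"
    proof (rule negligible_le[OF negl, where C = 1])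
      fix P assume P: "P \<in> E"
      then show "form_scale sw (exp (\<kappa> * of_real t) - (\<Prod>i<n. c i)) P \<in> slot_forms K sw n"
        using E_forms by (intro all.E_intros) auto
      have "form_scale sw (exp (\<kappa> * of_real t) - (\<Prod>i<n. c i)) P = flow n t P - form_scale sw (\<Prod>i<n. c i) P"
        unfolding inv[OF P t] by (rule ext) (simp add: form_scale_def sw.scale_left_diff_distrib)
      then show "N (form_scale sw (exp (\<kappa> * of_real t) - (\<Prod>i<n. c i)) P)
        \<le> 1 * N (flow n t P - form_scale sw (\<Prod>i<n. c i) P)" by (simp only: mult_1 order_refl)
    qed
    from zero_if_negligible[OF approx this] show ?thesis by simp
  qed
  have "exp (\<kappa> * of_real 1) = (\<Prod>i<n. \<tau> i)"
  proof (rule product)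
    show "negligible ?ops (\<lambda>P. slot i (T 1) P - form_scale sw (\<tau> i) P)" if "i < n" for i
      using E_forms that by (intro negligible_op ops slot_T_forms) auto
  qed simp
  then have "(\<Prod>i<n. \<tau> i) \<noteq> 0" using exp_not_eq_zero[of "\<kappa> * of_real 1"] by simp
  then have \<tau>: "\<tau> i \<noteq> 0" if "i < n" for i using that by auto
  define \<mu> where "\<mu> i = d i / \<tau> i" for i
  have spec: "\<mu> i \<in> \<Lambda>" if i: "i < n" for i
    unfolding \<mu>_def by (rule joint_eigenvalue_in_spectrum[OF approx ops[OF i] i \<tau>[OF i]])
  have "exp ((\<kappa> - (\<Sum>i<n. \<mu> i)) * of_real t) = 1" if t: "t \<in> {1..2}" for t
  proof -
    have "exp (\<kappa> * of_real t) = (\<Prod>i<n. exp (\<mu> i * of_real t))"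
      unfolding \<mu>_def by (rule product[OF t joint_eigenvalue_semigroup[OF approx ops _ \<tau> t]])
    also have "\<dots> = exp ((\<Sum>i<n. \<mu> i) * of_real t)"
      by (simp add: exp_sum sum_distrib_right)
    finally show ?thesis by (simp add: left_diff_distrib exp_diff)
  qed
  then have "\<kappa> - (\<Sum>i<n. \<mu> i) = 0" by (rule exp_scaled_eq_1_imp_0)
  then show ?thesis using spec by (intro exI[of _ \<mu>]) auto
qed

end

section \<open>Analytic semigroups\<close>

text \<open>
  The theorem of Banach and Steinhaus: by Baire's theorem, one of the closed sets on which the family is
  bounded by a fixed integer contains a ball.
\<close>

lemma uniform_boundedness:
  fixes f :: "'i \<Rightarrow> 'a::banach \<Rightarrow> 'b::real_normed_vector"
  assumes lin: "\<And>i. i \<in> I \<Longrightarrow> bounded_linear (f i)"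
    and pt: "\<And>x. \<exists>c. \<forall>i\<in>I. norm (f i x) \<le> c"
  shows "\<exists>M. \<forall>i\<in>I. \<forall>x. norm (f i x) \<le> M * norm x"
proof -
  define A where "A m = {x. \<forall>i\<in>I. norm (f i x) \<le> real m}" for m :: nat
  have closed: "closed (A m)" for m
  proof -
    have "A m = (\<Inter>i\<in>I. {x. norm (f i x) \<le> real m})" unfolding A_def by auto
    moreover have "closed {x. norm (f i x) \<le> real m}" if "i \<in> I" for i
      by (intro closed_Collect_le continuous_intros linear_continuous_on lin that)
    ultimately show ?thesis by auto
  qed
  have "\<exists>m. \<not> UNIV \<subseteq> closure (- A m)"
  proof (rule ccontr)
    assume "\<not> ?thesis"
    then have dense: "closure (- A m) = UNIV" for m by blast
    have "(euclidean :: 'a topology) closure_of \<Inter>(range (\<lambda>m. - A m)) = UNIV"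
      unfolding mtopology_is_euclidean[symmetric]
      by (rule Met_TC.metric_Baire_category)
        (auto simp: mcomplete_iff_complete complete_UNIV open_Compl closed dense euclidean_closure_of)
    then have "closure (\<Inter>(range (\<lambda>m. - A m))) = UNIV" by (simp add: euclidean_closure_of)
    moreover have "\<Inter>(range (\<lambda>m. - A m)) = {}"
    proof -
      have "\<exists>m. x \<in> A m" for x
      proof -
        obtain c where c: "\<forall>i\<in>I. norm (f i x) \<le> c" using pt by blast
        obtain m where "c \<le> real m" using real_arch_simple by blast
        then show ?thesis unfolding A_def using c by (auto intro: order_trans)
      qed
      then show ?thesis by auto
    qed
    ultimately show False by simp
  qed
  then obtain m where "\<not> UNIV \<subseteq> closure (- A m)" by blast
  then obtain x where "x \<in> interior (A m)" by (auto simp: closure_complement)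
  then obtain r where r: "0 < r" "cball x r \<subseteq> A m" by (auto simp: mem_interior_cball)
  have "norm (f i y) \<le> (2 * real m / r) * norm y" if i: "i \<in> I" for i y
  proof (cases "y = 0")
    case True
    then show ?thesis using lin[OF i] by (simp add: linear_simps)
  next
    case False
    interpret fi: bounded_linear "f i" by (rule lin[OF i])
    define z where "z = (r / norm y) *\<^sub>R y"
    have nz: "norm z = r" using False r(1) by (simp add: z_def)
    have "x \<in> cball x r" "x + z \<in> cball x r" using r(1) nz by (auto simp: dist_norm)
    then have "x \<in> A m" "x + z \<in> A m" using r(2) by blast+
    then have "norm (f i x) \<le> real m" "norm (f i (x + z)) \<le> real m" using i unfolding A_def by auto
    moreover have "f i z = f i (x + z) - f i x" by (simp add: fi.add)
    ultimately have "norm (f i z) \<le> 2 * real m" using norm_triangle_ineq4[of "f i (x + z)" "f i x"] by simp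
    moreover have "norm (f i z) = r / norm y * norm (f i y)" using r(1) by (simp add: z_def fi.scaleR)
    ultimately show ?thesis using False r(1) by (simp add: field_simps)
  qed
  then show ?thesis by blast
qed

text \<open>
  Strong continuity at \<open>0\<close> is a statement about right limits only, so uniform boundedness is applied to
  a sequence of times decreasing to \<open>0\<close>; the semigroup law extends the bound to the unit interval.
\<close>

lemma c0_semigroup_bounded_unit:
  fixes T :: "real \<Rightarrow> 'a::banach \<Rightarrow> 'a"
  assumes T: "c0_semigroup K T"
  shows "\<exists>M. \<forall>t\<in>{0..1}. \<forall>x. norm (T t x) \<le> M * norm x"
proof -
  have bl: "\<And>t. 0 \<le> t \<Longrightarrow> bounded_linear (T t)" and T0: "\<And>x. T 0 x = x"
    and add: "\<And>s t x. 0 \<le> s \<Longrightarrow> 0 \<le> t \<Longrightarrow> T (s + t) x = T s (T t x)"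
    and lim: "\<And>x. ((\<lambda>t. T t x) \<longlongrightarrow> x) (at_right 0)"
    using T unfolding c0_semigroup_def by auto
  have "\<exists>k::nat. \<forall>t\<in>{0<..1 / real (Suc k)}. \<forall>x. norm (T t x) \<le> real k * norm x"
  proof (rule ccontr)
    assume "\<not> ?thesis"
    then have "\<forall>k::nat. \<exists>t x. 0 < t \<and> t \<le> 1 / real (Suc k) \<and> real k * norm x < norm (T t x)"
      by (meson greaterThanAtMost_iff not_le)
    then obtain t x where tx: "\<And>k. 0 < t k" "\<And>k. t k \<le> 1 / real (Suc k)"
      "\<And>k::nat. real k * norm (x k) < norm (T (t k) (x k))"
      by metis
    have "t \<longlonglongrightarrow> 0"
    proof (rule real_tendsto_sandwich[of "\<lambda>_. 0"])
      show "(\<lambda>k. 1 / real (Suc k)) \<longlonglongrightarrow> 0" by (rule LIMSEQ_Suc[OF lim_1_over_n])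
      show "\<forall>\<^sub>F k in sequentially. 0 \<le> t k" by (intro always_eventually allI less_imp_le tx(1))
      show "\<forall>\<^sub>F k in sequentially. t k \<le> 1 / real (Suc k)" by (intro always_eventually allI tx(2))
    qed simp
    moreover have "t k \<noteq> 0" for k using tx(1)[of k] by simp
    ultimately have t0: "filterlim t (at_right 0) sequentially"
      by (simp add: filterlim_at tx(1))
    have "\<exists>M. \<forall>k\<in>UNIV. \<forall>x. norm (T (t k) x) \<le> M * norm x"
    proof (rule uniform_boundedness)
      show "bounded_linear (T (t k))" for k using bl tx(1)[of k] by (simp add: less_imp_le)
      fix y
      have "(\<lambda>k. T (t k) y) \<longlonglongrightarrow> y" by (rule filterlim_compose[OF lim t0])
      then have "Bseq (\<lambda>k. T (t k) y)" by (intro convergent_imp_Bseq convergentI)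
      then show "\<exists>c. \<forall>k\<in>UNIV. norm (T (t k) y) \<le> c" unfolding Bseq_def by blast
    qed
    then obtain M where M: "\<And>k x. norm (T (t k) x) \<le> M * norm x" by blast
    obtain k :: nat where k: "M \<le> real k" using real_arch_simple by blast
    have "norm (T (t k) (x k)) \<le> real k * norm (x k)"
      by (rule order_trans[OF M mult_right_mono[OF k norm_ge_zero]])
    then show False using tx(3)[of k] by simp
  qed
  then obtain k where k: "\<And>t x. 0 < t \<Longrightarrow> t \<le> 1 / real (Suc k) \<Longrightarrow> norm (T t x) \<le> real k * norm x"
    by (meson greaterThanAtMost_iff)
  define b where "b = real k + 1"
  have b: "norm (T t x) \<le> b * norm x" if "0 \<le> t" "t \<le> 1 / real (Suc k)" for t x
  proof (cases "t = 0")
    case False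
    then show ?thesis using k[of t x] that unfolding b_def by (simp add: distrib_right add_increasing2)
  qed (simp add: T0 b_def distrib_right)
  have pow: "norm (T (real j * s) x) \<le> b ^ j * norm x" if s: "0 \<le> s" "s \<le> 1 / real (Suc k)" for j s x
  proof (induction j)
    case (Suc j)
    have "T (real (Suc j) * s) x = T s (T (real j * s) x)"
      using add[of s "real j * s" x] s by (simp add: algebra_simps)
    also have "norm \<dots> \<le> b * norm (T (real j * s) x)" by (rule b[OF s])
    also have "\<dots> \<le> b * (b ^ j * norm x)" using Suc by (intro mult_left_mono) (auto simp: b_def)
    finally show ?case by (simp add: mult.assoc)
  qed (simp add: T0)
  have "norm (T t x) \<le> b ^ Suc k * norm x" if "t \<in> {0..1}" for t x
    using pow[of "t / real (Suc k)" "Suc k" x] that by (simp add: divide_right_mono del: power_Suc of_nat_Suc)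
  then show ?thesis by blast
qed

lemma has_vector_derivative_real_line:
  fixes F :: "complex \<Rightarrow> 'b::real_normed_vector"
  assumes F: "(F has_derivative (\<lambda>h. sc h d)) (at (complex_of_real t))"
    and sc: "\<And>r. sc (complex_of_real r) d = r *\<^sub>R d"
  shows "((\<lambda>s. F (complex_of_real s)) has_vector_derivative d) (at t)"
proof -
  have "(complex_of_real has_derivative complex_of_real) (at t)"
    by (rule bounded_linear_imp_has_derivative[OF bounded_linear_of_real])
  from diff_chain_at[OF this F] show ?thesis
    by (simp add: has_vector_derivative_def comp_def sc)
qed

lemma analytic_semigroup_differentiable:
  assumes K: "admissible_scalars K" and T: "analytic_semigroup K T" and t: "0 < t"
  shows "\<exists>d. ((\<lambda>s. T s x) has_vector_derivative d) (at t)"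
proof -
  have cone: "complex_of_real t \<in> cone \<delta>" if "0 < \<delta>" for \<delta>
    using t that by (simp add: cone_def)
  show ?thesis
  proof (cases K)
    case Real_Scalars
    then have "\<exists>\<delta>>0. \<forall>x. \<exists>F. vector_holomorphic_on complexification_scale F (cone \<delta>) \<and>
        (\<forall>t>0. F (complex_of_real t) = (T t x, 0))"
      using T unfolding analytic_semigroup_def by simp
    then obtain \<delta> F where F: "0 < \<delta>" "vector_holomorphic_on complexification_scale F (cone \<delta>)"
      "\<And>t. 0 < t \<Longrightarrow> F (complex_of_real t) = (T t x, 0)"
      by blast
    obtain d where d: "(F has_derivative (\<lambda>h. complexification_scale h d)) (at (complex_of_real t))"
      using F(2) cone[OF F(1)] unfolding vector_holomorphic_on_def by blast
    have "((\<lambda>s. F (complex_of_real s)) has_vector_derivative d) (at t)"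
      by (rule has_vector_derivative_real_line[where sc = complexification_scale, OF d]) (simp add: complexification_scale_def split: prod.splits)
    then have "((\<lambda>s. fst (F (complex_of_real s))) has_vector_derivative fst d) (at t)"
      by (rule bounded_linear.has_vector_derivative[OF bounded_linear_fst])
    then have "((\<lambda>s. T s x) has_vector_derivative fst d) (at t)"
      by (rule has_vector_derivative_transform_within_open[where S = "{0<..}"]) (use t F(3) in auto)
    then show ?thesis by blast
  next
    case (Complex_Scalars sc)
    then have "\<exists>\<delta>>0. \<forall>x. \<exists>F. vector_holomorphic_on sc F (cone \<delta>) \<and>
        (\<forall>t>0. F (complex_of_real t) = T t x)"
      using T unfolding analytic_semigroup_def by simp
    then obtain \<delta> F where F: "0 < \<delta>" "vector_holomorphic_on sc F (cone \<delta>)"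
      "\<And>t. 0 < t \<Longrightarrow> F (complex_of_real t) = T t x"
      by blast
    obtain d where d: "(F has_derivative (\<lambda>h. sc h d)) (at (complex_of_real t))"
      using F(2) cone[OF F(1)] unfolding vector_holomorphic_on_def by blast
    have "((\<lambda>s. F (complex_of_real s)) has_vector_derivative d) (at t)"
      using K Complex_Scalars by (intro has_vector_derivative_real_line[where sc = sc, OF d]) (simp add: admissible_scalars_def complex_scaling_def)
    then have "((\<lambda>s. T s x) has_vector_derivative d) (at t)"
      by (rule has_vector_derivative_transform_within_open[where S = "{0<..}"]) (use t F(3) in auto)
    then show ?thesis by blast
  qed
qed

lemma vector_derivative_imp_right_quotient:
  assumes "(f has_vector_derivative d) (at t)"
  shows "((\<lambda>h. (f (t + h) - f t) /\<^sub>R h) \<longlongrightarrow> d) (at_right 0)"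
proof -
  have lim: "((\<lambda>h. norm (f (t + h) - f t - h *\<^sub>R d) / norm h) \<longlongrightarrow> 0) (at 0)"
    using assms unfolding has_vector_derivative_def has_derivative_at by simp
  have "((\<lambda>h. (f (t + h) - f t) /\<^sub>R h - d) \<longlongrightarrow> 0) (at 0)"
  proof (rule Lim_null_comparison[OF _ lim])
    show "\<forall>\<^sub>F h in at 0. norm ((f (t + h) - f t) /\<^sub>R h - d) \<le> norm (f (t + h) - f t - h *\<^sub>R d) / norm h"
      using eventually_neq_at_within[of 0]
    proof eventually_elim
      case (elim h)
      then have "(f (t + h) - f t) /\<^sub>R h - d = (f (t + h) - f t - h *\<^sub>R d) /\<^sub>R h"
        by (simp add: scaleR_diff_right)
      then show ?case by (simp add: divide_inverse mult.commute)
    qed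
  qed
  then have "((\<lambda>h. (f (t + h) - f t) /\<^sub>R h) \<longlongrightarrow> d) (at 0)"
    by (simp add: LIM_zero_iff)
  then show ?thesis by (rule tendsto_mono[rotated]) (simp add: at_le)
qed

lemma linear_over_iff:
  assumes "admissible_scalars K"
  shows "linear_over K K f \<longleftrightarrow> linear f \<and> (\<forall>sc. K = Complex_Scalars sc \<longrightarrow> (\<forall>c x. f (sc c x) = sc c (f x)))"
proof (cases K)
  case Real_Scalars
  then show ?thesis by (simp add: linear_over_def)
next
  case (Complex_Scalars sc)
  then have sc: "vector_space sc" "\<And>r x. sc (of_real r) x = r *\<^sub>R x"
    using assms by (auto simp: admissible_scalars_def complex_scaling_def)
  have "Vector_Spaces.linear sc sc f \<longleftrightarrow> linear f \<and> (\<forall>c x. f (sc c x) = sc c (f x))"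
  proof
    assume "Vector_Spaces.linear sc sc f"
    then interpret f: Vector_Spaces.linear sc sc f .
    have "f (r *\<^sub>R x) = r *\<^sub>R f x" for r x
      using f.scale[of "of_real r" x] by (simp add: sc)
    then show "linear f \<and> (\<forall>c x. f (sc c x) = sc c (f x))"
      by (auto intro!: linearI f.add f.scale)
  next
    assume "linear f \<and> (\<forall>c x. f (sc c x) = sc c (f x))"
    then show "Vector_Spaces.linear sc sc f"
      using sc(1) by (simp add: module_hom_iff_linear[symmetric] module_hom_iff module_iff_vector_space linear_add)
  qed
  then show ?thesis using Complex_Scalars by (simp add: linear_over_def)
qed

text \<open>
  Analyticity enters through the differentiability of orbits at positive times. It makes \<open>T 1\<close> map into
  the domain of \<open>G\<close>, and \<open>D = G \<circ> T 1\<close>, being a pointwise limit of difference quotients, is bounded by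
  the uniform boundedness principle.
\<close>

theorem analytic_semigroup_smooth:
  fixes K :: "'a::banach scalars"
  assumes K: "admissible_scalars K" and T: "analytic_semigroup K T" and G: "generates T S G"
  shows "smooth_semigroup K T (\<lambda>x. G (T 1 x)) (spectrum_over K S G)"
proof -
  have c0: "c0_semigroup K T" using T unfolding analytic_semigroup_def by blast
  have bl: "\<And>t. 0 \<le> t \<Longrightarrow> bounded_linear (T t)" and lo: "\<And>t. 0 \<le> t \<Longrightarrow> linear_over K K (T t)"
    and T0: "\<And>x. T 0 x = x"
    and add: "\<And>s t x. 0 \<le> s \<Longrightarrow> 0 \<le> t \<Longrightarrow> T (s + t) x = T s (T t x)"
    using c0 unfolding c0_semigroup_def by auto
  have comm: "T s (T t x) = T t (T s x)" if "0 \<le> s" "0 \<le> t" for s t x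
    using add[OF that, of x] add[OF that(2,1), of x] by (simp add: add.commute)
  have G_lim: "((\<lambda>h. (T h y - y) /\<^sub>R h) \<longlongrightarrow> z) (at_right 0) \<Longrightarrow> y \<in> S \<and> G y = z" for y z
  proof -
    assume a: "((\<lambda>h. (T h y - y) /\<^sub>R h) \<longlongrightarrow> z) (at_right 0)"
    then have S: "y \<in> S" using G unfolding generates_def by blast
    then have "((\<lambda>h. (T h y - y) /\<^sub>R h) \<longlongrightarrow> G y) (at_right 0)" using G unfolding generates_def by blast
    then show ?thesis using a S tendsto_unique[OF trivial_limit_at_right_real] by blast
  qed
  have G_S: "((\<lambda>h. (T h y - y) /\<^sub>R h) \<longlongrightarrow> G y) (at_right 0)" if "y \<in> S" for y
    using G that unfolding generates_def by blast
  have deriv: "((\<lambda>s. T s x) has_vector_derivative G (T t x)) (at t) \<and> T t x \<in> S" if t: "0 < t" for t x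
  proof -
    obtain d where d: "((\<lambda>s. T s x) has_vector_derivative d) (at t)"
      using analytic_semigroup_differentiable[OF K T t] by blast
    have "((\<lambda>h. (T h (T t x) - T t x) /\<^sub>R h) \<longlongrightarrow> d) (at_right 0)"
    proof (rule Lim_transform_eventually[OF vector_derivative_imp_right_quotient[OF d]])
      show "\<forall>\<^sub>F h in at_right 0. (T (t + h) x - T t x) /\<^sub>R h = (T h (T t x) - T t x) /\<^sub>R h"
        using eventually_at_right_less[of 0]
        by eventually_elim (use t add in \<open>simp add: add.commute\<close>)
    qed
    then show ?thesis using d G_lim by blast
  qed
  have G_T: "T s y \<in> S \<and> G (T s y) = T s (G y)" if y: "y \<in> S" and s: "0 \<le> s" for s y
  proof (rule G_lim)
    interpret Ts: bounded_linear "T s" by (rule bl[OF s])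
    have "((\<lambda>h. T s ((T h y - y) /\<^sub>R h)) \<longlongrightarrow> T s (G y)) (at_right 0)"
      by (rule Ts.tendsto[OF G_S[OF y]])
    then show "((\<lambda>h. (T h (T s y) - T s y) /\<^sub>R h) \<longlongrightarrow> T s (G y)) (at_right 0)"
    proof (rule Lim_transform_eventually)
      show "\<forall>\<^sub>F h in at_right 0. T s ((T h y - y) /\<^sub>R h) = (T h (T s y) - T s y) /\<^sub>R h"
        using eventually_at_right_less[of 0]
        by eventually_elim (use s comm in \<open>simp add: Ts.scaleR Ts.diff\<close>)
    qed
  qed
  define D where "D x = G (T 1 x)" for x
  have T1S: "T 1 x \<in> S" for x using deriv[of 1] by simp
  define f where "f k x = real (Suc k) *\<^sub>R (T (1 + 1 / real (Suc k)) x - T 1 x)" for k x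
  have f_lim: "(\<lambda>k. f k x) \<longlonglongrightarrow> D x" for x
  proof -
    have "((\<lambda>s. T s x) has_vector_derivative G (T 1 x)) (at 1)" using deriv[of 1] by simp
    then have 1: "((\<lambda>h. (T (1 + h) x - T 1 x) /\<^sub>R h) \<longlongrightarrow> D x) (at_right 0)"
      unfolding D_def by (rule vector_derivative_imp_right_quotient)
    have "filterlim (\<lambda>k. 1 / real (Suc k)) (at_right 0) sequentially"
      using LIMSEQ_Suc[OF lim_1_over_n] by (auto simp: filterlim_at)
    from filterlim_compose[OF 1 this] show ?thesis
      unfolding f_def by simp
  qed
  have f_bl: "bounded_linear (f k)" for k
    unfolding f_def by (intro bounded_linear_intros bl) auto
  have D_lin: "linear D"
  proof
    show "D (x + y) = D x + D y" for x y
    proof (rule LIMSEQ_unique[OF f_lim])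
      show "(\<lambda>k. f k (x + y)) \<longlonglongrightarrow> D x + D y"
        using tendsto_add[OF f_lim f_lim, of x y] f_bl by (simp add: linear_simps)
    qed
    show "D (r *\<^sub>R x) = r *\<^sub>R D x" for r x
    proof (rule LIMSEQ_unique[OF f_lim])
      show "(\<lambda>k. f k (r *\<^sub>R x)) \<longlonglongrightarrow> r *\<^sub>R D x"
        using tendsto_scaleR[OF tendsto_const f_lim, of r x] f_bl by (simp add: linear_simps)
    qed
  qed
  have D_bl: "bounded_linear D"
  proof -
    have "\<exists>M. \<forall>k\<in>UNIV. \<forall>x. norm (f k x) \<le> M * norm x"
    proof (rule uniform_boundedness[OF f_bl])
      fix x
      have "Bseq (\<lambda>k. f k x)" by (intro convergent_imp_Bseq convergentI[OF f_lim])
      then show "\<exists>c. \<forall>k\<in>UNIV. norm (f k x) \<le> c" unfolding Bseq_def by blast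
    qed
    then obtain M where M: "\<And>k x. norm (f k x) \<le> M * norm x" by blast
    have "norm (D x) \<le> M * norm x" for x
      by (rule tendsto_upperbound[OF tendsto_norm[OF f_lim]]) (simp_all add: M)
    then have "norm (D x) \<le> norm x * M" for x by (simp add: mult.commute)
    then show ?thesis using D_lin by (intro bounded_linear_intro) (auto simp: linear_add linear_scale)
  qed
  have D_lo: "linear_over K K D"
  proof -
    have "D (sc c x) = sc c (D x)" if sc: "K = Complex_Scalars sc" for sc c x
    proof (rule LIMSEQ_unique[OF f_lim])
      have vs: "vector_space sc" and scr: "\<And>r x. sc (of_real r) x = r *\<^sub>R x" and scn: "\<And>c x. norm (sc c x) = cmod c * norm x"
        using K sc by (auto simp: admissible_scalars_def complex_scaling_def)
      interpret vector_space sc by (rule vs)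
      have scc: "sc c (r *\<^sub>R x) = r *\<^sub>R sc c x" for r x
        unfolding scr[symmetric] by (simp add: mult.commute)
      have "bounded_linear (sc c)"
        by (rule bounded_linear_intro[where K = "cmod c"]) (simp_all add: scale_right_distrib scc scn)
      then have "(\<lambda>k. sc c (f k x)) \<longlonglongrightarrow> sc c (D x)" by (rule bounded_linear.tendsto[OF _ f_lim])
      moreover have "T t (sc c x) = sc c (T t x)" if "0 \<le> t" for t x
        using lo[OF that] sc unfolding linear_over_iff[OF K] by blast
      ultimately show "(\<lambda>k. f k (sc c x)) \<longlonglongrightarrow> sc c (D x)"
        unfolding f_def by (simp add: scc scale_right_diff_distrib del: of_nat_Suc)
    qed
    then show ?thesis unfolding linear_over_iff[OF K] using D_lin by blast
  qed
  have D_comm: "D (T t x) = T t (D x)" if t: "0 \<le> t" for t x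
    unfolding D_def using G_T[OF T1S t, of x] comm[OF t, of 1 x] by simp
  have T_deriv: "((\<lambda>s. T s x) has_vector_derivative T (t - 1) (D x)) (at t)" if t: "1 \<le> t" for t x
  proof -
    have "T t x = T (t - 1) (T 1 x)" using add[of "t - 1" 1 x] t by simp
    then have "G (T t x) = T (t - 1) (D x)" unfolding D_def using G_T[OF T1S, of "t - 1" x] t by simp
    then show ?thesis using deriv[of t x] t by simp
  qed
  have D_S: "D z = T 1 (G z)" if "z \<in> S" for z
    unfolding D_def using G_T[OF that, of 1] by simp
  interpret T1: bounded_linear "T 1" by (rule bl) simp
  have resolvent: "resolvent_witness K (T 1) D \<mu>" if \<mu>: "\<mu> \<notin> spectrum_over K S G" for \<mu>
  proof (cases K)
    case Real_Scalars
    define f where "f = (\<lambda>x. complexification_scale \<mu> x - map_prod G G x)"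
    define R where "R = the_inv_into (S \<times> S) f"
    have bij: "bij_betw f (S \<times> S) UNIV" and R: "bounded_linear R"
      using \<mu> unfolding spectrum_over_def op_spectrum_def f_def R_def Real_Scalars by simp_all
    have R_in: "R y \<in> S \<times> S" for y
      unfolding R_def using bij_betwE[OF bij_betw_the_inv_into[OF bij]] by blast
    have fR: "f (R y) = y" for y
      unfolding R_def using bij by (simp add: f_the_inv_into_f_bij_betw)
    define R1 where "R1 y = fst (R (y, 0))" for y
    define R2 where "R2 y = snd (R (y, 0))" for y
    have pair: "bounded_linear (\<lambda>y::'a. (y, 0::'a))" by (intro bounded_linear_Pair bounded_linear_ident bounded_linear_zero)
    have R12: "bounded_linear R1" "bounded_linear R2"
      unfolding R1_def R2_def
      by (intro bounded_linear_compose[OF bounded_linear_fst] bounded_linear_compose[OF bounded_linear_snd]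
          bounded_linear_compose[OF R] pair)+
    have S12: "R1 y \<in> S" "R2 y \<in> S" for y
      using R_in[of "(y, 0)"] by (auto simp: R1_def R2_def mem_Times_iff)
    have e: "y = Re \<mu> *\<^sub>R R1 y - Im \<mu> *\<^sub>R R2 y - G (R1 y)" "0 = Im \<mu> *\<^sub>R R1 y + Re \<mu> *\<^sub>R R2 y - G (R2 y)" for y
    proof -
      have "R (y, 0) = (R1 y, R2 y)" by (simp add: R1_def R2_def)
      then have "(Re \<mu> *\<^sub>R R1 y - Im \<mu> *\<^sub>R R2 y - G (R1 y), Im \<mu> *\<^sub>R R1 y + Re \<mu> *\<^sub>R R2 y - G (R2 y)) = (y, 0)"
        using fR[of "(y, 0)"] by (simp only: f_def complexification_scale_def prod.case map_prod_simp diff_Pair)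
      then show "y = Re \<mu> *\<^sub>R R1 y - Im \<mu> *\<^sub>R R2 y - G (R1 y)" "0 = Im \<mu> *\<^sub>R R1 y + Re \<mu> *\<^sub>R R2 y - G (R2 y)"
        by (metis Pair_inject)+
    qed
    have "T 1 y = Re \<mu> *\<^sub>R T 1 (R1 y) - Im \<mu> *\<^sub>R T 1 (R2 y) - D (R1 y)" for y
      using arg_cong[OF e(1)[of y], of "T 1"] by (simp only: T1.diff T1.scaleR D_S[OF S12(1)])
    moreover have "0 = Im \<mu> *\<^sub>R T 1 (R1 y) + Re \<mu> *\<^sub>R T 1 (R2 y) - D (R2 y)" for y
      using arg_cong[OF e(2)[of y], of "T 1"] by (simp only: T1.zero T1.add T1.diff T1.scaleR D_S[OF S12(2)])
    ultimately show ?thesis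
      unfolding resolvent_witness_def Real_Scalars scalars.case
      by (intro exI[of _ R1] exI[of _ R2] conjI allI R12)
  next
    case (Complex_Scalars sc)
    define f where "f = (\<lambda>x. sc \<mu> x - G x)"
    define R where "R = the_inv_into S f"
    have bij: "bij_betw f S UNIV" and R: "bounded_linear R"
      using \<mu> unfolding spectrum_over_def op_spectrum_def f_def R_def Complex_Scalars by simp_all
    have R_in: "R y \<in> S" for y
      unfolding R_def using bij_betwE[OF bij_betw_the_inv_into[OF bij]] by blast
    have fR: "f (R y) = y" for y
      unfolding R_def using bij by (simp add: f_the_inv_into_f_bij_betw)
    have e: "y = sc \<mu> (R y) - G (R y)" for y using fR[of y] by (simp add: f_def)
    have "T 1 (sc \<mu> x) = sc \<mu> (T 1 x)" for x
      using lo[of 1] Complex_Scalars unfolding linear_over_iff[OF K] by auto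
    then have "T 1 y = sc \<mu> (T 1 (R y)) - D (R y)" for y
      using arg_cong[OF e[of y], of "T 1"] by (simp only: T1.diff D_S[OF R_in])
    then show ?thesis
      unfolding resolvent_witness_def Complex_Scalars scalars.case
      by (intro exI[of _ R] conjI allI R)
  qed
  show ?thesis
    unfolding D_def[symmetric]
    by (rule smooth_semigroup.intro)
      (fact K bl lo T0 add c0_semigroup_bounded_unit[OF c0] D_bl D_lo T_deriv D_comm resolvent)+
qed

lemma complex_target_complex: "complex_target ((*) :: complex \<Rightarrow> complex \<Rightarrow> complex)"
  by (intro complex_target.intro bounded_bilinear_mult)
    (unfold_locales, auto simp: algebra_simps scaleR_conv_of_real)

lemma complex_target_complex_scaling:
  assumes "complex_scaling sc"
  shows "complex_target sc"
proof -
  from assms have vs: "vector_space sc" and r: "\<And>r x. sc (of_real r) x = r *\<^sub>R x"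
    and n: "\<And>c x. norm (sc c x) = cmod c * norm x"
    by (auto simp: complex_scaling_def)
  interpret vector_space sc by (rule vs)
  have "bounded_bilinear sc"
  proof
    show "sc (r *\<^sub>R c) x = r *\<^sub>R sc c x" for r c x
      by (simp add: r[symmetric] scaleR_conv_of_real)
    show "sc c (r *\<^sub>R x) = r *\<^sub>R sc c x" for r c x
      by (simp add: r[symmetric] mult.commute)
    show "\<exists>C. \<forall>c x. norm (sc c x) \<le> norm c * norm x * C"
      by (intro exI[of _ 1]) (simp add: n)
  qed (simp_all add: scale_left_distrib scale_right_distrib)
  then show ?thesis using vs r by (intro complex_target.intro)
qed

lemma complex_target_complexification:
  "complex_target (complexification_scale :: complex \<Rightarrow> 'a::real_normed_vector \<times> 'a \<Rightarrow> 'a \<times> 'a)"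
proof (rule complex_target.intro)
  show "vector_space (complexification_scale :: complex \<Rightarrow> 'a \<times> 'a \<Rightarrow> 'a \<times> 'a)"
    by unfold_locales (auto simp: complexification_scale_def algebra_simps)
  show "complexification_scale (complex_of_real r) w = r *\<^sub>R w" for r and w :: "'a \<times> 'a"
    by (cases w) (simp add: complexification_scale_def)
  show "bounded_bilinear (complexification_scale :: complex \<Rightarrow> 'a \<times> 'a \<Rightarrow> 'a \<times> 'a)"
  proof
    show "\<exists>C. \<forall>c (x :: 'a \<times> 'a). norm (complexification_scale c x) \<le> norm c * norm x * C"
    proof (intro exI[of _ 4] allI)
      fix c and w :: "'a \<times> 'a"
      obtain x y where w: "w = (x, y)" by (cases w)
      have xy: "norm x \<le> norm w" "norm y \<le> norm w"
        unfolding w by (rule norm_fst_le norm_snd_le)+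
      have b: "norm (Re c *\<^sub>R u) \<le> cmod c * norm w" "norm (Im c *\<^sub>R u) \<le> cmod c * norm w" if "norm u \<le> norm w" for u :: 'a
        using that by (auto intro!: mult_mono abs_Re_le_cmod abs_Im_le_cmod)
      have "norm (complexification_scale c w) \<le> norm (Re c *\<^sub>R x - Im c *\<^sub>R y) + norm (Im c *\<^sub>R x + Re c *\<^sub>R y)"
        unfolding w complexification_scale_def prod.case by (rule norm_Pair_le)
      also have "\<dots> \<le> (norm (Re c *\<^sub>R x) + norm (Im c *\<^sub>R y)) + (norm (Im c *\<^sub>R x) + norm (Re c *\<^sub>R y))"
        by (intro add_mono norm_triangle_ineq4 norm_triangle_ineq)
      also have "\<dots> \<le> (cmod c * norm w + cmod c * norm w) + (cmod c * norm w + cmod c * norm w)"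
        by (intro add_mono b xy)
      finally show "norm (complexification_scale c w) \<le> norm c * norm w * 4" by simp
    qed
  qed (auto simp: complexification_scale_def algebra_simps)
qed

text \<open>
  An isometric embedding \<open>\<iota>\<close> of \<open>X\<close> into a space with complex structure is a form of degree 1, and
  \<open>T k\<close> is recovered from the action of the \<open>k\<close>-th power of \<open>T 1\<close> on it. This detour gives complex
  approximate eigenvalues of \<open>T 1\<close> also when \<open>X\<close> is real.
\<close>

lemma (in complex_target) growth_via_embedding:
  assumes sg: "smooth_semigroup K T D \<Lambda>" and q: "\<And>\<mu>. \<mu> \<in> \<Lambda> \<Longrightarrow> Re \<mu> < q"
    and \<iota>: "linear_over K (Complex_Scalars sw) \<iota>" "\<And>x. norm (\<iota> x) = norm x"
  shows "\<exists>C. \<forall>k x. norm (T (real k) x) \<le> C * exp (q * real k) * norm x"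
proof -
  interpret sg: smooth_semigroup K T D \<Lambda> by (rule sg)
  interpret F: semigroup_forms K T D \<Lambda> sw "slot_forms K sw 1" 1
  proof
    show "module.subspace (form_scale sw) (slot_forms K sw 1)"
      by (rule subspace_slot_forms[OF sg.admissible])
  qed (auto intro!: slot_in_forms sg.T_bounded_linear sg.T_linear_over sg.D_bounded_linear sg.D_linear_over)
  define P where "P v = \<iota> (v 0)" for v :: "nat \<Rightarrow> 'a"
  have P: "P \<in> slot_forms K sw 1"
    unfolding slot_forms_def P_def using \<iota> by (auto simp: form_bound_def intro!: exI[of _ 1])
  obtain C where C: "\<And>k. form_norm 1 ((slot 0 (T 1) ^^ k) P) \<le> C * exp (q * real k) * form_norm 1 P"
    using F.slot_growth[OF _ q] P by auto
  have power: "(slot 0 (T 1) ^^ k) P v = \<iota> (T (real k) (v 0))" for k v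
  proof (induction k arbitrary: v)
    case 0
    then show ?case by (simp add: P_def sg.T_0)
  next
    case (Suc k)
    have "T (real (Suc k)) (v 0) = T (real k) (T 1 (v 0))"
      using sg.T_add[of "real k" 1 "v 0"] by (simp add: add.commute)
    then show ?case using Suc by (simp add: slot_def)
  qed
  have forms: "(slot 0 (T 1) ^^ k) P \<in> slot_forms K sw 1" for k
  proof (induction k)
    case (Suc k)
    show ?case using F.slot_T_forms[OF Suc, of 0 1] by simp
  qed (use P in simp)
  have "norm (T (real k) x) \<le> (C * form_norm 1 P) * exp (q * real k) * norm x" for k x
  proof -
    have "norm (T (real k) x) = norm ((slot 0 (T 1) ^^ k) P (\<lambda>_. x))"
      by (simp add: power \<iota>)
    also have "\<dots> \<le> form_norm 1 ((slot 0 (T 1) ^^ k) P) * norm x"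
      using norm_form_le[OF forms[of k], of "\<lambda>_. x"] by simp
    also have "\<dots> \<le> C * exp (q * real k) * form_norm 1 P * norm x"
      by (intro mult_right_mono C) auto
    finally show ?thesis by (simp add: mult_ac)
  qed
  then show ?thesis by blast
qed

theorem analytic_semigroup_growth:
  fixes K :: "'a::banach scalars"
  assumes K: "admissible_scalars K" and T: "analytic_semigroup K T" and G: "generates T S G"
    and q: "\<And>\<mu>. \<mu> \<in> spectrum_over K S G \<Longrightarrow> Re \<mu> < q"
  shows "\<exists>C. \<forall>k x. norm (T (real k) x) \<le> C * exp (q * real k) * norm x"
proof (cases K)
  case Real_Scalars
  show ?thesis
  proof (rule complex_target.growth_via_embedding[OF complex_target_complexification analytic_semigroup_smooth[OF K T G] q])
    have "linear (\<lambda>x::'a. (x, 0::'a))" by (rule linearI) auto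
    then show "linear_over K (Complex_Scalars complexification_scale) (\<lambda>x::'a. (x, 0::'a))"
      by (simp add: linear_over_def Real_Scalars)
  qed (auto simp: norm_Pair)
next
  case (Complex_Scalars sc)
  then have sc: "complex_scaling sc" using K by (simp add: admissible_scalars_def)
  show ?thesis
  proof (rule complex_target.growth_via_embedding[OF complex_target_complex_scaling[OF sc] analytic_semigroup_smooth[OF K T G] q])
    show "linear_over K (Complex_Scalars sc) (\<lambda>x::'a. x)"
      using sc vector_space.linear_ident[of sc] by (simp add: linear_over_def Complex_Scalars complex_scaling_def)
  qed auto
qed

theorem invariant_multilinear_form_eigenvalue:
  fixes K :: "'a::banach scalars"
  assumes K: "admissible_scalars K" and T: "analytic_semigroup K T" and G: "generates T S G"
    and Q: "Q \<in> slot_forms K (*) n" "Q v0 \<noteq> 0"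
    and inv: "\<And>t v. 0 \<le> t \<Longrightarrow> Q (\<lambda>i. if i < n then T t (v i) else v i) = exp (\<kappa> * complex_of_real t) * Q v"
  shows "\<exists>\<mu>. (\<forall>i<n. \<mu> i \<in> spectrum_over K S G) \<and> \<kappa> = (\<Sum>i<n. \<mu> i)"
proof -
  define D where "D x = G (T 1 x)" for x
  interpret smooth_semigroup K T D "spectrum_over K S G"
    unfolding D_def by (rule analytic_semigroup_smooth[OF K T G])
  interpret C: complex_target "(*) :: complex \<Rightarrow> complex \<Rightarrow> complex" by (rule complex_target_complex)
  define E where "E = {P \<in> slot_forms K (*) n. \<forall>t v. 0 \<le> t \<longrightarrow>
    P (\<lambda>i. if i < n then T t (v i) else v i) = exp (\<kappa> * complex_of_real t) * P v}"
  interpret FS: vector_space "form_scale ((*) :: complex \<Rightarrow> complex \<Rightarrow> complex) :: complex \<Rightarrow> ((nat \<Rightarrow> 'a) \<Rightarrow> complex) \<Rightarrow> _"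
    by (rule C.vector_space_form_scale)
  have slot_E: "slot i A P \<in> E" if P: "P \<in> E" and i: "i < n" and A: "bounded_linear A" "linear_over K K A"
    and comm: "\<And>t x. 0 \<le> t \<Longrightarrow> A (T t x) = T t (A x)" for P i A
  proof -
    have inv: "slot i A P (\<lambda>j. if j < n then T t (v j) else v j) = exp (\<kappa> * complex_of_real t) * slot i A P v"
      if t: "0 \<le> t" for t v
    proof -
      have "(\<lambda>j. if j < n then T t (v j) else v j)(i := A (if i < n then T t (v i) else v i))
        = (\<lambda>j. if j < n then T t ((v(i := A (v i))) j) else (v(i := A (v i))) j)"
        using i comm[OF t] by (auto simp: fun_eq_iff)
      moreover have "P (\<lambda>j. if j < n then T t (w j) else w j) = exp (\<kappa> * complex_of_real t) * P w" for w
        using P t unfolding E_def by blast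
      ultimately show ?thesis unfolding slot_def by (simp only:)
    qed
    have "P \<in> slot_forms K (*) n" using P unfolding E_def by simp
    then have "slot i A P \<in> slot_forms K (*) n" by (rule C.slot_in_forms[OF _ i A])
    then show ?thesis using inv unfolding E_def by simp
  qed
  interpret F: semigroup_forms K T D "spectrum_over K S G" "(*)" E n
  proof
    show "E \<subseteq> slot_forms K (*) n" unfolding E_def by blast
    show "FS.subspace E"
    proof -
      note sub = C.subspace_slot_forms[OF K, of n]
      show ?thesis
      proof (rule FS.subspaceI)
        show "0 \<in> E"
          unfolding E_def mem_Collect_eq by (intro conjI allI impI FS.subspace_0[OF sub]) simp
        show "P + P' \<in> E" if "P \<in> E" "P' \<in> E" for P P'
          using that unfolding E_def mem_Collect_eq
          by (intro conjI allI impI FS.subspace_add[OF sub]) (simp_all add: distrib_left)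
        show "form_scale (*) c P \<in> E" if "P \<in> E" for c P
          using that unfolding E_def mem_Collect_eq
          by (intro conjI allI impI FS.subspace_scale[OF sub]) (simp_all add: form_scale_def)
      qed
    qed
    show "slot i (T 1) P \<in> E" if "P \<in> E" "i < n" for P i
    proof (rule slot_E[OF that T_bounded_linear T_linear_over])
      show "T 1 (T t x) = T t (T 1 x)" if "0 \<le> t" for t x
        using T_add[of 1 t x] T_add[of t 1 x] that by (simp add: add.commute)
    qed auto
    show "slot i D P \<in> E" if "P \<in> E" "i < n" for P i
      by (rule slot_E[OF that D_bounded_linear D_linear_over D_commute])
  qed
  show ?thesis
  proof (rule F.invariant_form_eigenvalue)
    show QE: "Q \<in> E" unfolding E_def using Q inv by blast
    show "0 < form_norm n Q"
    proof (rule ccontr)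
      assume "\<not> 0 < form_norm n Q"
      then have "form_norm n Q = 0" using form_norm_nonneg[OF Q(1)] by simp
      then show False using norm_form_le[OF Q(1), of v0] Q(2) by simp
    qed
    show "F.flow n t P = form_scale (*) (exp (\<kappa> * of_real t)) P" if "P \<in> E" "t \<in> {1..2}" for P t
      using that unfolding E_def by (intro ext) (simp add: F.flow_def form_scale_def)
  qed
qed

section \<open>Polarization\<close>

text \<open>
  Adding or removing an element of \<open>N - B\<close> cancels the terms in pairs.
\<close>

lemma sum_supersets_alternating:
  assumes "finite N" "B \<subseteq> N"
  shows "(\<Sum>A\<in>Pow N. if B \<subseteq> A then (- 1) ^ card A else 0) = (if B = N then (- 1) ^ card N else (0::complex))"
proof (cases "B = N")
  case True
  have "(\<Sum>A\<in>Pow N. if B \<subseteq> A then (- 1) ^ card A else (0::complex)) = (\<Sum>A\<in>{N}. (- 1) ^ card A)"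
    using assms True by (intro sum.mono_neutral_cong_right) auto
  then show ?thesis using True by simp
next
  case False
  then obtain x where x: "x \<in> N" "x \<notin> B" using assms by blast
  define N' where "N' = N - {x}"
  have N: "N = insert x N'" "x \<notin> N'" "finite N'" unfolding N'_def using x assms by auto
  let ?f = "\<lambda>A. if B \<subseteq> A then (- 1) ^ card A else (0::complex)"
  have "sum ?f (Pow N) = sum ?f (Pow N') + sum ?f (insert x ` Pow N')"
    unfolding N(1) Pow_insert using N by (intro sum.union_disjoint) auto
  also have "sum ?f (insert x ` Pow N') = (\<Sum>A\<in>Pow N'. ?f (insert x A))"
    using N(2) by (intro sum.reindex_cong[of "insert x"]) (auto simp: inj_on_def)
  also have "\<dots> = (\<Sum>A\<in>Pow N'. - ?f A)"
  proof (rule sum.cong[OF refl])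
    fix A assume A: "A \<in> Pow N'"
    then have "finite A" "x \<notin> A" using N finite_subset by auto
    moreover have "B \<subseteq> insert x A \<longleftrightarrow> B \<subseteq> A" using x by blast
    ultimately show "?f (insert x A) = - ?f A" by simp
  qed
  finally show ?thesis using False by (simp add: sum_negf)
qed

definition tuples :: "nat \<Rightarrow> nat set \<Rightarrow> nat list set" where
  "tuples k A = {is. set is \<subseteq> A \<and> length is = k}"

lemma finite_tuples: "finite A \<Longrightarrow> finite (tuples k A)"
  unfolding tuples_def by (rule finite_lists_length_eq)

lemma sum_tuples_Suc: "(\<Sum>is\<in>tuples (Suc k) A. g is) = (\<Sum>a\<in>A. \<Sum>is\<in>tuples k A. g (a # is))"
proof -
  have "tuples (Suc k) A = (\<lambda>(a, is). a # is) ` (A \<times> tuples k A)"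
    unfolding tuples_def by (force simp: length_Suc_conv image_iff)
  then have "(\<Sum>is\<in>tuples (Suc k) A. g is) = (\<Sum>(a, is)\<in>A \<times> tuples k A. g (a # is))"
    by (subst sum.reindex_cong[of "\<lambda>(a, is). a # is", OF _ _ refl]) (auto simp: inj_on_def case_prod_unfold)
  then show ?thesis by (simp add: sum.cartesian_product)
qed

lemma multilinear_expand:
  fixes M :: "'a::real_normed_vector list \<Rightarrow> complex"
  assumes lin: "\<And>vs i. length vs = n \<Longrightarrow> i < n \<Longrightarrow> linear (\<lambda>x. M (vs[i := x]))"
    and A: "finite A"
  shows "length ps + k = n \<Longrightarrow>
    M (map v ps @ replicate k (\<Sum>a\<in>A. v a)) = (\<Sum>is\<in>tuples k A. M (map v (ps @ is)))"
proof (induction k arbitrary: ps)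
  case 0
  have "tuples 0 A = {[]}" by (auto simp: tuples_def)
  then show ?case by simp
next
  case (Suc k)
  let ?s = "\<Sum>a\<in>A. v a"
  let ?vs = "\<lambda>x. map v ps @ x # replicate k ?s"
  interpret L: linear "\<lambda>x. M ((?vs 0)[length ps := x])"
    using Suc.prems by (intro lin) auto
  have upd: "(?vs 0)[length ps := x] = ?vs x" for x by (simp add: list_update_append)
  have "M (?vs ?s) = (\<Sum>a\<in>A. M (?vs (v a)))"
    using L.sum[of v A] unfolding upd .
  also have "\<dots> = (\<Sum>a\<in>A. M (map v (ps @ [a]) @ replicate k ?s))" by simp
  also have "\<dots> = (\<Sum>a\<in>A. \<Sum>is\<in>tuples k A. M (map v ((ps @ [a]) @ is)))"
    using Suc.prems by (intro sum.cong refl Suc.IH) auto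
  also have "\<dots> = (\<Sum>is\<in>tuples (Suc k) A. M (map v (ps @ is)))"
    unfolding sum_tuples_Suc by simp
  finally show ?case by simp
qed

text \<open>
  The permutations of \<open>{..<n}\<close>, as lists.
\<close>

definition arrangements :: "nat \<Rightarrow> nat list set" where
  "arrangements n = {is. set is = {..<n} \<and> length is = n}"

lemma arrangements_distinct: "is \<in> arrangements n \<Longrightarrow> distinct is"
  unfolding arrangements_def by (simp add: card_distinct)

lemma finite_arrangements: "finite (arrangements n)"
  by (rule finite_subset[OF _ finite_tuples[of "{..<n}" n]]) (auto simp: arrangements_def tuples_def)

definition symmetrization :: "nat \<Rightarrow> ('a list \<Rightarrow> complex) \<Rightarrow> (nat \<Rightarrow> 'a) \<Rightarrow> complex" where
  "symmetrization n M v = (\<Sum>is\<in>arrangements n. M (map v is))"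

text \<open>
  The polarization formula. Expanding the right-hand side over all index tuples, inclusion-exclusion
  leaves those tuples in which every index occurs. It shows that the symmetrization depends on the
  diagonal values of \<open>M\<close> alone, hence inherits their invariance.
\<close>

lemma symmetrization_polarization:
  fixes M :: "'a::real_normed_vector list \<Rightarrow> complex"
  assumes lin: "\<And>vs i. length vs = n \<Longrightarrow> i < n \<Longrightarrow> linear (\<lambda>x. M (vs[i := x]))"
  shows "(- 1) ^ n * symmetrization n M v
    = (\<Sum>A\<in>Pow {..<n}. (- 1) ^ card A * M (replicate n (\<Sum>a\<in>A. v a)))"
proof -
  let ?N = "{..<n}"
  have fin: "finite ?N" by simp
  have "(\<Sum>A\<in>Pow ?N. (- 1) ^ card A * M (replicate n (\<Sum>a\<in>A. v a)))
    = (\<Sum>A\<in>Pow ?N. \<Sum>is\<in>tuples n ?N. (if set is \<subseteq> A then (- 1) ^ card A else 0) * M (map v is))"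
  proof (rule sum.cong[OF refl])
    fix A assume A: "A \<in> Pow ?N"
    then have fA: "finite A" using finite_subset by auto
    have "M (replicate n (\<Sum>a\<in>A. v a)) = (\<Sum>is\<in>tuples n A. M (map v is))"
      using multilinear_expand[OF lin fA, of n "[]" n v] by simp
    then have "(- 1) ^ card A * M (replicate n (\<Sum>a\<in>A. v a)) = (\<Sum>is\<in>tuples n A. (- 1) ^ card A * M (map v is))"
      by (simp add: sum_distrib_left)
    also have "\<dots> = (\<Sum>is\<in>tuples n ?N. (if set is \<subseteq> A then (- 1) ^ card A else 0) * M (map v is))"
      using A finite_tuples[OF fin, of n] by (intro sum.mono_neutral_cong_left) (auto simp: tuples_def)
    finally show "(- 1) ^ card A * M (replicate n (\<Sum>a\<in>A. v a))
      = (\<Sum>is\<in>tuples n ?N. (if set is \<subseteq> A then (- 1) ^ card A else 0) * M (map v is))" .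
  qed
  also have "\<dots> = (\<Sum>is\<in>tuples n ?N. (\<Sum>A\<in>Pow ?N. if set is \<subseteq> A then (- 1) ^ card A else 0) * M (map v is))"
    by (subst sum.swap) (simp add: sum_distrib_right)
  also have "\<dots> = (\<Sum>is\<in>tuples n ?N. (if set is = ?N then (- 1) ^ n else 0) * M (map v is))"
  proof (rule sum.cong[OF refl])
    fix "is" assume "is \<in> tuples n ?N"
    then have "set is \<subseteq> ?N" by (simp add: tuples_def)
    from sum_supersets_alternating[OF fin this]
    show "(\<Sum>A\<in>Pow ?N. if set is \<subseteq> A then (- 1) ^ card A else 0) * M (map v is)
      = (if set is = ?N then (- 1) ^ n else 0) * M (map v is)" by simp
  qed
  also have "\<dots> = (\<Sum>is\<in>arrangements n. (- 1) ^ n * M (map v is))"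
    using finite_tuples[OF fin, of n] by (intro sum.mono_neutral_cong_right) (auto simp: tuples_def arrangements_def)
  finally show ?thesis by (simp add: symmetrization_def sum_distrib_left)
qed

lemma symmetrization_diagonal:
  "symmetrization n M (\<lambda>_. x) = of_nat (card (arrangements n)) * M (replicate n x)"
proof -
  have "M (map (\<lambda>_. x) is) = M (replicate n x)" if "is \<in> arrangements n" for "is"
    using that by (simp add: arrangements_def map_replicate_const)
  then show ?thesis by (simp add: symmetrization_def)
qed

lemma card_arrangements_pos: "0 < card (arrangements n)"
proof -
  have "[0..<n] \<in> arrangements n" by (auto simp: arrangements_def)
  then show ?thesis using finite_arrangements card_gt_0_iff by blast
qed

lemma symmetrization_slot_forms:
  fixes M :: "'a::real_normed_vector list \<Rightarrow> complex"
  assumes K: "admissible_scalars K"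
    and M: "multilinear_over K (Complex_Scalars (*)) n M" "multi_bound n M c"
  shows "symmetrization n M \<in> slot_forms K (*) n"
proof -
  interpret C: complex_target "(*) :: complex \<Rightarrow> complex \<Rightarrow> complex" by (rule complex_target_complex)
  have term_lin: "linear_over K (Complex_Scalars (*)) (\<lambda>x. M (map (v(i := x)) is))"
    if "is \<in> arrangements n" "i < n" for "is" i v
  proof -
    have i: "i \<in> set is" and len: "length is = n" and dist: "distinct is"
      using that arrangements_distinct by (auto simp: arrangements_def)
    obtain j where j: "j < n" "is ! j = i" using i len by (auto simp: in_set_conv_nth)
    have "map (v(i := x)) is = (map v is)[j := x]" for x
      using dist j len by (intro nth_equalityI) (auto simp: nth_list_update nth_eq_iff_index_eq)
    then show ?thesis using M(1) j len unfolding multilinear_over_def by simp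
  qed
  have sum_lin: "linear_over K (Complex_Scalars (*)) (\<lambda>x. \<Sum>is\<in>I. M (map (v(i := x)) is))"
    if "I \<subseteq> arrangements n" "i < n" for I i v
    using finite_subset[OF that(1) finite_arrangements] that
    by (induction I rule: finite_induct) (auto intro!: C.linear_over_zero[OF K] C.linear_over_add term_lin)
  have "form_bound n (symmetrization n M) (real (card (arrangements n)) * \<bar>c\<bar>)"
    unfolding form_bound_def
  proof (intro conjI allI)
    fix v :: "nat \<Rightarrow> 'a"
    have term_bound: "norm (M (map v is)) \<le> \<bar>c\<bar> * (\<Prod>i<n. norm (v i))" if "is \<in> arrangements n" for "is"
    proof -
      have "set is = {..<n}" "length is = n" "distinct is"
        using that arrangements_distinct by (auto simp: arrangements_def)
      then have "(\<Prod>x\<leftarrow>map v is. norm x) = (\<Prod>i<n. norm (v i))"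
        by (simp add: comp_def prod.distinct_set_conv_list[symmetric])
      moreover have "norm (M (map v is)) \<le> c * (\<Prod>x\<leftarrow>map v is. norm x)"
        using M(2)[unfolded multi_bound_def, rule_format, of "map v is"] \<open>length is = n\<close> by simp
      moreover have "c * (\<Prod>i<n. norm (v i)) \<le> \<bar>c\<bar> * (\<Prod>i<n. norm (v i))"
        by (intro mult_right_mono prod_nonneg) auto
      ultimately show ?thesis by simp
    qed
    have "norm (symmetrization n M v) \<le> (\<Sum>is\<in>arrangements n. \<bar>c\<bar> * (\<Prod>i<n. norm (v i)))"
      unfolding symmetrization_def by (intro sum_norm_le term_bound)
    then show "norm (symmetrization n M v) \<le> real (card (arrangements n)) * \<bar>c\<bar> * (\<Prod>i<n. norm (v i))" by simp
  qed simp
  then show ?thesis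
    using sum_lin[OF order_refl] unfolding slot_forms_def symmetrization_def by blast
qed

lemma symmetrization_invariant:
  fixes M :: "'a::real_normed_vector list \<Rightarrow> complex"
  assumes lin: "\<And>vs i. length vs = n \<Longrightarrow> i < n \<Longrightarrow> linear (\<lambda>x. M (vs[i := x]))"
    and A: "linear A" and inv: "\<And>x. M (replicate n (A x)) = c * M (replicate n x)"
  shows "symmetrization n M (\<lambda>i. if i < n then A (v i) else v i) = c * symmetrization n M v"
proof -
  let ?w = "\<lambda>i. if i < n then A (v i) else v i"
  have "(- 1) ^ n * symmetrization n M ?w = (\<Sum>B\<in>Pow {..<n}. (- 1) ^ card B * M (replicate n (\<Sum>a\<in>B. ?w a)))"
    by (rule symmetrization_polarization[OF lin])
  also have "\<dots> = (\<Sum>B\<in>Pow {..<n}. c * ((- 1) ^ card B * M (replicate n (\<Sum>a\<in>B. v a))))"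
  proof (rule sum.cong[OF refl])
    fix B assume "B \<in> Pow {..<n}"
    then have "(\<Sum>a\<in>B. ?w a) = (\<Sum>a\<in>B. A (v a))" by (intro sum.cong) auto
    also have "\<dots> = A (\<Sum>a\<in>B. v a)" by (rule linear_sum[OF A, symmetric])
    finally show "(- 1) ^ card B * M (replicate n (\<Sum>a\<in>B. ?w a)) = c * ((- 1) ^ card B * M (replicate n (\<Sum>a\<in>B. v a)))"
      by (simp add: inv)
  qed
  also have "\<dots> = c * ((- 1) ^ n * symmetrization n M v)"
  proof -
    have "(- 1) ^ n * symmetrization n M v = (\<Sum>B\<in>Pow {..<n}. (- 1) ^ card B * M (replicate n (\<Sum>a\<in>B. v a)))"
      by (rule symmetrization_polarization[OF lin])
    then show ?thesis by (simp only: sum_distrib_left)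
  qed
  finally show ?thesis by simp
qed

section \<open>Taylor expansions at the fixed point\<close>

text \<open>
  Taylor's formula for a sequence of successive derivatives. The remainder of order \<open>m + 1\<close> vanishes at
  \<open>0\<close> and has the remainder of order \<open>m\<close> of the next derivative as its derivative.
\<close>

lemma taylor_remainder_bound:
  fixes g :: "nat \<Rightarrow> real \<Rightarrow> 'b::real_normed_vector"
  assumes deriv: "\<And>k s. k < n \<Longrightarrow> s \<in> {0..1} \<Longrightarrow> (g k has_vector_derivative g (Suc k) s) (at s)"
    and B: "\<And>s. s \<in> {0..1} \<Longrightarrow> norm (g n s) \<le> B"
  shows "m \<le> n \<Longrightarrow> s \<in> {0..1} \<Longrightarrow>
    norm (g (n - m) s - (\<Sum>j<m. (s ^ j / fact j) *\<^sub>R g (n - m + j) 0)) \<le> B"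
proof (induction m arbitrary: s)
  case 0
  then show ?case using B by simp
next
  case (Suc m)
  define k where "k = n - Suc m"
  have k: "k < n" "Suc k = n - m" using Suc.prems unfolding k_def by auto
  define R where "R s = g k s - (\<Sum>j<Suc m. (s ^ j / fact j) *\<^sub>R g (k + j) 0)" for s
  define R' where "R' s = g (Suc k) s - (\<Sum>j<m. (s ^ j / fact j) *\<^sub>R g (Suc k + j) 0)" for s
  have R_deriv: "(R has_vector_derivative R' s) (at s)" if s: "s \<in> {0..1}" for s
  proof -
    have mono: "((\<lambda>s. s ^ Suc j / fact (Suc j)) has_vector_derivative s ^ j / fact j) (at s)" for j
    proof -
      have "((\<lambda>s. s ^ Suc j) has_real_derivative real (Suc j) * s ^ j) (at s)"
        using DERIV_pow[of "Suc j" s] by (simp del: of_nat_Suc power_Suc)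
      then have "((\<lambda>s. s ^ Suc j / fact (Suc j)) has_real_derivative (real (Suc j) * s ^ j / fact (Suc j))) (at s)"
        by (rule DERIV_cdivide)
      moreover have "real (Suc j) * s ^ j / fact (Suc j) = s ^ j / fact j"
        by (simp add: fact_Suc del: of_nat_Suc)
      ultimately show ?thesis by (simp only: has_real_derivative_iff_has_vector_derivative)
    qed
    have R_eq: "R s = (g k s - g k 0) - (\<Sum>j<m. (s ^ Suc j / fact (Suc j)) *\<^sub>R g (Suc k + j) 0)" for s
      unfolding R_def sum.lessThan_Suc_shift by simp
    have "((\<lambda>s. (g k s - g k 0) - (\<Sum>j<m. (s ^ Suc j / fact (Suc j)) *\<^sub>R g (Suc k + j) 0))
        has_vector_derivative ((g (Suc k) s - 0) - (\<Sum>j<m. (s ^ j / fact j) *\<^sub>R g (Suc k + j) 0))) (at s)"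
      by (intro has_vector_derivative_diff has_vector_derivative_sum deriv[OF k(1) s] has_vector_derivative_const
          bounded_linear.has_vector_derivative[OF bounded_linear_scaleR_left mono])
    then show ?thesis unfolding R_eq[abs_def] R'_def by simp
  qed
  have R'_bound: "norm (R' s) \<le> B" if "s \<in> {0..1}" for s
    using Suc.IH[OF _ that] Suc.prems unfolding R'_def k(2) by simp
  have B0: "0 \<le> B" by (rule order_trans[OF norm_ge_zero R'_bound[of 0]]) simp
  have "norm (R s - R 0) \<le> B * norm (s - 0)"
  proof (rule differentiable_bound[where S = "{0..1}"])
    fix u :: real assume u: "u \<in> {0..1}"
    show "(R has_derivative (\<lambda>h. h *\<^sub>R R' u)) (at u within {0..1})"
      using R_deriv[OF u] by (auto simp: has_vector_derivative_def intro: has_derivative_at_withinI)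
    show "onorm (\<lambda>h. h *\<^sub>R R' u) \<le> B"
    proof (rule onorm_le)
      fix x :: real
      have "\<bar>x\<bar> * norm (R' u) \<le> \<bar>x\<bar> * B" by (intro mult_left_mono R'_bound u) auto
      then show "norm (x *\<^sub>R R' u) \<le> B * norm x" by (simp add: mult.commute)
    qed
  qed (use Suc.prems in auto)
  also have "\<dots> \<le> B * 1" using Suc.prems B0 by (intro mult_left_mono) auto
  also have "R 0 = 0" unfolding R_def sum.lessThan_Suc_shift by simp
  finally show ?case by (simp add: R_def k_def)
qed

lemma multi_bound_diagonal:
  "multi_bound k M c \<Longrightarrow> norm (M (replicate k x)) \<le> c * norm x ^ k"
  unfolding multi_bound_def by (metis length_replicate map_replicate prod_list_replicate)

lemma multilinear_over_real:
  "multilinear_over Real_Scalars Real_Scalars k M \<longleftrightarrow>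
    (\<forall>vs i. length vs = k \<longrightarrow> i < k \<longrightarrow> linear (\<lambda>v. M (vs[i := v])))"
  by (simp add: multilinear_over_def linear_over_def)

lemma frechet_line_derivative:
  assumes F: "frechet_derivatives n V f F" and k: "k < n" and s: "s *\<^sub>R x \<in> V"
  shows "((\<lambda>s. F k (s *\<^sub>R x) (replicate k x)) has_vector_derivative F (Suc k) (s *\<^sub>R x) (replicate (Suc k) x)) (at s)"
  unfolding has_vector_derivative_def has_derivative_at_alt
proof (intro conjI allI impI)
  show "bounded_linear (\<lambda>h. h *\<^sub>R F (Suc k) (s *\<^sub>R x) (replicate (Suc k) x))"
    by (rule bounded_linear_scaleR_left)
  fix e :: real assume e: "0 < e"
  define e' where "e' = e / (norm x ^ Suc k + 1)"
  have den: "0 < norm x ^ Suc k + 1" by (simp add: add_nonneg_pos)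
  have e': "0 < e'" unfolding e'_def by (intro divide_pos_pos e den)
  have "\<forall>\<^sub>F h in nhds 0. multi_bound k (\<lambda>vs. F k (s *\<^sub>R x + h) vs - F k (s *\<^sub>R x) vs - F (Suc k) (s *\<^sub>R x) (h # vs)) (e' * norm h)"
    using F k s e' unfolding frechet_derivatives_def by blast
  then obtain d where d: "0 < d" "\<And>h. dist h 0 < d \<Longrightarrow>
      multi_bound k (\<lambda>vs. F k (s *\<^sub>R x + h) vs - F k (s *\<^sub>R x) vs - F (Suc k) (s *\<^sub>R x) (h # vs)) (e' * norm h)"
    unfolding eventually_nhds_metric by blast
  have multi: "multilinear_over Real_Scalars Real_Scalars (Suc k) (F (Suc k) (s *\<^sub>R x))"
    using F k s unfolding frechet_derivatives_def by (meson Suc_leI)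
  have lin: "F (Suc k) (s *\<^sub>R x) ((u *\<^sub>R x) # replicate k x) = u *\<^sub>R F (Suc k) (s *\<^sub>R x) (replicate (Suc k) x)" for u
  proof -
    have "linear (\<lambda>v. F (Suc k) (s *\<^sub>R x) ((replicate (Suc k) x)[0 := v]))"
      using multi[unfolded multilinear_over_real, rule_format, of "replicate (Suc k) x" 0] by simp
    from linear_scale[OF this, of u x] show ?thesis by simp
  qed
  show "\<exists>d>0. \<forall>y. norm (y - s) < d \<longrightarrow>
      norm (F k (y *\<^sub>R x) (replicate k x) - F k (s *\<^sub>R x) (replicate k x)
        - (y - s) *\<^sub>R F (Suc k) (s *\<^sub>R x) (replicate (Suc k) x)) \<le> e * norm (y - s)"
  proof (intro exI[of _ "d / (norm x + 1)"] conjI allI impI)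
    have x1: "0 < norm x + 1" by (simp add: add_nonneg_pos)
    show "0 < d / (norm x + 1)" using d(1) x1 by simp
    fix y :: real assume y: "norm (y - s) < d / (norm x + 1)"
    define h where "h = (y - s) *\<^sub>R x"
    have "norm h \<le> \<bar>y - s\<bar> * (norm x + 1)" unfolding h_def by (simp add: mult_left_mono)
    also have "\<dots> < d" using y x1 by (simp add: pos_less_divide_eq)
    finally have h: "dist h 0 < d" by simp
    have "s *\<^sub>R x + h = y *\<^sub>R x" unfolding h_def by (simp add: algebra_simps)
    then have "norm (F k (y *\<^sub>R x) (replicate k x) - F k (s *\<^sub>R x) (replicate k x)
        - (y - s) *\<^sub>R F (Suc k) (s *\<^sub>R x) (replicate (Suc k) x)) \<le> (e' * norm h) * norm x ^ k"
      using multi_bound_diagonal[OF d(2)[OF h], of x] lin[of "y - s"] unfolding h_def by simp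
    also have "\<dots> = e' * norm x ^ Suc k * norm (y - s)" unfolding h_def by simp
    also have "\<dots> \<le> e * norm (y - s)"
    proof (rule mult_right_mono)
      have "e' * norm x ^ Suc k \<le> e' * (norm x ^ Suc k + 1)" using e' by (intro mult_left_mono) auto
      also have "\<dots> = e" unfolding e'_def using den by simp
      finally show "e' * norm x ^ Suc k \<le> e" .
    qed simp
    finally show "norm (F k (y *\<^sub>R x) (replicate k x) - F k (s *\<^sub>R x) (replicate k x)
        - (y - s) *\<^sub>R F (Suc k) (s *\<^sub>R x) (replicate (Suc k) x)) \<le> e * norm (y - s)" .
  qed
qed

text \<open>
  The common consequence of the smoothness classes: an expansion at \<open>0\<close> into bounded multilinear terms,
  with a remainder one order higher. The terms need not be symmetric.
\<close>

definition taylor_expansion ::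
    "'a::real_normed_vector scalars \<Rightarrow> nat \<Rightarrow> ('a \<Rightarrow> complex) \<Rightarrow> (nat \<Rightarrow> 'a list \<Rightarrow> complex) \<Rightarrow> bool" where
  "taylor_expansion K L f M \<longleftrightarrow>
     (\<forall>k\<le>L. multilinear_over K (target_scalars K) k (M k) \<and> (\<exists>c. multi_bound k (M k) c)) \<and>
     (\<exists>\<rho>>0. \<exists>C. \<forall>x. norm x < \<rho> \<longrightarrow> norm (f x - (\<Sum>k\<le>L. M k (replicate k x))) \<le> C * norm x ^ Suc L)"

lemma taylor_expansionI:
  assumes "\<And>k. k \<le> L \<Longrightarrow> multilinear_over K (target_scalars K) k (M k) \<and> (\<exists>c. multi_bound k (M k) c)"
    and "0 < \<rho>" and "\<And>x. norm x < \<rho> \<Longrightarrow> norm (f x - (\<Sum>k\<le>L. M k (replicate k x))) \<le> C * norm x ^ Suc L"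
  shows "taylor_expansion K L f M"
  unfolding taylor_expansion_def
proof (intro conjI)
  show "\<exists>\<rho>>0. \<exists>C. \<forall>x. norm x < \<rho> \<longrightarrow> norm (f x - (\<Sum>k\<le>L. M k (replicate k x))) \<le> C * norm x ^ Suc L"
    by (rule exI[of _ \<rho>], rule conjI[OF assms(2)], rule exI[of _ C]) (use assms(3) in blast)
qed (use assms(1) in blast)

lemma taylor_expansion_finite:
  fixes f :: "'a::real_normed_vector \<Rightarrow> complex"
  assumes f: "Cb_finite n V f" and V: "open V" "0 \<in> V"
  shows "\<exists>M. \<forall>L<n. taylor_expansion Real_Scalars L f M"
proof -
  obtain F where F: "frechet_derivatives n V f F" and bd: "\<forall>k\<le>n. \<exists>c. \<forall>x\<in>V. multi_bound k (F k x) c"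
    using f unfolding Cb_finite_def by blast
  obtain \<rho> where \<rho>: "0 < \<rho>" "ball 0 \<rho> \<subseteq> V" using V openE by blast
  define M where "M k vs = F k 0 vs /\<^sub>R fact k" for k vs
  have remainder: "norm (f x - (\<Sum>k\<le>L. M k (replicate k x))) \<le> c * norm x ^ Suc L" if L: "L < n" and c: "\<And>x. x \<in> V \<Longrightarrow> multi_bound (Suc L) (F (Suc L) x) c" and x: "norm x < \<rho>" for L c x
  proof -
    have inV: "s *\<^sub>R x \<in> V" if s: "s \<in> {0..1}" for s
    proof -
      have "\<bar>s\<bar> * norm x \<le> 1 * norm x" using s by (intro mult_right_mono) auto
      then have "norm (s *\<^sub>R x) < \<rho>" using x by simp
      then show ?thesis using \<rho>(2) by auto
    qed
    define g where "g k s = F k (s *\<^sub>R x) (replicate k x)" for k s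
    have "norm (g (Suc L - Suc L) 1 - (\<Sum>j<Suc L. (1 ^ j / fact j) *\<^sub>R g (Suc L - Suc L + j) 0)) \<le> c * norm x ^ Suc L"
    proof (rule taylor_remainder_bound)
      show "(g k has_vector_derivative g (Suc k) s) (at s)" if "k < Suc L" "s \<in> {0..1}" for k s
        unfolding g_def using that L by (intro frechet_line_derivative[OF F] inV) auto
      show "norm (g (Suc L) s) \<le> c * norm x ^ Suc L" if "s \<in> {0..1}" for s
        unfolding g_def by (rule multi_bound_diagonal[OF c[OF inV[OF that]]])
    qed auto
    moreover have "g 0 1 = f x"
      using F inV[of 1] unfolding frechet_derivatives_def g_def by simp
    ultimately show ?thesis
      by (simp add: g_def M_def lessThan_Suc_atMost divide_inverse)
  qed
  have multi: "multilinear_over Real_Scalars Real_Scalars k (M k) \<and> (\<exists>c. multi_bound k (M k) c)" if k: "k \<le> n" for k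
  proof
    have Fk: "multilinear_over Real_Scalars Real_Scalars k (F k 0)" "\<exists>c. multi_bound k (F k 0) c"
      using F V k unfolding frechet_derivatives_def by auto
    have "linear (\<lambda>v. F k 0 (vs[i := v]) /\<^sub>R fact k)" if "length vs = k" "i < k" for vs i
      using Fk(1)[unfolded multilinear_over_real, rule_format, OF that]
      by (rule linear_compose_scale_right)
    then show "multilinear_over Real_Scalars Real_Scalars k (M k)"
      unfolding multilinear_over_real M_def by blast
    obtain c where c: "multi_bound k (F k 0) c" using Fk(2) by blast
    have "multi_bound k (M k) (c / fact k)"
      unfolding multi_bound_def M_def
    proof (intro allI impI)
      fix vs :: "'a list" assume "length vs = k"
      then have "norm (F k 0 vs) \<le> c * (\<Prod>v\<leftarrow>vs. norm v)" using c unfolding multi_bound_def by blast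
      then have "norm (F k 0 vs) / fact k \<le> c * (\<Prod>v\<leftarrow>vs. norm v) / fact k"
        by (rule divide_right_mono) simp
      then show "norm (F k 0 vs /\<^sub>R fact k) \<le> c / fact k * (\<Prod>v\<leftarrow>vs. norm v)"
        by (simp add: divide_inverse_commute)
    qed
    then show "\<exists>c. multi_bound k (M k) c" by blast
  qed
  have real: "target_scalars (Real_Scalars :: 'a scalars) = Real_Scalars"
    by (simp add: target_scalars_def)
  have "taylor_expansion Real_Scalars L f M" if L: "L < n" for L
  proof -
    obtain c where "\<And>x. x \<in> V \<Longrightarrow> multi_bound (Suc L) (F (Suc L) x) c" using bd L by (meson Suc_leI)
    then show ?thesis
      using multi L \<rho>(1) remainder[OF L] unfolding real[symmetric]
      by (intro taylor_expansionI[where \<rho> = \<rho> and C = c]) (simp_all only: real less_imp_le order.trans)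
  qed
  then show ?thesis by blast
qed

lemma taylor_expansion_analytic:
  fixes f :: "'a::real_normed_vector \<Rightarrow> complex"
  assumes f: "analytic_over K (target_scalars K) V f" and V: "open V" "0 \<in> V"
  shows "\<exists>M. \<forall>L. taylor_expansion K L f M"
proof -
  have "\<exists>\<rho>>0. \<exists>P c. (\<forall>k. multilinear_over K (target_scalars K) k (P k) \<and> 0 \<le> c k \<and> multi_bound k (P k) (c k)) \<and>
        summable (\<lambda>k. c k * \<rho> ^ k) \<and>
        (\<forall>h. norm h < \<rho> \<and> 0 + h \<in> V \<longrightarrow> (\<lambda>k. P k (replicate k h)) sums f (0 + h))"
    by (rule bspec[OF f[unfolded analytic_over_def] V(2)])
  then obtain \<rho> P c where \<rho>: "0 < \<rho>"
    and P': "\<forall>k. multilinear_over K (target_scalars K) k (P k) \<and> 0 \<le> c k \<and> multi_bound k (P k) (c k)"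
    and c: "summable (\<lambda>k. c k * \<rho> ^ k)"
    and sums: "\<forall>h. norm h < \<rho> \<and> 0 + h \<in> V \<longrightarrow> (\<lambda>k. P k (replicate k h)) sums f (0 + h)"
    by (elim exE conjE) (rule that, assumption+)
  have P: "\<And>k. multilinear_over K (target_scalars K) k (P k)" "\<And>k. 0 \<le> c k" "\<And>k. multi_bound k (P k) (c k)"
    using P' by auto
  obtain \<rho>' where \<rho>': "0 < \<rho>'" "ball 0 \<rho>' \<subseteq> V" using V openE by blast
  have "taylor_expansion K L f P" for L
  proof -
    define C where "C = (\<Sum>k. c (k + Suc L) * \<rho> ^ k)"
    have c_shift: "summable (\<lambda>k. c (k + Suc L) * \<rho> ^ k)"
    proof -
      have "summable (\<lambda>k. c (k + Suc L) * \<rho> ^ (k + Suc L))" using summable_ignore_initial_segment[OF c] .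
      then have "summable (\<lambda>k. c (k + Suc L) * \<rho> ^ (k + Suc L) / \<rho> ^ Suc L)" by (rule summable_divide)
      then show ?thesis using \<rho> by (simp add: power_add)
    qed
    have "norm (f x - (\<Sum>k\<le>L. P k (replicate k x))) \<le> C * norm x ^ Suc L" if x: "norm x < min \<rho> \<rho>'" for x
    proof -
      have "x \<in> V" using x \<rho>'(2) by auto
      then have "(\<lambda>k. P k (replicate k x)) sums f x" using sums[rule_format, of x] x by simp
      then have s1: "(\<lambda>k. P (k + Suc L) (replicate (k + Suc L) x)) sums (f x - (\<Sum>k<Suc L. P k (replicate k x)))"
        by (rule sums_split_initial_segment)
      have s2: "(\<lambda>k. c (k + Suc L) * \<rho> ^ k * norm x ^ Suc L) sums (C * norm x ^ Suc L)"
        unfolding C_def by (intro sums_mult2 summable_sums c_shift)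
      have s3: "norm (P (k + Suc L) (replicate (k + Suc L) x)) \<le> c (k + Suc L) * \<rho> ^ k * norm x ^ Suc L" for k
      proof -
        have "norm (P (k + Suc L) (replicate (k + Suc L) x)) \<le> c (k + Suc L) * norm x ^ (k + Suc L)"
          by (rule multi_bound_diagonal[OF P(3)])
        also have "\<dots> = c (k + Suc L) * (norm x ^ k * norm x ^ Suc L)" by (simp only: power_add)
        also have "\<dots> \<le> c (k + Suc L) * (\<rho> ^ k * norm x ^ Suc L)"
          using x P(2) by (intro mult_left_mono mult_right_mono power_mono) auto
        finally show ?thesis by (simp only: mult.assoc)
      qed
      have "norm (f x - (\<Sum>k<Suc L. P k (replicate k x))) \<le> C * norm x ^ Suc L"
        by (rule norm_sums_le[OF s1 s2 s3])
      then show ?thesis by (simp only: lessThan_Suc_atMost)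
    qed
    moreover have "0 < min \<rho> \<rho>'" using \<rho> \<rho>' by simp
    ultimately show ?thesis
      using P by (intro taylor_expansionI[where \<rho> = "min \<rho> \<rho>'" and C = C]) blast+
  qed
  then show ?thesis by blast
qed

lemma taylor_expansion_Cb:
  fixes f :: "'a::real_normed_vector \<Rightarrow> complex"
  assumes f: "Cb K (target_scalars K) r V f" and K: "K \<noteq> Real_Scalars \<longrightarrow> r = Analytic"
    and r: "below_order (int L) r" and V: "open V" "0 \<in> V"
  shows "\<exists>M. \<forall>m\<le>L. taylor_expansion K m f M"
proof (cases r)
  case (Finite_Order n)
  then have "Cb_finite n V f" "L < n" "K = Real_Scalars" using f r K by (auto simp: Cb_def)
  then show ?thesis using taylor_expansion_finite[of n V f] V by (meson le_less_trans)
next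
  case Smooth
  then have "Cb_finite (Suc L) V f" "K = Real_Scalars" using f K by (auto simp: Cb_def)
  then show ?thesis using taylor_expansion_finite[of "Suc L" V f] V by (meson le_imp_less_Suc)
next
  case Analytic
  then have "analytic_over K (target_scalars K) V f" using f by (simp add: Cb_def)
  then show ?thesis using taylor_expansion_analytic V by blast
qed

lemma Cb_bounded:
  fixes f :: "'a::real_normed_vector \<Rightarrow> complex"
  assumes "Cb K L r V f"
  shows "\<exists>B. \<forall>x\<in>V. norm (f x) \<le> B"
proof -
  have fin: "\<exists>B. \<forall>x\<in>V. norm (f x) \<le> B" if f: "Cb_finite n V f" for n
  proof -
    obtain F where F: "frechet_derivatives n V f F" and bd: "\<forall>k\<le>n. \<exists>c. \<forall>x\<in>V. multi_bound k (F k x) c"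
      using f unfolding Cb_finite_def by blast
    obtain c where c: "\<And>x. x \<in> V \<Longrightarrow> multi_bound 0 (F 0 x) c" using bd by blast
    have "norm (f x) \<le> c" if "x \<in> V" for x
      using multi_bound_diagonal[OF c[OF that], of x] F that unfolding frechet_derivatives_def by simp
    then show ?thesis by blast
  qed
  show ?thesis
  proof (cases r)
    case (Finite_Order n)
    then show ?thesis using assms fin[of n] by (simp add: Cb_def)
  next
    case Smooth
    then show ?thesis using assms fin[of 0] by (simp add: Cb_def)
  next
    case Analytic
    then show ?thesis using assms by (simp add: Cb_def bounded_iff)
  qed
qed

lemma taylor_expansion_0:
  assumes T: "taylor_expansion K L f M"
  shows "M 0 [] = f 0"
proof -
  obtain \<rho> C where \<rho>: "0 < \<rho>"
    and C: "\<And>x. norm x < \<rho> \<Longrightarrow> norm (f x - (\<Sum>k\<le>L. M k (replicate k x))) \<le> C * norm x ^ Suc L"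
    using T unfolding taylor_expansion_def by blast
  have "M k (replicate k 0) = 0" if k: "k \<le> L" "k \<noteq> 0" for k
  proof -
    obtain c where "multi_bound k (M k) c" using T k(1) unfolding taylor_expansion_def by blast
    from multi_bound_diagonal[OF this, of 0] show ?thesis using k(2) by (simp add: power_0_left)
  qed
  then have "(\<Sum>k\<le>L. M k (replicate k 0)) = (\<Sum>k\<in>{0}. M k (replicate k 0))"
    by (intro sum.mono_neutral_right) auto
  then show ?thesis using C[of 0] \<rho> by simp
qed

lemma diagonal_tendsto:
  fixes M :: "'a::real_normed_vector list \<Rightarrow> complex"
  assumes lin: "\<And>vs i. length vs = n \<Longrightarrow> i < n \<Longrightarrow> linear (\<lambda>x. M (vs[i := x]))"
    and bd: "multi_bound n M c" and z: "(z \<longlongrightarrow> y) F"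
  shows "((\<lambda>s. M (replicate n (z s))) \<longlongrightarrow> M (replicate n y)) F"
proof -
  have "((\<lambda>s. M (replicate k (z s) @ replicate (n - k) y)) \<longlongrightarrow> M (replicate n y)) F" if "k \<le> n" for k
    using that
  proof (induction k)
    case 0
    then show ?case by simp
  next
    case (Suc k)
    define r where "r = n - Suc k"
    have nk: "n - k = Suc r" "k + Suc r = n" using Suc.prems unfolding r_def by auto
    have diff: "M (replicate (Suc k) (z s) @ replicate r y) - M (replicate k (z s) @ replicate (Suc r) y)
      = M (replicate k (z s) @ (z s - y) # replicate r y)" for s
    proof -
      interpret L: linear "\<lambda>x. M ((replicate k (z s) @ 0 # replicate r y)[k := x])"
        using nk by (intro lin) auto
      have upd: "(replicate k (z s) @ 0 # replicate r y)[k := x] = replicate k (z s) @ x # replicate r y" for x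
        by (simp add: list_update_append)
      have "replicate (Suc k) (z s) @ replicate r y = replicate k (z s) @ z s # replicate r y"
        by (simp add: replicate_app_Cons_same)
      then show ?thesis using L.diff[of "z s" y] unfolding upd by simp
    qed
    have "((\<lambda>s. M (replicate k (z s) @ (z s - y) # replicate r y)) \<longlongrightarrow> 0) F"
    proof (rule Lim_null_comparison)
      show "\<forall>\<^sub>F s in F. norm (M (replicate k (z s) @ (z s - y) # replicate r y))
          \<le> c * (norm (z s) ^ k * (norm (z s - y) * norm y ^ r))"
      proof (rule always_eventually, rule allI)
        fix s
        have "length (replicate k (z s) @ (z s - y) # replicate r y) = n" using nk by simp
        then have "norm (M (replicate k (z s) @ (z s - y) # replicate r y))
          \<le> c * (\<Prod>v\<leftarrow>replicate k (z s) @ (z s - y) # replicate r y. norm v)"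
          using bd unfolding multi_bound_def by blast
        then show "norm (M (replicate k (z s) @ (z s - y) # replicate r y))
          \<le> c * (norm (z s) ^ k * (norm (z s - y) * norm y ^ r))" by simp
      qed
      have "((\<lambda>s. norm (z s - y)) \<longlongrightarrow> 0) F" using z by (simp add: tendsto_norm_zero LIM_zero)
      then have "((\<lambda>s. c * (norm (z s) ^ k * (norm (z s - y) * norm y ^ r))) \<longlongrightarrow> c * (norm y ^ k * (0 * norm y ^ r))) F"
        by (intro tendsto_intros z)
      then show "((\<lambda>s. c * (norm (z s) ^ k * (norm (z s - y) * norm y ^ r))) \<longlongrightarrow> 0) F" by simp
    qed
    from tendsto_add[OF this Suc.IH] show ?case
      using Suc.prems unfolding diff[symmetric] nk(1) r_def[symmetric] by simp
  qed
  from this[of n] show ?thesis by simp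
qed

lemma multilinear_over_complex:
  assumes K: "admissible_scalars K" and M: "multilinear_over K (target_scalars K) k M"
  shows "multilinear_over K (Complex_Scalars (*)) k M"
    and "length vs = k \<Longrightarrow> i < k \<Longrightarrow> linear (\<lambda>x. M (vs[i := x]))"
proof -
  show 1: "multilinear_over K (Complex_Scalars (*)) k M"
    using M by (cases K) (simp_all add: multilinear_over_def linear_over_def target_scalars_def)
  show "linear (\<lambda>x. M (vs[i := x]))" if "length vs = k" "i < k"
    using 1 that unfolding multilinear_over_def
    by (intro linear_over_real_linear[OF complex_target_complex K]) auto
qed

text \<open>
  The points \<open>z s\<close> vary with \<open>s\<close> because for \<open>z s = \<phi> (s x) / s\<close> the limit involves the derivative of \<open>\<phi>\<close>.
\<close>

lemma leading_term_limit:
  fixes f :: "'a::real_normed_vector \<Rightarrow> complex"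
  assumes K: "admissible_scalars K" and T: "taylor_expansion K n f M" and n: "1 \<le> n"
    and low: "\<And>k x. 1 \<le> k \<Longrightarrow> k < n \<Longrightarrow> M k (replicate k x) = 0"
    and z: "(z \<longlongrightarrow> y) (at_right 0)"
  shows "((\<lambda>s. (f (s *\<^sub>R z s) - f 0) /\<^sub>R s ^ n) \<longlongrightarrow> M n (replicate n y)) (at_right 0)"
proof -
  obtain \<rho> C where \<rho>: "0 < \<rho>"
    and C: "\<And>x. norm x < \<rho> \<Longrightarrow> norm (f x - (\<Sum>k\<le>n. M k (replicate k x))) \<le> C * norm x ^ Suc n"
    using T unfolding taylor_expansion_def by blast
  obtain c where M: "multilinear_over K (target_scalars K) n (M n)" "multi_bound n (M n) c"
    using T unfolding taylor_expansion_def by blast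
  note lin = multilinear_over_complex(2)[OF K M(1)]
  have sum: "(\<Sum>k\<le>n. M k (replicate k x)) = f 0 + M n (replicate n x)" for x
  proof -
    have "(\<Sum>k\<le>n. M k (replicate k x)) = (\<Sum>k\<in>{0, n}. M k (replicate k x))"
      using n low[of _ x] by (intro sum.mono_neutral_right) auto
    then show ?thesis using n taylor_expansion_0[OF T] by simp
  qed
  have homog: "M n (replicate n (s *\<^sub>R x)) = s ^ n *\<^sub>R M n (replicate n x)" for s x
  proof -
    have "M n (replicate k (s *\<^sub>R x) @ replicate (n - k) x) = s ^ k *\<^sub>R M n (replicate n x)" if "k \<le> n" for k
      using that
    proof (induction k)
      case (Suc k)
      define r where "r = n - Suc k"
      have nk: "n - k = Suc r" "k + Suc r = n" using Suc.prems unfolding r_def by auto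
      interpret L: linear "\<lambda>v. M n ((replicate k (s *\<^sub>R x) @ 0 # replicate r x)[k := v])"
        using nk by (intro lin) auto
      have upd: "(replicate k (s *\<^sub>R x) @ 0 # replicate r x)[k := v] = replicate k (s *\<^sub>R x) @ v # replicate r x" for v
        by (simp add: list_update_append)
      have "M n (replicate k (s *\<^sub>R x) @ (s *\<^sub>R x) # replicate r x) = s *\<^sub>R M n (replicate k (s *\<^sub>R x) @ x # replicate r x)"
        using L.scaleR[of s x] unfolding upd .
      moreover have "M n (replicate k (s *\<^sub>R x) @ x # replicate r x) = s ^ k *\<^sub>R M n (replicate n x)"
        using Suc nk(1) by simp
      ultimately show ?case
        unfolding r_def[symmetric] by (simp add: replicate_app_Cons_same)
    qed simp
    from this[of n] show ?thesis by simp
  qed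
  have err: "((\<lambda>s. (f (s *\<^sub>R z s) - f 0) /\<^sub>R s ^ n - M n (replicate n (z s))) \<longlongrightarrow> 0) (at_right 0)"
  proof (rule Lim_null_comparison)
    have "((\<lambda>s. norm (s *\<^sub>R z s)) \<longlongrightarrow> norm (0 *\<^sub>R y)) (at_right 0)"
      by (intro tendsto_intros z)
    then have "\<forall>\<^sub>F s in at_right 0. norm (s *\<^sub>R z s) < \<rho>"
      using \<rho> by (intro order_tendstoD(2)) auto
    then show "\<forall>\<^sub>F s in at_right 0. norm ((f (s *\<^sub>R z s) - f 0) /\<^sub>R s ^ n - M n (replicate n (z s)))
        \<le> C * (s * norm (z s) ^ Suc n)"
      using eventually_at_right_less[of 0]
    proof eventually_elim
      case (elim s)
      have "(f (s *\<^sub>R z s) - f 0) /\<^sub>R s ^ n - M n (replicate n (z s))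
        = (f (s *\<^sub>R z s) - (\<Sum>k\<le>n. M k (replicate k (s *\<^sub>R z s)))) /\<^sub>R s ^ n"
        using elim(2) unfolding sum homog by (simp add: scaleR_diff_right scaleR_add_right)
      also have "norm \<dots> = norm (f (s *\<^sub>R z s) - (\<Sum>k\<le>n. M k (replicate k (s *\<^sub>R z s)))) / s ^ n"
        using elim(2) by (simp add: divide_inverse mult.commute)
      also have "\<dots> \<le> C * norm (s *\<^sub>R z s) ^ Suc n / s ^ n"
        using elim(2) by (intro divide_right_mono C[OF elim(1)]) auto
      also have "\<dots> = C * (s * norm (z s) ^ Suc n)"
        using elim(2) by (simp add: power_mult_distrib)
      finally show ?case .
    qed
    have "((\<lambda>s. C * (s * norm (z s) ^ Suc n)) \<longlongrightarrow> C * (0 * norm y ^ Suc n)) (at_right 0)"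
      by (intro tendsto_intros z)
    then show "((\<lambda>s. C * (s * norm (z s) ^ Suc n)) \<longlongrightarrow> 0) (at_right 0)" by simp
  qed
  from tendsto_add[OF err diagonal_tendsto[OF lin M(2) z]] show ?thesis by simp
qed

lemma leading_term_invariant:
  fixes f :: "'a::real_normed_vector \<Rightarrow> complex"
  assumes K: "admissible_scalars K" and T: "taylor_expansion K n f M" and n: "1 \<le> n"
    and low: "\<And>k x. 1 \<le> k \<Longrightarrow> k < n \<Longrightarrow> M k (replicate k x) = 0"
    and \<phi>: "(\<phi> has_derivative A) (at 0)" "\<phi> 0 = 0"
    and V: "open V" "0 \<in> V" and inv: "\<And>x. x \<in> V \<Longrightarrow> f (\<phi> x) - f 0 = e * (f x - f 0)"
  shows "M n (replicate n (A x)) = e * M n (replicate n x)"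
proof -
  have "((\<lambda>s. s *\<^sub>R x) has_derivative (\<lambda>h. h *\<^sub>R x)) (at 0)"
    by (rule bounded_linear_imp_has_derivative[OF bounded_linear_scaleR_left])
  moreover have "(\<phi> has_derivative A) (at ((0::real) *\<^sub>R x))" using \<phi>(1) by simp
  ultimately have "(\<phi> \<circ> (\<lambda>s. s *\<^sub>R x) has_derivative A \<circ> (\<lambda>h. h *\<^sub>R x)) (at 0)"
    by (rule diff_chain_at)
  moreover have "A \<circ> (\<lambda>h. h *\<^sub>R x) = (\<lambda>h. h *\<^sub>R A x)"
    using has_derivative_linear[OF \<phi>(1)] by (simp add: linear_scale fun_eq_iff)
  ultimately have "((\<lambda>s. \<phi> (s *\<^sub>R x)) has_vector_derivative A x) (at 0)"
    by (simp add: has_vector_derivative_def comp_def)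
  from vector_derivative_imp_right_quotient[OF this]
  have z: "((\<lambda>s. \<phi> (s *\<^sub>R x) /\<^sub>R s) \<longlongrightarrow> A x) (at_right 0)" by (simp add: \<phi>(2))
  have 1: "((\<lambda>s. (f (s *\<^sub>R (\<phi> (s *\<^sub>R x) /\<^sub>R s)) - f 0) /\<^sub>R s ^ n) \<longlongrightarrow> M n (replicate n (A x))) (at_right 0)"
    by (rule leading_term_limit[OF K T n low z])
  have 2: "((\<lambda>s. e * ((f (s *\<^sub>R x) - f 0) /\<^sub>R s ^ n)) \<longlongrightarrow> e * M n (replicate n x)) (at_right 0)"
    by (intro tendsto_mult_left leading_term_limit[OF K T n low tendsto_const])
  have "((\<lambda>s. s *\<^sub>R x) \<longlongrightarrow> 0 *\<^sub>R x) (at_right 0)" by (intro tendsto_intros)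
  then have "\<forall>\<^sub>F s in at_right 0. s *\<^sub>R x \<in> V" using V by (intro topological_tendstoD) auto
  then have "\<forall>\<^sub>F s in at_right 0. e * ((f (s *\<^sub>R x) - f 0) /\<^sub>R s ^ n)
      = (f (s *\<^sub>R (\<phi> (s *\<^sub>R x) /\<^sub>R s)) - f 0) /\<^sub>R s ^ n"
    using eventually_at_right_less[of 0]
  proof eventually_elim
    case (elim s)
    then have "s *\<^sub>R (\<phi> (s *\<^sub>R x) /\<^sub>R s) = \<phi> (s *\<^sub>R x)" by simp
    then show ?case using inv[OF elim(1)] by (simp add: scaleR_conv_of_real)
  qed
  from Lim_transform_eventually[OF 2 this] 1 show ?thesis
    using tendsto_unique[OF trivial_limit_at_right_real] by blast
qed

section \<open>Principal eigenvalues generate the eigenvalues of smooth eigenfunctions\<close>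

theorem corollary3p9:
  fixes K :: "'a::banach scalars"
    and r :: smoothness
    and \<D> :: "(real \<times> 'a) set"
    and \<phi> :: "real \<Rightarrow> 'a \<Rightarrow> 'a"
    and W :: "'a set"
    and T :: "real \<Rightarrow> 'a \<Rightarrow> 'a"
    and S :: "'a set"
    and G :: "'a \<Rightarrow> 'a"
    and V :: "'a set"
    and \<psi> :: "'a \<Rightarrow> complex"
    and \<kappa> :: complex
    and l :: int
  assumes "admissible_scalars K"
    and "K \<noteq> Real_Scalars \<longrightarrow> r = Analytic"
    and "local_semiflow \<D> \<phi>"
    and "fixed_point \<D> \<phi> 0"
    and "lyapunov_stable \<D> \<phi> 0"
    and "open W" and "0 \<in> W"
    and "\<forall>t\<ge>0. Cb K K r (time_section \<D> t \<inter> W) (\<phi> t)"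
    and "\<forall>t\<ge>0. (\<phi> t has_derivative T t) (at 0)"
    and "analytic_semigroup K T"
    and "generates T S G"
    and "spectrum_over K S G \<subseteq> {\<mu>. Re \<mu> < 0}"
    and "koopman_eigenfunction K \<D> \<phi> V \<psi> \<kappa>"
    and "0 \<in> V"
    and "Cb K (target_scalars K) r V \<psi>"
    and nonconstant_near_0: "\<not> (\<forall>\<^sub>F x in nhds 0. \<psi> x = \<psi> 0)"
    and "below_order l r"
    and "ereal (of_int (l + 1)) * (SUP \<mu>\<in>spectrum_over K S G. ereal (Re \<mu>)) < ereal (Re \<kappa>)"
  shows "\<exists>n. 1 \<le> n \<and> int n \<le> l \<and> \<kappa> \<in> minkowski_multiple n (spectrum_over K S G)"
proof -
  note K = assms(1) and T = assms(10) and G = assms(11)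
  define \<Lambda> where "\<Lambda> = spectrum_over K S G"
  define s where "s = (SUP \<mu>\<in>\<Lambda>. ereal (Re \<mu>))"
  have open_V: "open V" and dom: "koopman_domain \<D> \<phi> V = {0..} \<times> V"
    and eig: "\<And>t x. (t, x) \<in> koopman_domain \<D> \<phi> V \<Longrightarrow> \<psi> (\<phi> t x) = exp (\<kappa> * of_real t) * \<psi> x"
    using assms(13) unfolding koopman_eigenfunction_def by auto
  have eigen: "\<psi> (\<phi> t x) = exp (\<kappa> * of_real t) * \<psi> x" if "0 \<le> t" "x \<in> V" for t x
    using that by (intro eig) (simp add: dom)
  have orbit: "(t, x) \<in> \<D> \<and> \<phi> t x \<in> V" if "0 \<le> t" "x \<in> V" for t x
  proof -
    have "(t, x) \<in> koopman_domain \<D> \<phi> V" using that by (simp add: dom)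
    then show ?thesis using that unfolding koopman_domain_def by auto
  qed
  have flow_add: "\<phi> t (\<phi> u x) = \<phi> (t + u) x" if "0 \<le> t" "0 \<le> u" "x \<in> V" for t u x
  proof -
    have "(u, x) \<in> \<D>" "(t, \<phi> u x) \<in> \<D>" "(t + u, x) \<in> \<D>" using that orbit by auto
    then show ?thesis using assms(3) unfolding local_semiflow_def by blast
  qed
  have fixed: "\<phi> t 0 = 0" if "0 \<le> t" for t
    using assms(4) that unfolding fixed_point_def by blast
  have nonzero: "\<not> (\<exists>\<delta>>0. \<forall>x. norm x < \<delta> \<longrightarrow> \<psi> x = \<psi> 0)"
    using nonconstant_near_0 unfolding eventually_nhds_metric by (auto simp: dist_norm)
  obtain \<delta>V where \<delta>V: "0 < \<delta>V" "ball 0 \<delta>V \<subseteq> V" using open_V assms(14) openE by blast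
  \<comment> \<open>The eigenfunction is bounded, so it cannot grow along an orbit. Together with the gap condition this
    forces \<open>l \<ge> 0\<close>, and in the last case below that the supremum of the real parts is negative.\<close>
  have Re_\<kappa>: "Re \<kappa> \<le> 0"
  proof (rule ccontr)
    assume pos: "\<not> Re \<kappa> \<le> 0"
    obtain B where B: "\<And>x. x \<in> V \<Longrightarrow> norm (\<psi> x) \<le> B" using Cb_bounded[OF assms(15)] by blast
    have zero: "\<psi> x = 0" if x: "x \<in> V" for x
    proof (rule ccontr)
      assume nz: "\<psi> x \<noteq> 0"
      have le_exp: "exp (Re \<kappa> * t) \<le> B / norm (\<psi> x)" if "0 \<le> t" for t
      proof -
        have "norm (\<psi> (\<phi> t x)) \<le> B" using B orbit[OF that x] by blast
        then show ?thesis using nz unfolding eigen[OF that x] by (simp add: norm_mult field_simps)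
      qed
      have le: "1 + Re \<kappa> * t \<le> B / norm (\<psi> x)" if "0 \<le> t" for t
        by (rule order_trans[OF exp_ge_add_one_self le_exp[OF that]])
      define t where "t = \<bar>B / norm (\<psi> x)\<bar> / Re \<kappa>"
      have t: "0 \<le> t" "Re \<kappa> * t = \<bar>B / norm (\<psi> x)\<bar>" using pos unfolding t_def by auto
      have "1 + \<bar>B / norm (\<psi> x)\<bar> \<le> B / norm (\<psi> x)" using le[OF t(1)] unfolding t(2) .
      then show False using abs_ge_self[of "B / norm (\<psi> x)"] by linarith
    qed
    have "\<psi> x = \<psi> 0" if "norm x < \<delta>V" for x
    proof -
      have "x \<in> V" using that \<delta>V(2) by auto
      then show ?thesis using zero[of x] zero[OF assms(14)] by simp
    qed
    then show False using nonzero \<delta>V(1) by blast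
  qed
  have s_le: "s \<le> 0"
    unfolding s_def using assms(12) unfolding \<Lambda>_def[symmetric]
    by (intro SUP_least) (auto intro: less_imp_le)
  have gap: "ereal (of_int (l + 1)) * s < ereal (Re \<kappa>)"
    using assms(18) unfolding s_def \<Lambda>_def .
  have l: "0 \<le> l"
  proof (rule ccontr)
    assume "\<not> 0 \<le> l"
    then have m: "real_of_int (l + 1) \<le> 0" by linarith
    have "0 \<le> ereal (of_int (l + 1)) * s"
    proof (cases s)
      case (real a)
      then show ?thesis using s_le m by (simp add: mult_nonpos_nonpos)
    next
      case MInf
      then show ?thesis using m by (cases "real_of_int (l + 1) = 0") auto
    qed (use s_le in simp)
    then have "0 < Re \<kappa>" using gap by (metis ereal_less(2) order.strict_trans1 zero_ereal_def)
    then show False using Re_\<kappa> by simp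
  qed
  define L where "L = nat l"
  have L: "int L = l" "real_of_int (l + 1) = real (Suc L)" using l unfolding L_def by auto
  have "\<exists>M. \<forall>m\<le>L. taylor_expansion K m \<psi> M"
    by (rule taylor_expansion_Cb[OF assms(15,2) _ open_V assms(14)]) (simp add: L(1) assms(17))
  then obtain M where M: "\<And>m. m \<le> L \<Longrightarrow> taylor_expansion K m \<psi> M" by blast
  have inv: "\<psi> (\<phi> t x) - \<psi> 0 = exp (\<kappa> * of_real t) * (\<psi> x - \<psi> 0)" if "0 \<le> t" "x \<in> V" for t x
    using eigen[OF that] eigen[OF that(1) assms(14)] fixed[OF that(1)] by (simp add: right_diff_distrib)
  show ?thesis
  proof (cases "\<exists>n. 1 \<le> n \<and> n \<le> L \<and> (\<exists>x. M n (replicate n x) \<noteq> 0)")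
    case True
    define n where "n = (LEAST n. 1 \<le> n \<and> n \<le> L \<and> (\<exists>x. M n (replicate n x) \<noteq> 0))"
    have n: "1 \<le> n" "n \<le> L" "\<exists>x. M n (replicate n x) \<noteq> 0"
      using LeastI_ex[OF True] unfolding n_def by blast+
    have low: "M k (replicate k x) = 0" if "1 \<le> k" "k < n" for k x
      using not_less_Least[of k "\<lambda>n. 1 \<le> n \<and> n \<le> L \<and> (\<exists>x. M n (replicate n x) \<noteq> 0)"] that n(2)
      unfolding n_def[symmetric] by auto
    have Tn: "taylor_expansion K n \<psi> M" by (rule M[OF n(2)])
    obtain c where Mn: "multilinear_over K (target_scalars K) n (M n)" "multi_bound n (M n) c"
      using Tn unfolding taylor_expansion_def by blast
    define Q where "Q = symmetrization n (M n)"
    obtain x where x: "M n (replicate n x) \<noteq> 0" using n(3) by blast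
    have "\<exists>\<mu>. (\<forall>i<n. \<mu> i \<in> spectrum_over K S G) \<and> \<kappa> = (\<Sum>i<n. \<mu> i)"
    proof (rule invariant_multilinear_form_eigenvalue[OF K T G])
      show "Q \<in> slot_forms K (*) n"
        unfolding Q_def by (rule symmetrization_slot_forms[OF K multilinear_over_complex(1)[OF K Mn(1)] Mn(2)])
      show "Q (\<lambda>_. x) \<noteq> 0"
        unfolding Q_def symmetrization_diagonal using x card_arrangements_pos[of n] by simp
      fix t :: real and v :: "nat \<Rightarrow> 'a" assume t: "0 \<le> t"
      have der: "(\<phi> t has_derivative T t) (at 0)" using assms(9) t by blast
      show "Q (\<lambda>i. if i < n then T t (v i) else v i) = exp (\<kappa> * of_real t) * Q v"
        unfolding Q_def
      proof (rule symmetrization_invariant[OF multilinear_over_complex(2)[OF K Mn(1)]])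
        show "linear (T t)" by (rule has_derivative_linear[OF der])
        show "M n (replicate n (T t x)) = exp (\<kappa> * of_real t) * M n (replicate n x)" for x
          by (rule leading_term_invariant[OF K Tn n(1) low der fixed[OF t] open_V assms(14) inv[OF t]])
      qed
    qed
    then obtain \<mu> where \<mu>: "\<forall>i<n. \<mu> i \<in> spectrum_over K S G" "\<kappa> = (\<Sum>i<n. \<mu> i)" by blast
    have "sum_list (map \<mu> [0..<n]) = \<kappa>"
      unfolding \<mu>(2) by (simp add: interv_sum_list_conv_sum_set_nat atLeast0LessThan)
    moreover have "set (map \<mu> [0..<n]) \<subseteq> spectrum_over K S G" using \<mu>(1) by auto
    ultimately have "\<kappa> \<in> minkowski_multiple n (spectrum_over K S G)"
      unfolding minkowski_multiple_def by (intro CollectI exI[of _ "map \<mu> [0..<n]"]) auto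
    then show ?thesis using n(1,2) L(1) by (intro exI[of _ n]) auto
  next
    case False
    then have diag: "M k (replicate k x) = 0" if "1 \<le> k" "k \<le> L" for k x using that by blast
    obtain \<rho> C where \<rho>: "0 < \<rho>"
      and C: "\<And>x. norm x < \<rho> \<Longrightarrow> norm (\<psi> x - (\<Sum>k\<le>L. M k (replicate k x))) \<le> C * norm x ^ Suc L"
      using M[OF order_refl] unfolding taylor_expansion_def by blast
    have sum: "(\<Sum>k\<le>L. M k (replicate k x)) = \<psi> 0" for x
    proof -
      have "(\<Sum>k\<le>L. M k (replicate k x)) = (\<Sum>k\<in>{0}. M k (replicate k x))"
        using diag[of _ x] by (intro sum.mono_neutral_right) auto
      then show ?thesis using taylor_expansion_0[OF M[OF order_refl]] by simp
    qed
    have "s < ereal (Re \<kappa> / real (Suc L))"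
      using gap s_le unfolding L(2)
      by (cases s) (auto simp: field_simps)
    then obtain q where q: "s < ereal q" "q < Re \<kappa> / real (Suc L)" using ereal_dense2 by fastforce
    \<comment> \<open>A growth rate \<open>q'\<close> strictly below \<open>q\<close> absorbs the constant in the growth bound and leaves room for
      the nonlinear part of \<open>\<phi>\<close>.\<close>
    obtain q' where q': "s < ereal q'" "q' < q" using ereal_dense2[OF q(1)] by auto
    have q0: "q < 0" using q(2) Re_\<kappa> by (meson divide_nonpos_pos of_nat_0_less_iff order.strict_trans2 zero_less_Suc)
    have q\<kappa>: "q * real (Suc L) < Re \<kappa>" using q(2) by (simp add: pos_less_divide_eq)
    obtain C' where C': "\<And>k x. norm (T (real k) x) \<le> C' * exp (q' * real k) * norm x"
    proof -
      have "Re \<mu> < q'" if "\<mu> \<in> spectrum_over K S G" for \<mu>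
      proof -
        have "ereal (Re \<mu>) \<le> s" unfolding s_def \<Lambda>_def using that by (intro SUP_upper)
        then show ?thesis using q'(1) by (metis ereal_less_eq(3) less_ereal.simps(1) order.strict_trans1)
      qed
      from analytic_semigroup_growth[OF K T G this] show ?thesis using that by blast
    qed
    have "(\<lambda>k. C' * exp (q' - q) ^ k) \<longlonglongrightarrow> C' * 0"
      using q'(2) by (intro tendsto_intros LIMSEQ_realpow_zero) auto
    then have "\<forall>\<^sub>F k in sequentially. C' * exp (q' - q) ^ k < 1 / 2"
      by (intro order_tendstoD(2)) auto
    then obtain k where k: "0 < k" "C' * exp (q' - q) ^ k < 1 / 2"
      using eventually_conj[OF _ eventually_gt_at_top[of 0]]
      by (metis (mono_tags, lifting) eventually_happens trivial_limit_sequentially)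
    \<comment> \<open>A time after which \<open>\<phi>\<close> contracts by the factor \<open>\<theta> = exp (q \<tau>)\<close> near \<open>0\<close>; one half of it is left to the
      linear part.\<close>
    define \<tau> where "\<tau> = real k"
    define \<theta> where "\<theta> = exp (q * \<tau>)"
    have \<tau>: "0 < \<tau>" using k(1) unfolding \<tau>_def by simp
    have \<theta>: "0 < \<theta>" "\<theta> < 1" using q0 \<tau> unfolding \<theta>_def by (auto simp: mult_neg_pos)
    have T_half: "norm (T \<tau> x) \<le> \<theta> / 2 * norm x" for x
    proof -
      have "exp (q' * real k) = exp (q' - q) ^ k * \<theta>"
        unfolding \<theta>_def \<tau>_def exp_of_nat_mult[symmetric] exp_add[symmetric] by (simp add: algebra_simps)
      then have "C' * exp (q' * real k) = (C' * exp (q' - q) ^ k) * \<theta>" by simp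
      also have "\<dots> \<le> 1 / 2 * \<theta>" using k(2) \<theta>(1) by (intro mult_right_mono) auto
      finally have "C' * exp (q' * real k) * norm x \<le> \<theta> / 2 * norm x" by (intro mult_right_mono) auto
      then show ?thesis using C'[of k x] unfolding \<tau>_def by simp
    qed
    have "(\<phi> \<tau> has_derivative T \<tau>) (at 0)" using assms(9) \<tau> by simp
    then have "\<exists>d>0. \<forall>x. norm (x - 0) < d \<longrightarrow> norm (\<phi> \<tau> x - \<phi> \<tau> 0 - T \<tau> (x - 0)) \<le> \<theta> / 2 * norm (x - 0)"
      using \<theta>(1) unfolding has_derivative_at_alt by (meson half_gt_zero)
    then obtain d where d: "0 < d" "\<And>x. norm x < d \<Longrightarrow> norm (\<phi> \<tau> x - T \<tau> x) \<le> \<theta> / 2 * norm x"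
      using fixed \<tau> by auto
    have contract: "norm (\<phi> \<tau> x) \<le> \<theta> * norm x" if "norm x < d" for x
      using norm_triangle_sub[of "\<phi> \<tau> x" "T \<tau> x"] d(2)[OF that] T_half[of x] by (simp add: field_simps)
    define \<delta> where "\<delta> = min d (min \<rho> \<delta>V)"
    have "\<psi> x = \<psi> 0" if x: "norm x < \<delta>" for x
    proof -
      have xV: "x \<in> V" using x \<delta>V(2) unfolding \<delta>_def by auto
      have it: "norm (\<phi> (real j * \<tau>) x) \<le> \<theta> ^ j * norm x" for j
      proof (induction j)
        case 0
        then show ?case using assms(3) unfolding local_semiflow_def by simp
      next
        case (Suc j)
        have "\<theta> ^ j \<le> 1" using \<theta> by (intro power_le_one) auto
        then have "\<theta> ^ j * norm x \<le> 1 * norm x" by (intro mult_right_mono) auto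
        then have small: "norm (\<phi> (real j * \<tau>) x) < d" using Suc x unfolding \<delta>_def by linarith
        have "\<phi> (real (Suc j) * \<tau>) x = \<phi> \<tau> (\<phi> (real j * \<tau>) x)"
          using flow_add[of \<tau> "real j * \<tau>" x] \<tau> xV by (simp add: algebra_simps)
        then have "norm (\<phi> (real (Suc j) * \<tau>) x) \<le> \<theta> * norm (\<phi> (real j * \<tau>) x)"
          using contract[OF small] by simp
        also have "\<dots> \<le> \<theta> * (\<theta> ^ j * norm x)" using Suc \<theta> by (intro mult_left_mono) auto
        finally show ?case by simp
      qed
      \<comment> \<open>In \<open>j\<close> steps, \<open>\<psi> - \<psi> 0\<close> gains \<open>\<theta> ^ (L + 1)\<close> per step by its order of vanishing, and loses
        \<open>exp (- Re \<kappa> \<tau>)\<close> by the eigenfunction equation.\<close>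
      define \<beta> where "\<beta> = exp (- (Re \<kappa> * \<tau>)) * \<theta> ^ Suc L"
      have \<beta>: "0 \<le> \<beta>" "\<beta> < 1"
      proof -
        have "\<beta> = exp ((q * real (Suc L) - Re \<kappa>) * \<tau>)"
          unfolding \<beta>_def \<theta>_def exp_of_nat_mult[symmetric] exp_add[symmetric] by (simp add: algebra_simps)
        then show "0 \<le> \<beta>" "\<beta> < 1" using q\<kappa> \<tau> by (auto simp: mult_neg_pos)
      qed
      have bound: "norm (\<psi> x - \<psi> 0) \<le> \<bar>C\<bar> * norm x ^ Suc L * \<beta> ^ j" for j
      proof -
        define y where "y = \<phi> (real j * \<tau>) x"
        have jt: "0 \<le> real j * \<tau>" using \<tau> by simp
        have "\<theta> ^ j \<le> 1" using \<theta> by (intro power_le_one) auto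
        then have "\<theta> ^ j * norm x \<le> 1 * norm x" by (intro mult_right_mono) auto
        then have y: "norm y < \<rho>" using it[of j] x unfolding \<delta>_def y_def by linarith
        have "norm (\<psi> y - \<psi> 0) = exp (Re \<kappa> * (real j * \<tau>)) * norm (\<psi> x - \<psi> 0)"
          unfolding y_def inv[OF jt xV] by (simp add: norm_mult)
        then have "norm (\<psi> x - \<psi> 0) = exp (- (Re \<kappa> * (real j * \<tau>))) * norm (\<psi> y - \<psi> 0)"
          by (simp add: exp_minus field_simps)
        also have "\<dots> \<le> exp (- (Re \<kappa> * (real j * \<tau>))) * (\<bar>C\<bar> * (\<theta> ^ j * norm x) ^ Suc L)"
        proof (intro mult_left_mono)
          have "norm (\<psi> y - \<psi> 0) \<le> C * norm y ^ Suc L" using C[OF y] unfolding sum .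
          also have "\<dots> \<le> \<bar>C\<bar> * norm y ^ Suc L" by (intro mult_right_mono) auto
          also have "\<dots> \<le> \<bar>C\<bar> * (\<theta> ^ j * norm x) ^ Suc L"
            using it[of j] unfolding y_def by (intro mult_left_mono power_mono) auto
          finally show "norm (\<psi> y - \<psi> 0) \<le> \<bar>C\<bar> * (\<theta> ^ j * norm x) ^ Suc L" .
        qed simp
        also have "exp (- (Re \<kappa> * (real j * \<tau>))) = exp (- (Re \<kappa> * \<tau>)) ^ j"
          by (simp add: exp_of_nat_mult[symmetric])
        also have "(\<theta> ^ j * norm x) ^ Suc L = (\<theta> ^ Suc L) ^ j * norm x ^ Suc L"
          by (simp only: power_mult_distrib power_mult[symmetric] mult.commute)
        also have "exp (- (Re \<kappa> * \<tau>)) ^ j * (\<bar>C\<bar> * ((\<theta> ^ Suc L) ^ j * norm x ^ Suc L))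
          = \<bar>C\<bar> * norm x ^ Suc L * \<beta> ^ j"
          unfolding \<beta>_def power_mult_distrib by (simp only: mult_ac)
        finally show ?thesis .
      qed
      have "(\<lambda>j. \<bar>C\<bar> * norm x ^ Suc L * \<beta> ^ j) \<longlonglongrightarrow> \<bar>C\<bar> * norm x ^ Suc L * 0"
        using \<beta> by (intro tendsto_intros LIMSEQ_realpow_zero)
      then have "norm (\<psi> x - \<psi> 0) \<le> \<bar>C\<bar> * norm x ^ Suc L * 0"
        by (rule LIMSEQ_le_const) (use bound in blast)
      then show ?thesis by simp
    qed
    moreover have "0 < \<delta>" using d(1) \<rho> \<delta>V(1) unfolding \<delta>_def by simp
    ultimately show ?thesis using nonzero by blast
  qed
qed

end
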